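(* Let $\alpha\in(0,1)$. For any $\varepsilon>0$, there exists $\theta_0\in\mathcal{C}^{0,\alpha}_c(\mathbb{R}^2)$ satisfying $\|\theta_0\|_{\mathcal{C}^{0,\alpha}}<\varepsilon$ such that, for any $\delta>0$, there is no odd-odd symmetric solution to $$\partial_t\theta+u\cdot\nabla\theta=0,\qquad u=\nabla^\perp(-\Delta)^{-1+\frac{\alpha}{2}}\theta,\qquad x\in\mathbb{R}^2,\ t>0,$$ with initial data $\theta_0$ belonging to $L^\infty([0,\delta];\mathcal{C}^{0,\alpha}(\mathbb{R}^2))$.
   Context: Here $\nabla^\perp=(\partial_{x_2},-\partial_{x_1})$, and the velocity is given by $$u(t,x)=\int_{\mathbb{R}^2}\frac{(x-y)^\perp}{|x-y|^{2+\alpha}}\theta(t,y)\,dy,\qquad z^\perp=(-z_2,z_1),$$ where the multiplicative constant $c_\alpha>0$ in front of the kernel is normalized to $1$. Solutions are understood in the sense of distributions. $\mathcal{C}^{0,\alpha}(\mathbb{R}^2)$ is the H\"older space with norm $\|f\|_{\mathcal{C}^{0,\alpha}}=\|f\|_{L^\infty}+\sup_{x\ne y}\frac{|f(x)-f(y)|}{|x-y|^\alpha}$, and $\mathcal{C}^{0,\alpha}_c(\mathbb{R}^2)$ is its subset of compactly supported functions. A function $\theta$ on $\mathbb{R}^2$ is odd-odd symmetric if it is odd with respect to both axes: $\theta(x_1,x_2)=-\theta(x_1,-x_2)=-\theta(-x_1,x_2)=\theta(-x_1,-x_2)$; a solution is odd-odd symmetric if $\theta(t,\cdot)$ is so at each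 time. *)

theory Defs
  imports "HOL-Analysis.Analysis"
begin

definition perp :: "real^2 \<Rightarrow> real^2" where
  "perp z = vector [- z $ 2, z $ 1]"

definition odd_odd :: "(real^2 \<Rightarrow> real) \<Rightarrow> bool" where
  "odd_odd f \<longleftrightarrow> (\<forall>a b.
     f (vector [a, b]) = - f (vector [a, - b]) \<and>
     f (vector [a, b]) = - f (vector [- a, b]) \<and>
     f (vector [a, b]) = f (vector [- a, - b]))"

definition compactly_supported :: "('a::topological_space \<Rightarrow> real) \<Rightarrow> bool" where
  "compactly_supported f \<longleftrightarrow> compact (closure {x. f x \<noteq> 0})"

text \<open>The norm takes the value \<open>\<infinity>\<close> exactly off the Hoelder space; functions in the
  space are continuous, so the pointwise supremum is the \<open>L\<^sup>\<infinity>\<close> norm.\<close>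

definition holder_norm :: "real \<Rightarrow> (real^2 \<Rightarrow> real) \<Rightarrow> ennreal" where
  "holder_norm \<alpha> f =
     (SUP x. ennreal \<bar>f x\<bar>) +
     (SUP (x, y) \<in> {(x, y). x \<noteq> y}. ennreal (\<bar>f x - f y\<bar> / norm (x - y) powr \<alpha>))"

definition holder_space :: "real \<Rightarrow> (real^2 \<Rightarrow> real) set" where
  "holder_space \<alpha> = {f. holder_norm \<alpha> f < \<infinity>}"

definition Linfty_holder :: "real \<Rightarrow> real \<Rightarrow> (real \<Rightarrow> real^2 \<Rightarrow> real) set" where
  "Linfty_holder \<alpha> \<delta> = {\<theta>.
     (\<lambda>(t, x). \<theta> t x) \<in> borel_measurable (lebesgue_on ({0..\<delta>} \<times> UNIV)) \<and>
     (\<exists>M::real. AE t in lebesgue_on {0..\<delta>}. \<theta> t \<in> holder_space \<alpha> \<and> holder_norm \<alpha> (\<theta> t) \<le> ennreal M)}"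

text \<open>The kernel decays only like \<open>\<bar>y\<bar> powr (- 1 - \<alpha>)\<close>, which is not integrable at infinity
  in the plane, so for a bounded \<open>f\<close> without decay the velocity integral is understood as the limit
  of its truncations. The limit exists for every bounded measurable odd-odd \<open>f\<close>, because
  the kernel summed over the reflections of \<open>y\<close> decays faster, and it is the
  Lebesgue integral whenever the latter converges absolutely.\<close>

definition has_velocity :: "real \<Rightarrow> (real^2 \<Rightarrow> real) \<Rightarrow> (real^2 \<Rightarrow> real^2) \<Rightarrow> bool" where
  "has_velocity \<alpha> f v \<longleftrightarrow> (\<forall>x.
     ((\<lambda>R. LINT y : ball 0 R | lebesgue.
            (f y / norm (x - y) powr (2 + \<alpha>)) *\<^sub>R perp (x - y)) \<longlongrightarrow> v x) at_top)"

primrec Ck :: "nat \<Rightarrow> ('a::euclidean_space \<Rightarrow> real) \<Rightarrow> bool" where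
  "Ck 0 f \<longleftrightarrow> continuous_on UNIV f"
| "Ck (Suc k) f \<longleftrightarrow> (\<forall>p. f differentiable (at p)) \<and>
     (\<forall>b\<in>Basis. Ck k (\<lambda>p. frechet_derivative f (at p) b))"

text \<open>Restricted to \<open>t \<ge> 0\<close> these are the smooth functions with compact support in
  \<open>[0,\<delta>) \<times> \<real>\<^sup>2\<close>; they need not vanish at \<open>t = 0\<close>.\<close>

definition test_functions :: "real \<Rightarrow> (real \<times> (real^2) \<Rightarrow> real) set" where
  "test_functions \<delta> = {\<phi>. (\<forall>k. Ck k \<phi>) \<and> compactly_supported \<phi> \<and>
     closure {p. \<phi> p \<noteq> 0} \<subseteq> {..<\<delta>} \<times> UNIV}"

text \<open>Distributional solutions on \<open>[0,\<delta>]\<close>, with the initial data in the weak formulation.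
  As \<open>u\<close> is divergence free, \<open>u \<bullet> \<nabla>\<theta>\<close> is the divergence of \<open>\<theta> u\<close>; the term
  \<open>frechet_derivative (\<lambda>y. \<phi> (t, y)) (at x) (u t x)\<close> is \<open>u \<bullet> \<nabla>\<phi>\<close>.\<close>

definition gsqg_solution ::
  "real \<Rightarrow> real \<Rightarrow> (real^2 \<Rightarrow> real) \<Rightarrow> (real \<Rightarrow> real^2 \<Rightarrow> real) \<Rightarrow> bool" where
  "gsqg_solution \<alpha> \<delta> \<theta>0 \<theta> \<longleftrightarrow> (\<exists>u.
     (AE t in lebesgue_on {0..\<delta>}. has_velocity \<alpha> (\<theta> t) (u t)) \<and>
     (\<forall>\<phi>\<in>test_functions \<delta>.
        has_bochner_integral (lebesgue_on ({0..\<delta>} \<times> UNIV))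
          (\<lambda>(t, x). \<theta> t x * (deriv (\<lambda>s. \<phi> (s, x)) t +
                             frechet_derivative (\<lambda>y. \<phi> (t, y)) (at x) (u t x)))
          (- (LINT x | lebesgue. \<theta>0 x * \<phi> (0, x)))))"

end

theory Submission
  imports Defs
begin

text \<open>The datum is \<open>c sgn (x\<^sub>1 x\<^sub>2) min(\<bar>x\<^sub>1\<bar>, \<bar>x\<^sub>2\<bar>)\<^sup>\<alpha>\<close> near the origin: homogeneous of degree \<open>\<alpha>\<close>, hence exactly
  as rough at the origin as the Hoelder class permits.

  For an odd-odd function \<open>f\<close> with Hoelder bound \<open>M\<close>, the velocity on the ball of radius \<open>\<rho>/2\<close> is
  \<open>S (x\<^sub>1, -x\<^sub>2) + O(M \<rho>)\<close>, where \<open>S\<close> is the integral of \<open>(2+\<alpha>) y\<^sub>1 y\<^sub>2 \<bar>y\<bar> powr (-4-\<alpha>) f(y)\<close> over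
  \<open>\<bar>y\<bar> > \<rho>\<close> (\<open>velocity_estimate\<close>): the reflections kill every other term of the first order
  expansion of the kernel. For the datum every dyadic annulus contributes the same positive amount to
  \<open>S\<close>, so the rate of strain diverges logarithmically as \<open>\<rho>\<close> tends to \<open>0\<close>.

  Suppose that a solution stays bounded in the Hoelder norm by \<open>M\<close>. Let \<open>L \<rho> t\<close> be its rate of strain at
  scale \<open>\<rho>\<close> and \<open>G \<rho> t\<close> the integral of \<open>L \<rho>\<close> over \<open>[0,t]\<close>. Since the remainder of the velocity is
  \<open>O(M \<rho>)\<close>, on the scale \<open>\<rho>\<close> the solution is transported by the hyperbolic map
  \<open>(x\<^sub>1, x\<^sub>2) \<mapsto> (exp G x\<^sub>1, exp (-G) x\<^sub>2)\<close> with an error that is small relative to \<open>\<rho> powr \<alpha>\<close> on a time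
  interval that does not depend on \<open>\<rho>\<close>, as long as \<open>G\<close> is bounded (\<open>tracking\<close>). Three consequences
  contradict each other.

  \<^item> \<open>G\<close> is bounded uniformly in \<open>\<rho>\<close> (\<open>deformation_bounded\<close>): a hyperbolic map with large \<open>\<bar>G\<bar>\<close> carries
    a value of size \<open>\<rho> powr \<alpha>\<close> to distance \<open>exp (-\<bar>G\<bar>) \<rho>\<close> from an axis, where an odd-odd
    function with Hoelder bound \<open>M\<close> is at most \<open>M (exp (-\<bar>G\<bar>) \<rho>) powr \<alpha>\<close>.

  \<^item> With bounded deformation, every small dyadic annulus keeps contributing at least a fixed positive
    amount to the rate of strain (\<open>strain_increment\<close>).

  \<^item> Summation over \<open>n\<close> annuli makes \<open>L\<close>, and thus \<open>G\<close>, arbitrarily large on a fixed time interval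
    (\<open>no_holder_solution\<close>).

  Tracking is extracted from the weak formulation: the test functions are bumps that are carried along
  by the hyperbolic maps whose exponent is a polynomial in time that approximates \<open>G\<close>.\<close>

section \<open>Smooth functions\<close>

text \<open>The predicate \<open>Ck\<close> recurses through partial derivatives. Membership in it is derived from closure
  under sums, products and composition with functions of one real variable, each by induction on the
  order.\<close>

definition smooth :: "('a::euclidean_space \<Rightarrow> real) \<Rightarrow> bool" where
  "smooth f \<longleftrightarrow> (\<forall>k. Ck k f)"

lemma Ck_SucI:
  assumes "\<And>p. (f has_derivative f' p) (at p)"
    and "\<And>b. b \<in> Basis \<Longrightarrow> Ck k (\<lambda>p. f' p b)"
  shows "Ck (Suc k) f"
proof -
  have "frechet_derivative f (at p) = f' p" for p
    using assms(1) frechet_derivative_at by metis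
  then show ?thesis
    using assms by (auto simp: differentiable_def)
qed

lemma Ck_SucI_real:
  fixes h :: "real \<Rightarrow> real"
  assumes "\<And>x. (h has_real_derivative h' x) (at x)" and "Ck k h'"
  shows "Ck (Suc k) h"
  by (rule Ck_SucI[where f'="\<lambda>p. (*) (h' p)"])
    (use assms in \<open>auto simp: has_field_derivative_def\<close>)

lemma Ck_Suc_D: "Ck (Suc k) f \<Longrightarrow> Ck k f"
proof (induction k arbitrary: f)
  case 0
  then show ?case
    by (auto intro!: differentiable_imp_continuous_on simp: differentiable_on_def)
next
  case (Suc k)
  then show ?case by (metis Ck.simps(2))
qed

lemma Ck_has_derivative:
  "Ck (Suc k) f \<Longrightarrow> (f has_derivative frechet_derivative f (at p)) (at p)"
  by (simp add: frechet_derivative_works[symmetric])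

lemma Ck_const: "Ck k (\<lambda>_. c)"
proof (induction k arbitrary: c)
  case (Suc k)
  show ?case by (rule Ck_SucI[where f'="\<lambda>_ _. 0"]) (use Suc in auto)
qed simp

lemma Ck_bounded_linear: "bounded_linear f \<Longrightarrow> Ck k f"
proof (cases k)
  case 0
  then show "bounded_linear f \<Longrightarrow> ?thesis" by (simp add: linear_continuous_on)
next
  case (Suc j)
  assume "bounded_linear f"
  then show ?thesis unfolding Suc
    by (intro Ck_SucI[where f'="\<lambda>_. f"]) (auto simp: bounded_linear_imp_has_derivative Ck_const)
qed

lemma Ck_add: "Ck k f \<Longrightarrow> Ck k g \<Longrightarrow> Ck k (\<lambda>p. f p + g p)"
proof (induction k arbitrary: f g)
  case 0
  then show ?case by (simp add: continuous_on_add)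
next
  case (Suc k)
  show ?case
    by (rule Ck_SucI[where f'="\<lambda>p b. frechet_derivative f (at p) b + frechet_derivative g (at p) b"])
      (use Suc in \<open>auto intro!: derivative_intros Ck_has_derivative\<close>)
qed

lemma Ck_mult: "Ck k f \<Longrightarrow> Ck k g \<Longrightarrow> Ck k (\<lambda>p. f p * g p)"
proof (induction k arbitrary: f g)
  case 0
  then show ?case by (simp add: continuous_on_mult)
next
  case (Suc k)
  have *: "Ck k f" "Ck k g" using Suc.prems Ck_Suc_D by blast+
  show ?case
    by (rule Ck_SucI[where f'="\<lambda>p b. f p * frechet_derivative g (at p) b + frechet_derivative f (at p) b * g p"])
      (use Suc * in \<open>auto intro!: has_derivative_mult Ck_has_derivative Ck_add\<close>)
qed

lemma Ck_compose:
  fixes h :: "real \<Rightarrow> real"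
  shows "Ck k h \<Longrightarrow> Ck k f \<Longrightarrow> Ck k (\<lambda>p. h (f p))"
proof (induction k arbitrary: h f)
  case 0
  then show ?case using continuous_on_compose2[of UNIV h UNIV f] by simp
next
  case (Suc k)
  have *: "Ck k f" using Suc.prems Ck_Suc_D by blast
  show ?case
  proof (rule Ck_SucI[where f'="\<lambda>p b. frechet_derivative h (at (f p)) (frechet_derivative f (at p) b)"])
    show "((\<lambda>p. h (f p)) has_derivative (\<lambda>b. frechet_derivative h (at (f p)) (frechet_derivative f (at p) b))) (at p)" for p
      by (rule has_derivative_compose[OF Ck_has_derivative[OF Suc.prems(2)] Ck_has_derivative[OF Suc.prems(1)]])
    fix b :: 'a
    assume b: "b \<in> Basis"
    have lin: "linear (frechet_derivative h (at y))" for y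
      using Suc.prems(1) by (simp add: linear_frechet_derivative)
    have "frechet_derivative h (at y) x = x * frechet_derivative h (at y) 1" for x y
      using linear_cmul[OF lin, of y x 1] by simp
    then have eq: "(\<lambda>p. frechet_derivative h (at (f p)) (frechet_derivative f (at p) b))
       = (\<lambda>p. frechet_derivative f (at p) b * frechet_derivative h (at (f p)) 1)"
      by (intro ext)
    show "Ck k (\<lambda>p. frechet_derivative h (at (f p)) (frechet_derivative f (at p) b))"
      unfolding eq
    proof (rule Ck_mult)
      show "Ck k (\<lambda>p. frechet_derivative f (at p) b)" using Suc.prems(2) b by simp
      have "Ck k (\<lambda>y. frechet_derivative h (at y) 1)" using Suc.prems(1) by simp
      from Suc.IH[OF this *] show "Ck k (\<lambda>p. frechet_derivative h (at (f p)) 1)" .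
    qed
  qed
qed

lemma smooth_const: "smooth (\<lambda>_. c)"
  and smooth_bounded_linear: "bounded_linear l \<Longrightarrow> smooth l"
  and smooth_add: "smooth f \<Longrightarrow> smooth g \<Longrightarrow> smooth (\<lambda>p. f p + g p)"
  and smooth_mult: "smooth f \<Longrightarrow> smooth g \<Longrightarrow> smooth (\<lambda>p. f p * g p)"
  and smooth_compose: "smooth (h :: real \<Rightarrow> real) \<Longrightarrow> smooth f \<Longrightarrow> smooth (\<lambda>p. h (f p))"
  by (simp_all add: smooth_def Ck_const Ck_bounded_linear Ck_add Ck_mult Ck_compose)

lemma smooth_uminus: "smooth f \<Longrightarrow> smooth (\<lambda>p. - f p)"
  using smooth_mult[OF smooth_const[of "-1"]] by force

lemma smooth_diff: "smooth f \<Longrightarrow> smooth g \<Longrightarrow> smooth (\<lambda>p. f p - g p)"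
  using smooth_add[OF _ smooth_uminus] by force

lemma smooth_ident: "smooth (\<lambda>x::real. x)"
  by (simp add: smooth_bounded_linear bounded_linear_ident)

lemma smooth_power: "smooth f \<Longrightarrow> smooth (\<lambda>p. f p ^ n)"
  by (induction n) (auto simp: smooth_const smooth_mult)

lemma smooth_sum: "(\<And>i. i \<in> I \<Longrightarrow> smooth (f i)) \<Longrightarrow> smooth (\<lambda>p. \<Sum>i\<in>I. f i p)"
  by (induction I rule: infinite_finite_induct) (auto simp: smooth_const smooth_add)

lemma smooth_real_derivative:
  fixes h :: "real \<Rightarrow> real"
  assumes "\<And>x. (h has_real_derivative h' x) (at x)" and "smooth h'"
  shows "smooth h"
  unfolding smooth_def
proof
  fix k
  have "Ck (Suc k) h" using assms by (intro Ck_SucI_real) (auto simp: smooth_def)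
  then show "Ck k h" by (rule Ck_Suc_D)
qed

lemma smooth_exp: "smooth (exp :: real \<Rightarrow> real)"
  unfolding smooth_def
proof
  fix k show "Ck k (exp :: real \<Rightarrow> real)"
    by (induction k) (auto intro!: Ck_SucI_real DERIV_exp continuous_on_exp continuous_on_id simp del: Ck.simps(2))
qed

lemma smooth_continuous_on: "smooth f \<Longrightarrow> continuous_on S f"
  by (metis Ck.simps(1) smooth_def continuous_on_subset subset_UNIV)

lemma smooth_has_derivative: "smooth f \<Longrightarrow> (f has_derivative frechet_derivative f (at p)) (at p)"
  using Ck_has_derivative smooth_def by blast

text \<open>\<open>flat n\<close> is \<open>x\<^sup>-\<^sup>n exp (- 1/x)\<close>, extended by zero to \<open>x \<le> 0\<close>. Differentiation
  maps this family into its own span, so one induction on the order of differentiability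
  treats all members at once.\<close>

definition flat :: "nat \<Rightarrow> real \<Rightarrow> real" where
  "flat n x = (if x > 0 then inverse x ^ n * exp (- inverse x) else 0)"

lemma flat_tendsto_0: "((\<lambda>x. inverse x ^ n * exp (- inverse x)) \<longlongrightarrow> 0) (at_right (0::real))"
proof -
  have "((\<lambda>y::real. y ^ n * exp (- y)) \<longlongrightarrow> 0) at_top"
    using tendsto_power_div_exp_0[of n] by (simp add: exp_minus divide_inverse)
  then show ?thesis
    using filterlim_compose[OF _ filterlim_inverse_at_top_right] by blast
qed

lemma flat_DERIV: "(flat n has_real_derivative (- real n * flat (Suc n) x + flat (Suc (Suc n)) x)) (at x)"
proof -
  consider "x > 0" | "x < 0" | "x = 0" by linarith
  then show ?thesis
  proof cases
    case 1
    define z where "z = inverse x"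
    have "((\<lambda>x. inverse x ^ n * exp (- inverse x)) has_real_derivative
        real n * z ^ (n - 1) * - (z * z) * exp (- z) + z ^ n * (exp (- z) * (z * z))) (at x)"
      unfolding z_def using 1 by (auto intro!: derivative_eq_intros)
    moreover have "real n * z ^ (n - 1) * - (z * z) * exp (- z) + z ^ n * (exp (- z) * (z * z))
        = - real n * flat (Suc n) x + flat (Suc (Suc n)) x"
      using 1 by (cases n) (auto simp: flat_def z_def[symmetric] algebra_simps)
    ultimately have "((\<lambda>x. inverse x ^ n * exp (- inverse x)) has_real_derivative
        (- real n * flat (Suc n) x + flat (Suc (Suc n)) x)) (at x)"
      by simp
    moreover have "\<forall>\<^sub>F y in nhds x. flat n y = inverse y ^ n * exp (- inverse y)"
      using eventually_nhds_in_open[of "{0<..}" x] 1 by (auto elim!: eventually_mono simp: flat_def)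
    ultimately show ?thesis by (subst DERIV_cong_ev[OF refl _ refl]) auto
  next
    case 2
    have "\<forall>\<^sub>F y in nhds x. flat n y = 0"
      using eventually_nhds_in_open[of "{..<0}" x] 2 by (auto elim!: eventually_mono simp: flat_def)
    then show ?thesis using 2 by (subst DERIV_cong_ev[OF refl _ refl]) (auto simp: flat_def)
  next
    case 3
    have "((\<lambda>y. flat n y / y) \<longlongrightarrow> 0) (at_right 0)"
      using flat_tendsto_0[of "Suc n"]
      by (rule Lim_transform_eventually)
        (auto simp: eventually_at_right_less flat_def field_simps eventually_at_topological intro!: exI[of _ UNIV])
    moreover have "((\<lambda>y. flat n y / y) \<longlongrightarrow> 0) (at_left 0)"
      by (rule Lim_transform_eventually[of "\<lambda>_. 0"])
        (auto simp: flat_def eventually_at_topological intro!: exI[of _ UNIV])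
    ultimately have "((\<lambda>y. flat n y / y) \<longlongrightarrow> 0) (at 0)"
      by (simp add: filterlim_split_at)
    then show ?thesis using 3 by (simp add: has_field_derivative_iff flat_def)
  qed
qed

lemma smooth_flat: "smooth (flat n)"
  unfolding smooth_def
proof
  fix k show "Ck k (flat n)"
  proof (induction k arbitrary: n)
    case 0
    show ?case using flat_DERIV by (auto intro: DERIV_atLeastAtMost_imp_continuous_on continuous_at_imp_continuous_on DERIV_isCont)
  next
    case (Suc k)
    show ?case by (rule Ck_SucI_real[OF flat_DERIV]) (intro Ck_add Ck_mult Ck_const Suc)
  qed
qed

definition bump :: "real \<Rightarrow> real" where
  "bump s = flat 0 (1 - s) * flat 0 (1 + s)"

lemma bump_nonneg: "0 \<le> bump s"
  and bump_pos: "\<bar>s\<bar> < 1 \<Longrightarrow> 0 < bump s"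
  and bump_zero: "1 \<le> \<bar>s\<bar> \<Longrightarrow> bump s = 0"
  by (auto simp: bump_def flat_def)

lemma bump_le_1: "bump s \<le> 1"
  by (auto simp: bump_def flat_def intro!: mult_le_one)

lemma smooth_bump: "smooth bump"
  unfolding bump_def
  by (intro smooth_mult smooth_compose[OF smooth_flat] smooth_diff smooth_add smooth_const smooth_ident)

definition bump' :: "real \<Rightarrow> real" where
  "bump' s = frechet_derivative bump (at s) 1"

lemma bump_DERIV: "(bump has_real_derivative bump' s) (at s)"
proof -
  have *: "bump differentiable at s" using smooth_bump Ck.simps(2) smooth_def by blast
  have "linear (frechet_derivative bump (at s))"
    using * by (simp add: linear_frechet_derivative)
  then have "frechet_derivative bump (at s) (x * 1) = x * bump' s" for x
    using linear_cmul[of "frechet_derivative bump (at s)" x 1]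
    unfolding real_scaleR_def bump'_def by blast
  then have "frechet_derivative bump (at s) x = bump' s * x" for x
    by (metis mult.right_neutral mult.commute)
  then have "frechet_derivative bump (at s) = (*) (bump' s)" by (intro ext)
  then show ?thesis
    using smooth_has_derivative[OF smooth_bump, of s] by (simp add: has_field_derivative_def)
qed

lemma continuous_bump': "continuous_on S bump'"
proof -
  have "Ck (Suc 0) bump" using smooth_bump smooth_def by blast
  then have "continuous_on UNIV bump'" by (simp add: bump'_def[abs_def])
  then show ?thesis using continuous_on_subset by blast
qed

lemma bump'_zero: "1 < \<bar>s\<bar> \<Longrightarrow> bump' s = 0"
proof -
  assume "1 < \<bar>s\<bar>"
  then have "\<forall>\<^sub>F y in nhds s. bump y = 0"
    by (intro eventually_mono[OF eventually_nhds_in_open[of "{1<..} \<union> {..<-1}" s]] bump_zero) auto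
  then have "(bump has_real_derivative 0) (at s)"
    by (subst DERIV_cong_ev[OF refl _ refl]) auto
  then show ?thesis using bump_DERIV DERIV_unique by blast
qed

lemma bump'_bounded: obtains C where "C \<ge> 1" "\<And>s. \<bar>bump' s\<bar> \<le> C"
proof -
  have "bounded (bump' ` {-1..1})"
    by (intro compact_imp_bounded compact_continuous_image continuous_bump' compact_Icc)
  then obtain B where "\<forall>x\<in>bump' ` {-1..1}. norm x \<le> B" unfolding bounded_iff by blast
  then have B: "\<bar>bump' s\<bar> \<le> B" if "s \<in> {-1..1}" for s using that by auto
  have "\<bar>bump' s\<bar> \<le> max 1 B" for s
    using B[of s] bump'_zero[of s] by (cases "\<bar>s\<bar> \<le> 1") (auto simp: abs_le_iff le_max_iff_disj)
  then show ?thesis using that[of "max 1 B"] by simp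
qed

section \<open>Integrals over the line and the plane\<close>

lemma cball_borel [measurable]: "cball x r \<in> sets borel" for x :: "'a::euclidean_space"
  by (intro borel_closed closed_cball)

lemma ball_borel [measurable]: "ball x r \<in> sets borel" for x :: "'a::euclidean_space"
  by (intro borel_open open_ball)

text \<open>Powers of the distance are integrated by covering the plane with balls of geometrically
  growing or shrinking radii, on each of which the integrand is dominated by a constant.\<close>

lemma dyadic_integral_bound:
  fixes f :: "real^2 \<Rightarrow> real"
  assumes [measurable]: "f \<in> borel_measurable borel" and nonneg: "\<And>y. 0 \<le> f y"
    and cover: "\<And>y. f y \<noteq> 0 \<Longrightarrow> \<exists>n::nat. y \<in> cball x (R n) \<and> f y \<le> c n"
    and R: "\<And>n. 0 \<le> R n" and c: "\<And>n. 0 \<le> c n"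
    and geo: "\<And>n. c n * (pi * R n ^ 2) \<le> A * q ^ n" and q: "0 \<le> q" "q < 1"
  shows "integrable lborel f" and "(\<integral>y. f y \<partial>lborel) \<le> A / (1 - q)"
proof -
  have A: "0 \<le> A"
    using geo[of 0] mult_nonneg_nonneg[OF c[of 0], of "pi * R 0 ^ 2"] by auto
  have "(\<integral>\<^sup>+y. ennreal (f y) \<partial>lborel) \<le> (\<integral>\<^sup>+y. (\<Sum>n. ennreal (c n) * indicator (cball x (R n)) y) \<partial>lborel)"
  proof (rule nn_integral_mono)
    fix y
    show "ennreal (f y) \<le> (\<Sum>n. ennreal (c n) * indicator (cball x (R n)) y)"
    proof (cases "f y = 0")
      case False
      then obtain n where n: "y \<in> cball x (R n)" "f y \<le> c n" using cover by blast
      then have "ennreal (f y) \<le> (\<Sum>n\<in>{n}. ennreal (c n) * indicator (cball x (R n)) y)"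
        by (auto intro: ennreal_leI)
      also have "\<dots> \<le> (\<Sum>n. ennreal (c n) * indicator (cball x (R n)) y)"
        by (rule sum_le_suminf) auto
      finally show ?thesis .
    qed simp
  qed
  also have "\<dots> = (\<Sum>n. \<integral>\<^sup>+y. ennreal (c n) * indicator (cball x (R n)) y \<partial>lborel)"
    by (rule nn_integral_suminf) auto
  also have "\<dots> = (\<Sum>n. ennreal (c n * (pi * R n ^ 2)))"
    using R c by (simp add: nn_integral_cmult_indicator emeasure_cball unit_ball_vol_2 ennreal_mult[symmetric])
  also have "\<dots> \<le> (\<Sum>n. ennreal (A * q ^ n))"
    by (intro suminf_le ennreal_leI geo) auto
  also have "\<dots> = ennreal (A / (1 - q))"
  proof (rule suminf_ennreal_eq)
    show "(\<lambda>n. A * q ^ n) sums (A / (1 - q))"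
      using sums_mult[OF geometric_sums[of q], of A] q by simp
  qed (use A q in auto)
  finally have le: "(\<integral>\<^sup>+y. ennreal (f y) \<partial>lborel) \<le> ennreal (A / (1 - q))" .
  show int: "integrable lborel f"
    by (rule integrableI_nonneg) (use nonneg le in \<open>auto simp: top_unique less_top[symmetric]\<close>)
  have "ennreal (\<integral>y. f y \<partial>lborel) \<le> ennreal (A / (1 - q))"
    using le nn_integral_eq_integral[OF int] nonneg by simp
  then show "(\<integral>y. f y \<partial>lborel) \<le> A / (1 - q)"
    using A q by (subst (asm) ennreal_le_iff) auto
qed

lemma dyadic_scale:
  assumes "1 \<le> (r::real)" shows "\<exists>n::nat. 2 ^ n \<le> r \<and> r \<le> 2 ^ Suc n"
proof -
  define n where "n = nat \<lfloor>log 2 r\<rfloor>"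
  have 0: "0 \<le> log 2 r" using assms by simp
  then have "real n \<le> log 2 r" "log 2 r \<le> real (Suc n)" unfolding n_def by linarith+
  then have "2 powr real n \<le> r" "r \<le> 2 powr (real (Suc n))" using assms by (auto simp: le_log_iff log_le_iff)
  then show ?thesis by (intro exI[of _ n]) (simp add: powr_realpow del: of_nat_Suc power_Suc)
qed

lemma tail_power_bound:
  assumes p: "2 < p"
  shows "\<exists>C>0. \<forall>\<rho>>0. integrable lborel (\<lambda>y::real^2. indicat_real {y. \<rho> < norm y} y * norm y powr (-p)) \<and>
    (\<integral>y. indicat_real {y::real^2. \<rho> < norm y} y * norm y powr (-p) \<partial>lborel) \<le> C * \<rho> powr (2 - p)"
proof -
  define q :: real where "q = 2 powr (2 - p)"
  have q: "0 < q" "q < 1" using p by (auto simp: q_def powr_less_one)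
  have main: "integrable lborel (\<lambda>y::real^2. indicat_real {y. \<rho> < norm y} y * norm y powr (-p)) \<and>
    (\<integral>y. indicat_real {y::real^2. \<rho> < norm y} y * norm y powr (-p) \<partial>lborel) \<le> 4 * pi / (1 - q) * \<rho> powr (2 - p)"
    if \<rho>: "0 < \<rho>" for \<rho>
  proof -
    define f where "f = (\<lambda>y::real^2. indicat_real {y. \<rho> < norm y} y * norm y powr (-p))"
    define c where "c = (\<lambda>n::nat. (2 ^ n * \<rho>) powr (-p))"
    have f: "f \<in> borel_measurable borel" "\<And>y. 0 \<le> f y" by (auto simp: f_def)
    have cover: "\<exists>n::nat. y \<in> cball 0 (2 ^ Suc n * \<rho>) \<and> f y \<le> c n" if "f y \<noteq> 0" for y
    proof -
      have y: "\<rho> < norm y" using that by (auto simp: f_def indicator_def split: if_splits)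
      then obtain n :: nat where "2 ^ n \<le> norm y / \<rho>" "norm y / \<rho> \<le> 2 ^ Suc n"
        using dyadic_scale[of "norm y / \<rho>"] \<rho> by auto
      then have n: "2 ^ n * \<rho> \<le> norm y" "norm y \<le> 2 ^ Suc n * \<rho>" using \<rho> by (auto simp: field_simps)
      then show ?thesis using \<rho> p y by (intro exI[of _ n]) (auto simp: c_def f_def intro!: powr_mono2')
    qed
    have geo: "c n * (pi * (2 ^ Suc n * \<rho>)\<^sup>2) \<le> (4 * pi * \<rho> powr (2 - p)) * q ^ n" for n
    proof -
      have "c n * (pi * (2 ^ Suc n * \<rho>)\<^sup>2) = 4 * pi * ((2 ^ n * \<rho>) powr (-p) * (2 ^ n * \<rho>) powr 2)"
        using \<rho> by (simp add: c_def powr_numeral power_mult_distrib)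
      also have "\<dots> = 4 * pi * (2 ^ n * \<rho>) powr (2 - p)" by (simp add: powr_add[symmetric])
      also have "(2 ^ n * \<rho>) powr (2 - p) = (2 ^ n) powr (2 - p) * \<rho> powr (2 - p)"
        using \<rho> by (simp add: powr_mult)
      also have "(2 ^ n :: real) powr (2 - p) = q ^ n"
        by (simp add: q_def powr_realpow[symmetric] powr_powr mult.commute)
      finally show ?thesis by (simp add: mult_ac)
    qed
    note * = dyadic_integral_bound[where f=f and x=0 and R="\<lambda>n. 2 ^ Suc n * \<rho>" and c=c and q=q, OF f cover _ _ geo]
    have "integrable lborel f" "(\<integral>y. f y \<partial>lborel) \<le> (4 * pi * \<rho> powr (2 - p)) / (1 - q)"
      by (rule *; use q \<rho> in \<open>auto simp: c_def\<close>)+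
    then show ?thesis by (auto simp: f_def)
  qed
  have "0 < 4 * pi / (1 - q)" using q by simp
  then show ?thesis using main by blast
qed

lemma local_power_bound:
  assumes p: "0 < p" "p < 2"
  shows "\<exists>C>0. \<forall>\<rho>>0. \<forall>x. integrable lborel (\<lambda>y::real^2. indicat_real (cball x \<rho>) y * norm (x - y) powr (-p)) \<and>
    (\<integral>y. indicat_real (cball x \<rho>) y * norm (x - y) powr (-p) \<partial>lborel) \<le> C * \<rho> powr (2 - p)"
proof -
  define q :: real where "q = 2 powr (p - 2)"
  have q: "0 < q" "q < 1" using p by (auto simp: q_def powr_less_one)
  have main: "integrable lborel (\<lambda>y::real^2. indicat_real (cball x \<rho>) y * norm (x - y) powr (-p)) \<and>
    (\<integral>y. indicat_real (cball x \<rho>) y * norm (x - y) powr (-p) \<partial>lborel) \<le> pi * 2 powr p / (1 - q) * \<rho> powr (2 - p)"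
    if \<rho>: "0 < \<rho>" for \<rho> and x :: "real^2"
  proof -
    define f where "f = (\<lambda>y::real^2. indicat_real (cball x \<rho>) y * norm (x - y) powr (-p))"
    define c where "c = (\<lambda>n::nat. (\<rho> / 2 ^ Suc n) powr (-p))"
    have f: "f \<in> borel_measurable borel" "\<And>y. 0 \<le> f y" by (auto simp: f_def)
    have cover: "\<exists>n::nat. y \<in> cball x (\<rho> / 2 ^ n) \<and> f y \<le> c n" if "f y \<noteq> 0" for y
    proof -
      have y: "0 < norm (x - y)" "norm (x - y) \<le> \<rho>"
        using that by (auto simp: f_def indicator_def dist_norm split: if_splits)
      then obtain n :: nat where "2 ^ n \<le> \<rho> / norm (x - y)" "\<rho> / norm (x - y) \<le> 2 ^ Suc n"
        using dyadic_scale[of "\<rho> / norm (x - y)"] \<rho> by auto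
      then have n: "\<rho> / 2 ^ Suc n \<le> norm (x - y)" "norm (x - y) \<le> \<rho> / 2 ^ n"
        using \<rho> y by (auto simp: field_simps)
      moreover have "0 < \<rho> / 2 ^ Suc n" using \<rho> by simp
      ultimately have "norm (x - y) powr (-p) \<le> c n"
        unfolding c_def using p by (intro powr_mono2') auto
      then show ?thesis using y n
        by (intro exI[of _ n]) (auto simp: f_def dist_norm)
    qed
    have geo: "c n * (pi * (\<rho> / 2 ^ n)\<^sup>2) \<le> (pi * 2 powr p * \<rho> powr (2 - p)) * q ^ n" for n
    proof -
      have "c n = (\<rho> / 2 ^ n) powr (-p) * (1/2) powr (-p)"
        using \<rho> powr_mult[of "\<rho> / 2 ^ n" "1/2" "-p"] by (simp add: c_def mult.commute)
      moreover have "(1/2::real) powr (-p) = 2 powr p" by (simp add: powr_minus powr_divide)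
      ultimately have "c n * (pi * (\<rho> / 2 ^ n)\<^sup>2) = pi * 2 powr p * ((\<rho> / 2 ^ n) powr (-p) * (\<rho> / 2 ^ n) powr 2)"
        using \<rho> by (simp add: powr_numeral)
      also have "\<dots> = pi * 2 powr p * (\<rho> / 2 ^ n) powr (2 - p)" by (simp add: powr_add[symmetric])
      also have "(\<rho> / 2 ^ n) powr (2 - p) = \<rho> powr (2 - p) * (2 ^ n) powr (p - 2)"
        using \<rho> by (simp add: powr_divide powr_minus_divide[of _ "p - 2", simplified])
      also have "(2 ^ n :: real) powr (p - 2) = q ^ n"
        by (simp add: q_def powr_realpow[symmetric] powr_powr mult.commute)
      finally show ?thesis by (simp add: mult_ac)
    qed
    note * = dyadic_integral_bound[where f=f and x=x and R="\<lambda>n. \<rho> / 2 ^ n" and c=c and q=q, OF f cover _ _ geo]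
    have "integrable lborel f" "(\<integral>y. f y \<partial>lborel) \<le> (pi * 2 powr p * \<rho> powr (2 - p)) / (1 - q)"
      by (rule *; use q \<rho> in \<open>auto simp: c_def\<close>)+
    then show ?thesis by (auto simp: f_def)
  qed
  have "0 < pi * 2 powr p / (1 - q)" using q by simp
  then show ?thesis using main by blast
qed

lemma diag_measurable: "(\<lambda>x::real^2. vector [s + a * x $ 1, t + b * x $ 2] :: real^2) \<in> borel_measurable borel"
proof -
  have "continuous_on UNIV (\<lambda>x::real^2. (\<chi> i. if i = (1::2) then s + a * x $ 1 else t + b * x $ 2))"
  proof (rule continuous_on_vec_lambda)
    fix i :: 2
    show "continuous_on UNIV (\<lambda>x::real^2. if i = 1 then s + a * x $ 1 else t + b * x $ 2)"
      by (cases "i = 1") (auto intro!: continuous_intros)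
  qed
  moreover have "(\<chi> i. if i = (1::2) then s + a * x $ 1 else t + b * x $ 2) = (vector [s + a * x $ 1, t + b * x $ 2] :: real^2)"
    for x :: "real^2"
    by (auto simp: vec_eq_iff forall_2)
  ultimately show ?thesis by (simp add: borel_measurable_continuous_onI)
qed

lemma lborel_diag:
  assumes "a \<noteq> 0" "b \<noteq> 0"
  shows "(lborel :: (real^2) measure) =
    density (distr lborel borel (\<lambda>x::real^2. vector [s + a * x $ 1, t + b * x $ 2])) (\<lambda>_. ennreal \<bar>a * b\<bar>)"
proof -
  have B: "(Basis :: (real^2) set) = {axis 1 1, axis 2 1}"
    by (auto simp: Basis_vec_def UNIV_2)
  have ne: "axis 1 1 \<noteq> (axis 2 1 :: real^2)" by (simp add: axis_eq_axis)
  define c :: "real^2 \<Rightarrow> real" where "c = (\<lambda>j. if j = axis 1 1 then a else b)"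
  have "(\<lambda>x::real^2. vector [s, t] + (\<Sum>j\<in>Basis. (c j * (x \<bullet> j)) *\<^sub>R j))
      = (\<lambda>x::real^2. vector [s + a * x $ 1, t + b * x $ 2])"
    unfolding B using ne by (auto simp: fun_eq_iff vec_eq_iff forall_2 c_def inner_axis) (auto simp: axis_def)
  moreover have "(\<Prod>j\<in>Basis. \<bar>c j\<bar>) = \<bar>a * b\<bar>"
    unfolding B using ne by (simp add: c_def abs_mult)
  ultimately show ?thesis
    using lborel_affine_euclidean[of c "vector [s, t]"] assms by (auto simp: c_def)
qed

lemma integral_diag:
  fixes f :: "real^2 \<Rightarrow> real"
  assumes [measurable]: "f \<in> borel_measurable borel" and ab: "a \<noteq> 0" "b \<noteq> 0"
  shows "(\<integral>x. f (vector [s + a * (x::real^2) $ 1, t + b * x $ 2]) \<partial>lborel) = (\<integral>x. f x \<partial>lborel) / \<bar>a * b\<bar>"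
    and "integrable lborel (\<lambda>x::real^2. f (vector [s + a * x $ 1, t + b * x $ 2])) \<longleftrightarrow> integrable lborel f"
proof -
  note [measurable] = diag_measurable[of s a t b]
  have "(\<integral>x. f x \<partial>lborel) = \<bar>a * b\<bar> * (\<integral>x. f (vector [s + a * (x::real^2) $ 1, t + b * x $ 2]) \<partial>lborel)"
    by (subst lborel_diag[OF ab, of s t]) (simp add: integral_density integral_distr)
  then show "(\<integral>x. f (vector [s + a * (x::real^2) $ 1, t + b * x $ 2]) \<partial>lborel) = (\<integral>x. f x \<partial>lborel) / \<bar>a * b\<bar>"
    using ab by simp
  show "integrable lborel (\<lambda>x::real^2. f (vector [s + a * x $ 1, t + b * x $ 2])) \<longleftrightarrow> integrable lborel f"
  proof -
    have "integrable lborel f \<longleftrightarrow> integrable (density (distr lborel borel (\<lambda>x::real^2. vector [s + a * x $ 1, t + b * x $ 2])) (\<lambda>_. ennreal \<bar>a * b\<bar>)) f"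
      using lborel_diag[OF ab, of s t] by simp
    then show ?thesis using ab by (simp add: integrable_density integrable_distr_eq)
  qed
qed

lemma integrable_indicator_Icc [simp]: "integrable lborel (indicat_real {a..b::real})"
  by (intro integrable_real_indicator) (auto simp: emeasure_lborel_Icc_eq)

lemma integrable_bounded_on_interval:
  fixes w :: "real \<Rightarrow> real"
  assumes [measurable]: "w \<in> borel_measurable borel" and "\<And>t. \<bar>w t\<bar> \<le> C"
  shows "set_integrable lborel {a..b} w"
proof -
  have "integrable lborel (\<lambda>t. C * indicat_real {a..b} t)" by simp
  then have "integrable lborel (\<lambda>t. indicat_real {a..b} t *\<^sub>R w t)"
  proof (rule Bochner_Integration.integrable_bound)
    show "AE t in lborel. norm (indicat_real {a..b} t *\<^sub>R w t) \<le> norm (C * indicat_real {a..b} t)"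
      using assms(2) by (intro AE_I2) (auto simp: indicator_def intro: order_trans[OF _ abs_ge_self])
  qed simp
  then show ?thesis by (simp add: set_integrable_def)
qed

text \<open>The exponent of the moving test functions has to be smooth in time, while the rate of strain of a
  weak solution is only bounded and measurable; a polynomial replaces it at the cost of a small
  \<open>L\<^sup>1\<close> error.\<close>

lemma polynomial_approx_L1:
  fixes L :: "real \<Rightarrow> real"
  assumes L[measurable]: "L \<in> borel_measurable borel" and C: "\<And>t. \<bar>L t\<bar> \<le> C" and \<sigma>: "0 < \<sigma>" and T: "0 \<le> T"
  obtains p where "real_polynomial_function p" "(LINT t : {0..T} | lborel. \<bar>L t - p t\<bar>) < \<sigma>"
proof -
  have "L measurable_on {0..T}"
    by (rule lebesgue_measurable_imp_measurable_on) (auto intro: measurable_completion)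
  then obtain N g where N: "negligible N" and g: "\<And>n. continuous_on UNIV (g n)"
    and lim: "\<And>x. x \<notin> N \<Longrightarrow> (\<lambda>n. g n x) \<longlonglongrightarrow> (if x \<in> {0..T} then L x else 0)"
    unfolding measurable_on_def by blast
  define h where "h = (\<lambda>n t::real. max (- C) (min C (g n t)))"
  have C0: "0 \<le> C" using C[of 0] by auto
  have hc: "continuous_on S (h n)" for n S
    unfolding h_def by (intro continuous_intros continuous_on_subset[OF g]) auto
  have [measurable]: "h n \<in> borel_measurable borel" for n
    by (rule borel_measurable_continuous_onI[OF hc])
  have hb: "\<bar>h n t\<bar> \<le> C" for n t using C0 by (auto simp: h_def)
  have "AE t in lebesgue. t \<notin> N"
    using N by (intro AE_not_in) (simp add: negligible_iff_null_sets)
  then have AE_N: "AE t in lborel. t \<notin> N" by (simp add: AE_completion_iff)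
  have "(\<lambda>n. \<integral>t. indicat_real {0..T} t * \<bar>L t - h n t\<bar> \<partial>lborel) \<longlonglongrightarrow> (\<integral>t. 0 \<partial>(lborel :: real measure))"
  proof (rule integral_dominated_convergence[where w="\<lambda>t. 2 * C * indicat_real {0..T} t"])
    show "AE t in lborel. (\<lambda>n. indicat_real {0..T} t * \<bar>L t - h n t\<bar>) \<longlonglongrightarrow> 0"
      using AE_N
    proof eventually_elim
      case (elim t)
      show ?case
      proof (cases "t \<in> {0..T}")
        case True
        have "(\<lambda>n. h n t) \<longlonglongrightarrow> max (- C) (min C (L t))"
          unfolding h_def using lim[OF elim] True by (intro tendsto_max tendsto_min tendsto_const) simp
        moreover have "max (- C) (min C (L t)) = L t" using C[of t] by auto
        ultimately have "(\<lambda>n. \<bar>L t - h n t\<bar>) \<longlonglongrightarrow> \<bar>L t - L t\<bar>"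
          by (intro tendsto_intros) simp
        then show ?thesis using True by simp
      qed simp
    qed
    show "AE t in lborel. norm (indicat_real {0..T} t * \<bar>L t - h n t\<bar>) \<le> 2 * C * indicat_real {0..T} t" for n
    proof (intro AE_I2)
      fix t show "norm (indicat_real {0..T} t * \<bar>L t - h n t\<bar>) \<le> 2 * C * indicat_real {0..T} t"
        using C[of t] hb[of n t] by (auto simp: indicator_def)
    qed
  qed auto
  then have "(\<lambda>n. \<integral>t. indicat_real {0..T} t * \<bar>L t - h n t\<bar> \<partial>lborel) \<longlonglongrightarrow> 0" by simp
  then have "\<forall>\<^sub>F n in sequentially. (\<integral>t. indicat_real {0..T} t * \<bar>L t - h n t\<bar> \<partial>lborel) < \<sigma> / 2"
    by (rule order_tendstoD) (use \<sigma> in simp)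
  then obtain n where n: "(\<integral>t. indicat_real {0..T} t * \<bar>L t - h n t\<bar> \<partial>lborel) < \<sigma> / 2"
    by (auto dest: eventually_happens)
  define e where "e = \<sigma> / (2 * (T + 1))"
  have e: "0 < e" using \<sigma> T by (simp add: e_def)
  obtain p where p: "real_polynomial_function p" and pe: "\<And>t. t \<in> {0..T} \<Longrightarrow> \<bar>h n t - p t\<bar> < e"
    using Stone_Weierstrass_real_polynomial_function[OF compact_Icc hc e] by metis
  have "continuous_on UNIV p"
    using p continuous_on_polymonial_function real_polynomial_function_eq by blast
  then have [measurable]: "p \<in> borel_measurable borel" by (rule borel_measurable_continuous_onI)
  have i1: "integrable lborel (\<lambda>t. indicat_real {0..T} t * \<bar>L t - h n t\<bar>)"
  proof -
    have "\<bar>L t - h n t\<bar> \<le> 2 * C" for t using C[of t] hb[of n t] by linarith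
    then show ?thesis
      using integrable_bounded_on_interval[of "\<lambda>t. \<bar>L t - h n t\<bar>" "2 * C" 0 T]
      by (simp add: set_integrable_def)
  qed
  have i2: "integrable lborel (\<lambda>t. indicat_real {0..T} t * e)" by simp
  have "(LINT t : {0..T} | lborel. \<bar>L t - p t\<bar>)
      \<le> (\<integral>t. indicat_real {0..T} t * \<bar>L t - h n t\<bar> + indicat_real {0..T} t * e \<partial>lborel)"
    unfolding set_lebesgue_integral_def
  proof (rule integral_mono')
    fix t show "indicat_real {0..T} t *\<^sub>R \<bar>L t - p t\<bar> \<le> indicat_real {0..T} t * \<bar>L t - h n t\<bar> + indicat_real {0..T} t * e"
      using pe[of t] by (auto simp: indicator_def)
  qed (use i1 i2 C0 e in \<open>auto simp: indicator_def\<close>)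
  also have "\<dots> = (\<integral>t. indicat_real {0..T} t * \<bar>L t - h n t\<bar> \<partial>lborel) + T * e"
    using i1 i2 T by simp
  also have "T * e \<le> \<sigma> / 2" using T \<sigma> by (simp add: e_def field_simps)
  finally show ?thesis using that[OF p] n by simp
qed

text \<open>Smooth functions of the form \<open>1 - exp (- n b)\<close>, with a bump \<open>b\<close> supported in an interval,
  increase to the indicator function of its interior. Testing with them bounds the integrals of \<open>w\<close>
  over intervals, and differentiation of the integral gives the pointwise bound.\<close>

lemma smooth_integral_tests_imp_AE_nonpos:
  fixes w :: "real \<Rightarrow> real"
  assumes w[measurable]: "w \<in> borel_measurable borel" and C: "\<And>t. \<bar>w t\<bar> \<le> C"
    and test: "\<And>\<psi>. smooth \<psi> \<Longrightarrow> (\<And>t. 0 \<le> \<psi> t) \<Longrightarrow> (\<And>t. \<psi> t \<le> 1) \<Longrightarrow> (\<And>t. t \<notin> {a<..<b} \<Longrightarrow> \<psi> t = 0)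
      \<Longrightarrow> (\<integral>t. w t * \<psi> t \<partial>lborel) \<le> 0"
  shows "AE t in lborel. a < t \<longrightarrow> t < b \<longrightarrow> w t \<le> 0"
proof -
  have C0: "0 \<le> C" using C[of 0] by auto
  have int: "set_integrable lborel {s..t} w" for s t
    by (rule integrable_bounded_on_interval[OF w C])
  have nonpos: "integral {s..s + h} w \<le> 0" if s: "a \<le> s" "0 < h" "s + h \<le> b" for s h
  proof -
    define \<psi> where "\<psi> = (\<lambda>n t. 1 - exp (- real n * bump ((t - (s + h / 2)) * (2 / h))))"
    have z: "\<psi> n t = 0" if "t \<notin> {s<..<s + h}" for n t
    proof -
      have "1 \<le> \<bar>(t - (s + h / 2)) * (2 / h)\<bar>"
        using that s by (auto simp: field_simps abs_if)
      then show ?thesis by (simp add: \<psi>_def bump_zero)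
    qed
    have sm: "smooth (\<psi> n)" for n
      unfolding \<psi>_def by (intro smooth_diff smooth_const smooth_compose[OF smooth_exp] smooth_mult
          smooth_compose[OF smooth_bump] smooth_ident)
    have le: "0 \<le> \<psi> n t" "\<psi> n t \<le> 1" for n t
      by (auto simp: \<psi>_def bump_nonneg)
    have [measurable]: "\<psi> n \<in> borel_measurable borel" for n
      by (rule borel_measurable_continuous_onI[OF smooth_continuous_on[OF sm]])
    have lim: "(\<lambda>n. \<psi> n t) \<longlonglongrightarrow> indicat_real {s<..<s + h} t" for t
    proof (cases "t \<in> {s<..<s + h}")
      case True
      then have "0 < bump ((t - (s + h / 2)) * (2 / h))"
        using s by (intro bump_pos) (auto simp: field_simps abs_if)
      then have "(\<lambda>n. exp (- real n * bump ((t - (s + h / 2)) * (2 / h)))) \<longlonglongrightarrow> 0"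
        using LIMSEQ_power_zero[of "exp (- bump ((t - (s + h / 2)) * (2 / h)))"]
        by (simp add: exp_of_nat_mult[symmetric])
      then have "(\<lambda>n. \<psi> n t) \<longlonglongrightarrow> 1 - 0"
        unfolding \<psi>_def by (intro tendsto_intros)
      then show ?thesis using True by simp
    qed (simp add: z)
    have "(\<lambda>n. \<integral>t. w t * \<psi> n t \<partial>lborel) \<longlonglongrightarrow> (\<integral>t. w t * indicat_real {s<..<s + h} t \<partial>lborel)"
    proof (rule integral_dominated_convergence[where w="\<lambda>t. C * indicat_real {s..s + h} t"])
      show "AE t in lborel. norm (w t * \<psi> n t) \<le> C * indicat_real {s..s + h} t" for n
      proof (intro AE_I2)
        fix t show "norm (w t * \<psi> n t) \<le> C * indicat_real {s..s + h} t"
          using C[of t] le[of n t] z[of t n] C0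
          by (cases "t \<in> {s<..<s+h}") (auto simp: abs_mult intro: mult_left_le[THEN order_trans])
      qed
    qed (auto intro!: AE_I2 tendsto_intros lim)
    moreover have "(\<integral>t. w t * \<psi> n t \<partial>lborel) \<le> 0" for n
      by (rule test) (use sm le z s in auto)
    ultimately have "(\<integral>t. w t * indicat_real {s<..<s + h} t \<partial>lborel) \<le> 0"
      by (intro LIMSEQ_le_const2) auto
    also have "(\<integral>t. w t * indicat_real {s<..<s + h} t \<partial>lborel) = (LINT t : {s..s + h} | lborel. w t)"
      unfolding set_lebesgue_integral_def
    proof (rule integral_cong_AE)
      show "AE t in lborel. w t * indicat_real {s<..<s + h} t = indicat_real {s..s + h} t *\<^sub>R w t"
        using AE_lborel_singleton[of s] AE_lborel_singleton[of "s + h"]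
        by eventually_elim (auto simp: indicator_def)
    qed auto
    also have "\<dots> = integral {s..s + h} w"
      by (rule set_borel_integral_eq_integral(2)[OF int])
    finally show ?thesis .
  qed
  have "w integrable_on cbox s t" for s t
    using set_borel_integral_eq_integral(1)[OF int] by simp
  then obtain N where N: "negligible N" and
    diff: "\<And>x e. \<lbrakk>x \<notin> N; 0 < e\<rbrakk> \<Longrightarrow> \<exists>d>0. \<forall>h. 0 < h \<and> h < d \<longrightarrow>
        norm (integral (cbox x (x + h *\<^sub>R One)) w /\<^sub>R h ^ DIM(real) - w x) < e"
    using integrable_ccontinuous_explicit[of w] by blast
  have "AE t in lebesgue. t \<notin> N"
    using N by (intro AE_not_in) (simp add: negligible_iff_null_sets)
  then have "AE t in lborel. t \<notin> N" by (simp add: AE_completion_iff)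
  then show ?thesis
  proof eventually_elim
    case (elim t)
    show ?case
    proof (intro impI leI notI)
      assume t: "a < t" "t < b" "0 < w t"
      obtain d where d: "d > 0" "\<And>h. 0 < h \<Longrightarrow> h < d \<Longrightarrow>
          norm (integral (cbox t (t + h *\<^sub>R One)) w /\<^sub>R h ^ DIM(real) - w t) < w t"
        using diff[OF elim t(3)] by blast
      define h where "h = min (d / 2) (b - t)"
      have h: "0 < h" "h < d" "t + h \<le> b" using d t by (auto simp: h_def)
      have "\<bar>integral {t..t + h} w / h - w t\<bar> < w t"
        using d(2)[OF h(1,2)] by (simp add: divide_inverse mult.commute)
      moreover have "integral {t..t + h} w / h \<le> 0"
        using nonpos[of t h] t h by (simp add: divide_le_0_iff)
      ultimately show False by linarith
    qed
  qed
qed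

section \<open>The velocity near the origin\<close>

lemma norm_real2: "(norm (z :: real^2))\<^sup>2 = (z $ 1)\<^sup>2 + (z $ 2)\<^sup>2"
  by (simp add: norm_vec_def L2_set_def sum_2)

lemma inner_real2: "(x :: real^2) \<bullet> y = x $ 1 * y $ 1 + x $ 2 * y $ 2"
  by (simp add: inner_vec_def sum_2)

lemma real2_eq_iff: "(x :: real^2) = y \<longleftrightarrow> x $ 1 = y $ 1 \<and> x $ 2 = y $ 2"
  by (simp add: vec_eq_iff forall_2)

lemma perp_nth [simp]: "perp z $ 1 = - z $ 2" "perp z $ 2 = z $ 1"
  by (simp_all add: perp_def)

lemma norm_perp [simp]: "norm (perp z) = norm z"
proof -
  have "(norm (perp z))\<^sup>2 = (norm z)\<^sup>2" by (simp add: norm_real2)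
  then show ?thesis by simp
qed

lemma perp_add: "perp (x + y) = perp x + perp y"
  by (simp add: real2_eq_iff)

text \<open>Applied with \<open>q = \<bar>w\<bar>\<^sup>2\<close> and \<open>q + d = \<bar>w + x\<bar>\<^sup>2\<close>. The lower bound on \<open>d\<close> keeps the segment from
  \<open>q\<close> to \<open>q + d\<close> away from zero; it holds as soon as \<open>\<bar>x\<bar> \<le> \<bar>w\<bar> / 2\<close>.\<close>

lemma powr_second_order:
  fixes q d \<beta> :: real
  assumes q: "0 < q" and d: "- (3/4) * q \<le> d" and \<beta>: "0 < \<beta>"
  shows "\<bar>(q + d) powr (-\<beta>) - q powr (-\<beta>) + \<beta> * q powr (-\<beta> - 1) * d\<bar>
    \<le> \<beta> * (\<beta> + 1) * (q / 4) powr (-\<beta> - 2) * d\<^sup>2"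
proof -
  define D :: "nat \<Rightarrow> real \<Rightarrow> real" where
    "D = (\<lambda>m s. if m = 0 then (q + s * d) powr (-\<beta>) else if m = 1 then - \<beta> * (q + s * d) powr (-\<beta> - 1) * d
       else \<beta> * (\<beta> + 1) * (q + s * d) powr (-\<beta> - 2) * d\<^sup>2)"
  have ge: "q / 4 \<le> q + s * d" if "0 \<le> s" "s \<le> 1" for s
  proof -
    have "s * (- (3/4) * q) \<le> s * d" using that d by (intro mult_left_mono) auto
    moreover have "s * ((3/4) * q) \<le> 1 * ((3/4) * q)" using that q by (intro mult_right_mono) auto
    moreover have "s * (- (3/4) * q) = - (s * ((3/4) * q))" by simp
    ultimately show ?thesis by linarith
  qed
  have "\<exists>t>0. t < 1 \<and> D 0 1 = (\<Sum>m<2. D m 0 / fact m * 1 ^ m) + D 2 t / fact 2 * 1 ^ 2"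
  proof (rule Maclaurin)
    show "\<forall>m t. m < 2 \<and> 0 \<le> t \<and> t \<le> 1 \<longrightarrow> (D m has_real_derivative D (Suc m) t) (at t)"
    proof (intro allI impI)
      fix m :: nat and t :: real
      assume mt: "m < 2 \<and> 0 \<le> t \<and> t \<le> 1"
      then have pos: "0 < q + t * d" using ge[of t] q by linarith
      consider "m = 0" | "m = 1" using mt by linarith
      then show "(D m has_real_derivative D (Suc m) t) (at t)"
      proof cases
        case 1
        have "((\<lambda>s. (q + s * d) powr (-\<beta>)) has_real_derivative (-\<beta>) * (q + t * d) powr (-\<beta> - 1) * d) (at t)"
          using pos by (auto intro!: derivative_eq_intros)
        then show ?thesis using 1 by (simp add: D_def)
      next
        case 2
        have "((\<lambda>s. - \<beta> * (q + s * d) powr (-\<beta> - 1) * d) has_real_derivative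
            - \<beta> * ((-\<beta> - 1) * (q + t * d) powr (-\<beta> - 1 - 1) * d) * d) (at t)"
          using pos by (auto intro!: derivative_eq_intros)
        then show ?thesis using 2 by (simp add: D_def power2_eq_square algebra_simps)
      qed
    qed
  qed auto
  then obtain t where t: "0 < t" "t < 1"
    "D 0 1 = (\<Sum>m<2. D m 0 / fact m * 1 ^ m) + D 2 t / fact 2 * 1 ^ 2" by blast
  have eq: "(q + d) powr (-\<beta>) - q powr (-\<beta>) + \<beta> * q powr (-\<beta> - 1) * d
      = \<beta> * (\<beta> + 1) * (q + t * d) powr (-\<beta> - 2) * d\<^sup>2 / 2"
    using t(3) by (simp add: D_def numeral_2_eq_2)
  have "\<bar>(q + d) powr (-\<beta>) - q powr (-\<beta>) + \<beta> * q powr (-\<beta> - 1) * d\<bar>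
      = \<beta> * (\<beta> + 1) * (q + t * d) powr (-\<beta> - 2) * d\<^sup>2 / 2"
    unfolding eq using \<beta> by simp
  also have "\<dots> \<le> \<beta> * (\<beta> + 1) * (q + t * d) powr (-\<beta> - 2) * d\<^sup>2"
    using \<beta> by simp
  also have "\<dots> \<le> \<beta> * (\<beta> + 1) * (q / 4) powr (-\<beta> - 2) * d\<^sup>2"
    using ge[of t] t q \<beta> by (intro mult_right_mono mult_left_mono powr_mono2') auto
  finally show ?thesis .
qed

lemma norm_powr_half: "norm z powr (2 * s) = ((norm z)\<^sup>2) powr s"
  by (simp add: powr_powr[symmetric] powr_numeral)

text \<open>The first order Taylor polynomial of the velocity kernel \<open>z \<mapsto> perp z / \<bar>z\<bar> powr (2 + \<alpha>)\<close> at \<open>w\<close>.\<close>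

definition kernel_order1 :: "real \<Rightarrow> real^2 \<Rightarrow> real^2 \<Rightarrow> real^2" where
  "kernel_order1 \<alpha> w x = norm w powr (-2-\<alpha>) *\<^sub>R (perp w + perp x)
     - ((2 + \<alpha>) * (w \<bullet> x) * norm w powr (-4-\<alpha>)) *\<^sub>R perp w"

text \<open>The second order remainder decays like \<open>\<bar>w\<bar> powr (-3-\<alpha>)\<close>. Against a function that grows like
  \<open>\<bar>w\<bar> powr \<alpha>\<close> this is integrable at infinity in the plane, which the first order remainder is not.\<close>

lemma kernel_Taylor:
  assumes \<alpha>: "0 < \<alpha>"
  obtains C where "0 < C"
    "\<And>w x :: real^2. w \<noteq> 0 \<Longrightarrow> norm x \<le> norm w / 2 \<Longrightarrow>
      norm ((1 / norm (w + x) powr (2 + \<alpha>)) *\<^sub>R perp (w + x) - kernel_order1 \<alpha> w x)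
        \<le> C * (norm x)\<^sup>2 * norm w powr (-3-\<alpha>)"
proof
  define \<beta> where "\<beta> = 1 + \<alpha> / 2"
  have \<beta>: "0 < \<beta>" using \<alpha> by (simp add: \<beta>_def)
  define c where "c = \<beta> * (\<beta> + 1) * (1/4) powr (-\<beta> - 2) * 9 + \<beta>"
  have c: "0 < c" using \<beta> by (auto simp: c_def intro!: add_nonneg_pos)
  show "0 < 2 + \<alpha> + 2 * c" using \<alpha> c by simp
  fix w x :: "real^2"
  assume w: "w \<noteq> 0" and x: "norm x \<le> norm w / 2"
  define q where "q = (norm w)\<^sup>2"
  define d where "d = 2 * (w \<bullet> x) + (norm x)\<^sup>2"
  have q: "0 < q" using w by (simp add: q_def)
  have qd: "(norm (w + x))\<^sup>2 = q + d"
    by (simp add: q_def d_def power2_norm_eq_inner inner_add inner_commute)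
  have cs: "\<bar>w \<bullet> x\<bar> \<le> norm w * norm x" by (rule Cauchy_Schwarz_ineq2)
  have xx: "(norm x)\<^sup>2 \<le> norm w / 2 * norm x"
    unfolding power2_eq_square using x by (intro mult_right_mono) auto
  have d1: "- (3/4) * q \<le> d"
  proof -
    have "norm w - norm x \<le> norm (w + x)" using norm_triangle_ineq4[of "w + x" x] by simp
    then have "norm w / 2 \<le> norm (w + x)" using x by linarith
    then have "(norm w / 2)\<^sup>2 \<le> (norm (w + x))\<^sup>2" by (intro power_mono) auto
    then show ?thesis using qd by (simp add: q_def power_divide)
  qed
  have "\<bar>d\<bar> \<le> 3 * (norm w * norm x)"
    using cs xx mult_nonneg_nonneg[of "norm w" "norm x"] zero_le_power2[of "norm x"]
    unfolding d_def by linarith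
  then have "\<bar>d\<bar>\<^sup>2 \<le> (3 * (norm w * norm x))\<^sup>2" by (intro power_mono) auto
  then have d2: "d\<^sup>2 \<le> 9 * q * (norm x)\<^sup>2" by (simp add: q_def power_mult_distrib)
  define N0 N' N1 R where "N0 = norm w powr (-2-\<alpha>)" and "N' = - (2 + \<alpha>) * (w \<bullet> x) * norm w powr (-4-\<alpha>)"
    and "N1 = norm (w + x) powr (-2-\<alpha>)" and "R = N1 - N0 - N'"
  have e: "-2-\<alpha> = 2 * (-\<beta>)" "-4-\<alpha> = 2 * (-\<beta> - 1)" by (auto simp: \<beta>_def)
  have N: "N0 = q powr (-\<beta>)" "N1 = (q + d) powr (-\<beta>)" "norm w powr (-4-\<alpha>) = q powr (-\<beta> - 1)"
    unfolding N0_def N1_def e norm_powr_half qd q_def by auto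
  have N'eq: "N' = - \<beta> * q powr (-\<beta> - 1) * d + \<beta> * q powr (-\<beta> - 1) * (norm x)\<^sup>2"
    unfolding N'_def N by (simp add: \<beta>_def d_def algebra_simps)
  have "\<bar>N1 - N0 + \<beta> * q powr (-\<beta> - 1) * d\<bar> \<le> \<beta> * (\<beta> + 1) * (q / 4) powr (-\<beta> - 2) * d\<^sup>2"
    unfolding N by (rule powr_second_order[OF q d1 \<beta>])
  also have "\<dots> \<le> \<beta> * (\<beta> + 1) * (q / 4) powr (-\<beta> - 2) * (9 * q * (norm x)\<^sup>2)"
    using d2 \<beta> by (intro mult_left_mono) auto
  also have "(q / 4) powr (-\<beta> - 2) = q powr (-\<beta> - 2) * (1/4) powr (-\<beta> - 2)"
    using powr_mult[of q "1/4" "-\<beta> - 2"] q by simp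
  also have "\<beta> * (\<beta> + 1) * (q powr (-\<beta> - 2) * (1/4) powr (-\<beta> - 2)) * (9 * q * (norm x)\<^sup>2)
      = \<beta> * (\<beta> + 1) * (1/4) powr (-\<beta> - 2) * 9 * (q powr (-\<beta> - 2) * q powr 1) * (norm x)\<^sup>2"
    using q by simp
  also have "q powr (-\<beta> - 2) * q powr 1 = q powr (-\<beta> - 1)"
    by (subst powr_add[symmetric]) (rule arg_cong[of _ _ "\<lambda>s. q powr s"], simp)
  finally have "\<bar>N1 - N0 + \<beta> * q powr (-\<beta> - 1) * d\<bar> \<le> (c - \<beta>) * q powr (-\<beta> - 1) * (norm x)\<^sup>2"
    by (simp add: c_def)
  moreover have "R = (N1 - N0 + \<beta> * q powr (-\<beta> - 1) * d) - \<beta> * q powr (-\<beta> - 1) * (norm x)\<^sup>2"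
    unfolding R_def N'eq by simp
  moreover have "\<bar>\<beta> * q powr (-\<beta> - 1) * (norm x)\<^sup>2\<bar> = \<beta> * q powr (-\<beta> - 1) * (norm x)\<^sup>2"
    using \<beta> by simp
  ultimately have R: "\<bar>R\<bar> \<le> c * norm w powr (-4-\<alpha>) * (norm x)\<^sup>2"
    unfolding N by (simp add: algebra_simps)
  have pw: "norm w powr (-4-\<alpha>) * norm w = norm w powr (-3-\<alpha>)"
    using w powr_add[of "norm w" "-4-\<alpha>" 1] by simp
  have "\<bar>N'\<bar> \<le> (2 + \<alpha>) * (norm w * norm x) * norm w powr (-4-\<alpha>)"
  proof -
    have "\<bar>N'\<bar> = (2 + \<alpha>) * \<bar>w \<bullet> x\<bar> * norm w powr (-4-\<alpha>)"
      unfolding N'_def using \<alpha> by (simp add: abs_mult)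
    then show ?thesis using cs \<alpha> by (simp add: mult_left_mono mult_right_mono)
  qed
  also have "\<dots> = (2 + \<alpha>) * norm x * norm w powr (-3-\<alpha>)" unfolding pw[symmetric] by simp
  finally have N'b: "\<bar>N'\<bar> \<le> (2 + \<alpha>) * norm x * norm w powr (-3-\<alpha>)" .
  have "1 / norm (w + x) powr (2 + \<alpha>) = N1"
    unfolding N1_def using powr_minus_divide[of "norm (w + x)" "2 + \<alpha>"] by simp
  also have "\<dots> = N0 + N' + R" by (simp add: R_def)
  finally have e1: "1 / norm (w + x) powr (2 + \<alpha>) = N0 + N' + R" .
  have wx: "norm (w + x) \<le> 2 * norm w"
    using norm_triangle_ineq[of w x] x norm_ge_zero[of w] by linarith
  have "kernel_order1 \<alpha> w x = N0 *\<^sub>R (perp w + perp x) + N' *\<^sub>R perp w"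
    by (simp add: kernel_order1_def N0_def N'_def real2_eq_iff algebra_simps)
  then have "(1 / norm (w + x) powr (2 + \<alpha>)) *\<^sub>R perp (w + x) - kernel_order1 \<alpha> w x
      = N' *\<^sub>R perp x + R *\<^sub>R perp (w + x)"
    unfolding e1 by (simp add: perp_add algebra_simps)
  also have "norm \<dots> \<le> \<bar>N'\<bar> * norm x + \<bar>R\<bar> * norm (w + x)"
    by (rule norm_triangle_le) simp
  also have "\<dots> \<le> ((2 + \<alpha>) * norm x * norm w powr (-3-\<alpha>)) * norm x
      + (c * norm w powr (-4-\<alpha>) * (norm x)\<^sup>2) * (2 * norm w)"
    using N'b R wx c by (intro add_mono mult_mono) auto
  also have "\<dots> = (2 + \<alpha> + 2 * c) * (norm x)\<^sup>2 * norm w powr (-3-\<alpha>)"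
    unfolding pw[symmetric] by (simp add: power2_eq_square algebra_simps)
  finally show "norm ((1 / norm (w + x) powr (2 + \<alpha>)) *\<^sub>R perp (w + x) - kernel_order1 \<alpha> w x)
        \<le> (2 + \<alpha> + 2 * c) * (norm x)\<^sup>2 * norm w powr (-3-\<alpha>)" .
qed

definition holder_bound :: "real \<Rightarrow> real \<Rightarrow> (real^2 \<Rightarrow> real) \<Rightarrow> bool" where
  "holder_bound \<alpha> M f \<longleftrightarrow> (\<forall>x. \<bar>f x\<bar> \<le> M) \<and> (\<forall>x y. \<bar>f x - f y\<bar> \<le> M * norm (x - y) powr \<alpha>)"

lemma holder_boundD:
  assumes "holder_bound \<alpha> M f"
  shows "\<bar>f x\<bar> \<le> M" "\<bar>f x - f y\<bar> \<le> M * norm (x - y) powr \<alpha>" "0 \<le> M"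
  using assms abs_ge_zero[of "f x"] unfolding holder_bound_def by (blast, blast, metis abs_ge_zero order_trans)

lemma holder_bound_continuous:
  assumes f: "holder_bound \<alpha> M f" and \<alpha>: "0 < \<alpha>"
  shows "continuous_on S f"
proof -
  have "isCont f x" for x
    unfolding isCont_def
  proof (rule LIM_zero_cancel, rule Lim_null_comparison[where g="\<lambda>y. M * norm (y - x) powr \<alpha>"])
    show "\<forall>\<^sub>F y in at x. norm (f y - f x) \<le> M * norm (y - x) powr \<alpha>"
      using holder_boundD(2)[OF f] by (simp add: always_eventually)
    have "((\<lambda>y. norm (y - x)) \<longlongrightarrow> norm (x - x)) (at x)" by (intro tendsto_intros)
    then have "((\<lambda>y. norm (y - x) powr \<alpha>) \<longlongrightarrow> 0) (at x)"
      using \<alpha> by (intro tendsto_zero_powrI[of _ _ _ \<alpha>]) (auto intro: tendsto_const)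
    then show "((\<lambda>y. M * norm (y - x) powr \<alpha>) \<longlongrightarrow> 0) (at x)"
      using tendsto_mult_right_zero by blast
  qed
  then show ?thesis by (simp add: continuous_at_imp_continuous_on)
qed

lemma odd_oddD:
  assumes "odd_odd f"
  shows "f (vector [- y $ 1, y $ 2]) = - f y" "f (vector [y $ 1, - y $ 2]) = - f y" "f 0 = 0"
    "y $ 1 = 0 \<Longrightarrow> f y = 0" "y $ 2 = 0 \<Longrightarrow> f y = 0"
proof -
  have v: "y = vector [y $ 1, y $ 2]" for y :: "real^2" by (simp add: real2_eq_iff)
  have h: "f (vector [a, b]) = - f (vector [a, - b])" "f (vector [a, b]) = - f (vector [- a, b])" for a b
    using assms unfolding odd_odd_def by blast+
  show r: "f (vector [- y $ 1, y $ 2]) = - f y" "f (vector [y $ 1, - y $ 2]) = - f y" for y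
    using h(2)[of "y $ 1" "y $ 2"] h(1)[of "y $ 1" "y $ 2"] v[of y] by auto
  show z: "f y = 0" if "y $ 1 = 0" for y
    using r(1)[of y] that v[of y] by auto
  show "f y = 0" if "y $ 2 = 0"
    using r(2)[of y] that v[of y] by auto
  show "f 0 = 0" by (rule z) simp
qed

text \<open>The rate of the linear strain field \<open>(x\<^sub>1, -x\<^sub>2)\<close> that the part of \<open>f\<close> outside the ball of radius \<open>\<rho>\<close>
  generates at the origin.\<close>

definition strain :: "real \<Rightarrow> real \<Rightarrow> (real^2 \<Rightarrow> real) \<Rightarrow> real" where
  "strain \<alpha> \<rho> f = (2 + \<alpha>) *
     (\<integral>y. indicat_real {y. \<rho> < norm y} y * (f y * (y $ 1 * y $ 2) * norm y powr (-4-\<alpha>)) \<partial>lborel)"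

lemma abs_mult_le_norm2: "\<bar>(y :: real^2) $ 1 * y $ 2\<bar> \<le> norm y powr 2"
proof -
  have "\<bar>y $ 1\<bar> \<le> norm y" "\<bar>y $ 2\<bar> \<le> norm y" by (rule component_le_norm_cart)+
  then have "\<bar>y $ 1 * y $ 2\<bar> \<le> norm y * norm y" unfolding abs_mult by (intro mult_mono) auto
  then show ?thesis by (cases "y = 0") (auto simp: powr_numeral power2_eq_square)
qed

lemma nth_borel [measurable]: "(\<lambda>y::real^2. y $ i) \<in> borel_measurable borel"
  by (intro borel_measurable_continuous_onI continuous_intros)

lemma reflection_integral_zero:
  fixes h :: "real^2 \<Rightarrow> real"
  assumes [measurable]: "h \<in> borel_measurable borel" and ab: "(a, b) \<in> {(-1, 1), (1, -1 :: real)}"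
    and anti: "\<And>y. h (vector [a * y $ 1, b * y $ 2]) = - h y"
  shows "(\<integral>y. h y \<partial>lborel) = 0"
proof -
  have "(\<integral>y. h y \<partial>lborel) = (\<integral>y. h (vector [0 + a * (y::real^2) $ 1, 0 + b * y $ 2]) \<partial>lborel)"
    using ab by (subst integral_diag) auto
  also have "\<dots> = - (\<integral>y. h y \<partial>lborel)" by (simp add: anti)
  finally show ?thesis by simp
qed


lemma bounded_linear_perp: "bounded_linear perp"
proof (rule bounded_linear_intro[where K=1])
  show "perp (r *\<^sub>R x) = r *\<^sub>R perp x" for r x by (simp add: real2_eq_iff)
qed (simp_all add: perp_add)

lemma perp_borel [measurable]: "perp \<in> borel_measurable borel"
  by (intro borel_measurable_continuous_onI linear_continuous_on bounded_linear_perp)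

lemma strain_integrand_bound:
  assumes "\<bar>f y\<bar> \<le> M"
  shows "\<bar>f y * (y $ 1 * y $ 2) * norm (y :: real^2) powr (-4-\<alpha>)\<bar> \<le> M * norm y powr (-(2+\<alpha>))"
proof -
  have "\<bar>f y * (y $ 1 * y $ 2) * norm y powr (-4-\<alpha>)\<bar> \<le> (M * norm y powr 2) * norm y powr (-4-\<alpha>)"
    unfolding abs_mult[of _ "norm y powr (-4-\<alpha>)"] abs_mult[of "f y"]
    using assms abs_mult_le_norm2[of y] by (intro mult_mono) auto
  also have "\<dots> = M * norm y powr (-(2+\<alpha>))"
    using powr_add[of "norm y" 2 "-4-\<alpha>"] by (simp del: powr_numeral)
  finally show ?thesis .
qed

text \<open>Near the origin the velocity is linear up to \<open>O(M \<rho>)\<close>. The part of \<open>f\<close> in the ball of radius \<open>\<rho>\<close>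
  contributes \<open>O(M \<rho>)\<close> because there \<open>\<bar>f\<bar> \<le> M \<rho> powr \<alpha>\<close> and the
  kernel has integral \<open>O(\<rho> powr (1-\<alpha>))\<close>. For the part outside, the kernel is expanded
  to first order; in each component all terms but one are even in \<open>y\<^sub>1\<close> or in \<open>y\<^sub>2\<close>, so that their
  integrals against \<open>f\<close> vanish, and the remaining one is the strain. All bounds are uniform in the
  truncation radius.\<close>

lemma velocity_estimate:
  assumes \<alpha>: "0 < \<alpha>" "\<alpha> < 1"
  shows "\<exists>C>0. \<forall>f M v \<rho> x. odd_odd f \<longrightarrow> holder_bound \<alpha> M f \<longrightarrow> has_velocity \<alpha> f v \<longrightarrow> 0 < \<rho> \<longrightarrow> norm x \<le> \<rho> / 2 \<longrightarrow>
       norm (v x - strain \<alpha> \<rho> f *\<^sub>R vector [x $ 1, - x $ 2]) \<le> C * M * \<rho>"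
proof -
  obtain CT where CT: "0 < CT"
    "\<And>w x :: real^2. w \<noteq> 0 \<Longrightarrow> norm x \<le> norm w / 2 \<Longrightarrow>
      norm ((1 / norm (w + x) powr (2 + \<alpha>)) *\<^sub>R perp (w + x) - kernel_order1 \<alpha> w x)
        \<le> CT * (norm x)\<^sup>2 * norm w powr (-3-\<alpha>)"
    by (rule kernel_Taylor[OF \<alpha>(1)]) blast
  obtain C3 where C3: "0 < C3"
    "\<And>\<rho>. 0 < \<rho> \<Longrightarrow> integrable lborel (\<lambda>y::real^2. indicat_real {y. \<rho> < norm y} y * norm y powr (-3))"
    "\<And>\<rho>. 0 < \<rho> \<Longrightarrow> (\<integral>y. indicat_real {y::real^2. \<rho> < norm y} y * norm y powr (-3) \<partial>lborel) \<le> C3 * \<rho> powr (2 - 3)"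
    using tail_power_bound[of 3] by auto
  have tail2: "integrable lborel (\<lambda>y::real^2. indicat_real {y. \<rho> < norm y} y * norm y powr (-(2+\<alpha>)))" if "0 < \<rho>" for \<rho>
    using tail_power_bound[of "2 + \<alpha>"] \<alpha> that by auto
  have "0 < 1 + \<alpha>" "1 + \<alpha> < 2" using \<alpha> by auto
  from local_power_bound[OF this] obtain CL where CL: "0 < CL"
    "\<And>\<rho> x. 0 < \<rho> \<Longrightarrow> integrable lborel (\<lambda>y::real^2. indicat_real (cball x \<rho>) y * norm (x - y) powr (-(1+\<alpha>)))"
    "\<And>\<rho> (x::real^2). 0 < \<rho> \<Longrightarrow> (\<integral>y. indicat_real (cball x \<rho>) y * norm (x - y) powr (-(1+\<alpha>)) \<partial>lborel) \<le> CL * \<rho> powr (2 - (1 + \<alpha>))"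
    by auto
  define C where "C = CL * 2 powr (1 - \<alpha>) + CT * C3 / 4"
  have C: "0 < C" using CT CL C3 by (auto simp: C_def intro!: add_pos_pos)
  have main: "\<bar>v x $ i - strain \<alpha> \<rho> f * s\<bar> \<le> C * M * \<rho>"
    if odd: "odd_odd f" and holder: "holder_bound \<alpha> M f" and vel: "has_velocity \<alpha> f v"
      and \<rho>: "0 < \<rho>" and x: "norm x \<le> \<rho> / 2" and i: "(i, s) \<in> {(1, x $ 1), (2, - x $ 2)}"
    for f M v \<rho> x i s
  proof -
    have [measurable]: "f \<in> borel_measurable borel"
      by (intro borel_measurable_continuous_onI holder_bound_continuous[OF holder \<alpha>(1)])
    have M: "0 \<le> M" and fM: "\<And>y. \<bar>f y\<bar> \<le> M" and f\<alpha>: "\<And>y. \<bar>f y\<bar> \<le> M * norm y powr \<alpha>"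
      using holder_boundD[OF holder] odd_oddD(3)[OF odd] by (auto, metis diff_zero)
    define k where "k = (\<lambda>y. (1 / norm (x - y) powr (2 + \<alpha>)) *\<^sub>R perp (x - y))"
    define K1 where "K1 = (\<lambda>y. kernel_order1 \<alpha> (- y) x)"
    have [measurable]: "k \<in> borel_measurable borel" unfolding k_def by measurable
    have [measurable]: "K1 \<in> borel_measurable borel" unfolding K1_def kernel_order1_def by measurable
    have normk: "norm (k y) = norm (x - y) powr (-(1+\<alpha>))" for y
    proof (cases "x = y")
      case False
      then have "norm (k y) = norm (x - y) powr 1 / norm (x - y) powr (2 + \<alpha>)"
        by (simp add: k_def)
      also have "\<dots> = norm (x - y) powr (-(1+\<alpha>))"
        by (subst powr_diff[symmetric]) (simp add: algebra_simps)
      finally show ?thesis .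
    qed (simp add: k_def)
    define A where "A = (\<lambda>R. {y::real^2. \<rho> < norm y \<and> norm y < R})"
    have [measurable]: "A R \<in> sets borel" for R unfolding A_def by measurable
    have int_ball: "integrable lborel (\<lambda>y. indicat_real (ball 0 R) y *\<^sub>R (f y *\<^sub>R k y))" for R
    proof (rule Bochner_Integration.integrable_bound)
      let ?r = "norm x + \<bar>R\<bar> + 1"
      show "integrable lborel (\<lambda>y. M * (indicat_real (cball x ?r) y * norm (x - y) powr (-(1+\<alpha>))))"
        using CL(2)[of ?r x] by (intro integrable_mult_right) (auto simp: add_nonneg_pos)
      show "AE y in lborel. norm (indicat_real (ball 0 R) y *\<^sub>R (f y *\<^sub>R k y))
          \<le> norm (M * (indicat_real (cball x ?r) y * norm (x - y) powr (-(1+\<alpha>))))"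
      proof (intro AE_I2)
        fix y
        have "y \<in> ball 0 R \<Longrightarrow> y \<in> cball x ?r"
          using norm_triangle_ineq4[of x y] by (auto simp: dist_norm)
        then show "norm (indicat_real (ball 0 R) y *\<^sub>R (f y *\<^sub>R k y))
          \<le> norm (M * (indicat_real (cball x ?r) y * norm (x - y) powr (-(1+\<alpha>))))"
          using M fM[of y] by (auto simp: indicator_def normk mult_right_mono)
      qed
    qed measurable
    have int_i: "integrable lborel (\<lambda>y. indicat_real (ball 0 R) y * (f y * k y $ i))" for R
      using integrable_bounded_linear[OF bounded_linear_vec_nth[of i] int_ball[of R]] by (simp add: mult.assoc)
    have trunc: "(LINT y : ball 0 R | lebesgue. (f y / norm (x - y) powr (2 + \<alpha>)) *\<^sub>R perp (x - y)) $ i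
        = (\<integral>y. indicat_real (ball 0 R) y * (f y * k y $ i) \<partial>lborel)" for R
    proof -
      have "(LINT y : ball 0 R | lebesgue. (f y / norm (x - y) powr (2 + \<alpha>)) *\<^sub>R perp (x - y))
          = (\<integral>y. indicat_real (ball 0 R) y *\<^sub>R (f y *\<^sub>R k y) \<partial>lebesgue)"
        by (simp add: set_lebesgue_integral_def k_def)
      also have "\<dots> = (\<integral>y. indicat_real (ball 0 R) y *\<^sub>R (f y *\<^sub>R k y) \<partial>lborel)"
        by (rule integral_completion) measurable
      finally show ?thesis
        using integral_bounded_linear[OF bounded_linear_vec_nth[of i] int_ball[of R]] by (simp add: mult.assoc)
    qed
    define S where "S = (\<lambda>R. (2 + \<alpha>) * (\<integral>y. indicat_real (A R) y * (f y * (y $ 1 * y $ 2) * norm y powr (-4-\<alpha>)) \<partial>lborel))"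
    have dom: "norm (indicat_real B y * (f y * (y $ 1 * y $ 2) * norm y powr (-4-\<alpha>)))
        \<le> M * (indicat_real {y. \<rho> < norm y} y * norm y powr (-(2+\<alpha>)))" if "B \<subseteq> {y. \<rho> < norm y}" for B and y :: "real^2"
      using strain_integrand_bound[of f y M \<alpha>] fM[of y] M that by (auto simp: indicator_def)
    have intdom: "integrable lborel (\<lambda>y::real^2. M * (indicat_real {y. \<rho> < norm y} y * norm y powr (-(2+\<alpha>))))"
      using tail2[OF \<rho>] by (rule integrable_mult_right)
    have S_lim: "(S \<longlongrightarrow> strain \<alpha> \<rho> f) at_top"
      unfolding S_def strain_def
    proof (intro tendsto_mult tendsto_const integral_dominated_convergence_at_top)
      show "integrable lborel (\<lambda>y::real^2. M * (indicat_real {y. \<rho> < norm y} y * norm y powr (-(2+\<alpha>))))"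
        by (rule intdom)
      show "\<forall>\<^sub>F R in at_top. AE y in lborel. norm (indicat_real (A R) y * (f y * (y $ 1 * y $ 2) * norm y powr (-4-\<alpha>)))
        \<le> M * (indicat_real {y. \<rho> < norm y} y * norm y powr (-(2+\<alpha>)))"
        by (intro always_eventually allI AE_I2 dom) (auto simp: A_def)
      show "AE y in lborel. ((\<lambda>R. indicat_real (A R) y * (f y * (y $ 1 * y $ 2) * norm y powr (-4-\<alpha>))) \<longlongrightarrow>
          indicat_real {y. \<rho> < norm y} y * (f y * (y $ 1 * y $ 2) * norm y powr (-4-\<alpha>))) at_top"
      proof (intro AE_I2 tendsto_eventually)
        fix y :: "real^2"
        show "\<forall>\<^sub>F R in at_top. indicat_real (A R) y * (f y * (y $ 1 * y $ 2) * norm y powr (-4-\<alpha>)) =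
          indicat_real {y. \<rho> < norm y} y * (f y * (y $ 1 * y $ 2) * norm y powr (-4-\<alpha>))"
          using eventually_gt_at_top[of "norm y"] by eventually_elim (auto simp: A_def indicator_def)
      qed
    qed measurable
    have est: "\<bar>(\<integral>y. indicat_real (ball 0 R) y * (f y * k y $ i) \<partial>lborel) - S R * s\<bar> \<le> C * M * \<rho>" if R: "\<rho> < R" for R
    proof -
      have int_in: "integrable lborel (\<lambda>y. indicat_real (cball 0 \<rho>) y * (f y * k y $ i))"
        and int_A: "integrable lborel (\<lambda>y. indicat_real (A R) y * (f y * k y $ i))"
        by (rule Bochner_Integration.integrable_bound[OF int_i[of R]];
            use R in \<open>auto simp: indicator_def A_def intro!: AE_I2\<close>)+
      have "(\<integral>y. indicat_real (ball 0 R) y * (f y * k y $ i) \<partial>lborel)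
          = (\<integral>y. indicat_real (cball 0 \<rho>) y * (f y * k y $ i) + indicat_real (A R) y * (f y * k y $ i) \<partial>lborel)"
        by (rule Bochner_Integration.integral_cong) (use R in \<open>auto simp: indicator_def A_def\<close>)
      then have split: "(\<integral>y. indicat_real (ball 0 R) y * (f y * k y $ i) \<partial>lborel)
          = (\<integral>y. indicat_real (cball 0 \<rho>) y * (f y * k y $ i) \<partial>lborel) + (\<integral>y. indicat_real (A R) y * (f y * k y $ i) \<partial>lborel)"
        using int_in int_A by simp
      have inner: "\<bar>\<integral>y. indicat_real (cball 0 \<rho>) y * (f y * k y $ i) \<partial>lborel\<bar> \<le> CL * 2 powr (1 - \<alpha>) * M * \<rho>"
      proof -
        have "\<bar>\<integral>y. indicat_real (cball 0 \<rho>) y * (f y * k y $ i) \<partial>lborel\<bar>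
            \<le> (\<integral>y. (M * \<rho> powr \<alpha>) * (indicat_real (cball x (2*\<rho>)) y * norm (x - y) powr (-(1+\<alpha>))) \<partial>lborel)"
        proof (rule order_trans[OF integral_abs_bound], rule integral_mono)
          show "integrable lborel (\<lambda>y. \<bar>indicat_real (cball 0 \<rho>) y * (f y * k y $ i)\<bar>)"
            using int_in by (rule integrable_abs)
          show "integrable lborel (\<lambda>y. (M * \<rho> powr \<alpha>) * (indicat_real (cball x (2*\<rho>)) y * norm (x - y) powr (-(1+\<alpha>))))"
            using CL(2)[of "2*\<rho>" x] \<rho> by (intro integrable_mult_right) auto
          fix y :: "real^2"
          show "\<bar>indicat_real (cball 0 \<rho>) y * (f y * k y $ i)\<bar>
            \<le> (M * \<rho> powr \<alpha>) * (indicat_real (cball x (2*\<rho>)) y * norm (x - y) powr (-(1+\<alpha>)))"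
          proof (cases "y \<in> cball 0 \<rho>")
            case True
            then have "norm (x - y) \<le> 2 * \<rho>"
              using norm_triangle_ineq4[of x y] x \<rho> by auto
            moreover have "\<bar>f y\<bar> \<le> M * \<rho> powr \<alpha>"
              using True \<alpha> M by (intro order_trans[OF f\<alpha>[of y]] mult_left_mono powr_mono2) auto
            moreover have "\<bar>k y $ i\<bar> \<le> norm (x - y) powr (-(1+\<alpha>))"
              using component_le_norm_cart[of "k y" i] by (simp add: normk)
            ultimately show ?thesis
              using True by (auto simp: dist_norm abs_mult intro!: mult_mono)
          qed (use M in simp)
        qed
        also have "\<dots> = (M * \<rho> powr \<alpha>) * (\<integral>y. indicat_real (cball x (2*\<rho>)) y * norm (x - y) powr (-(1+\<alpha>)) \<partial>lborel)"
          by simp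
        also have "\<dots> \<le> (M * \<rho> powr \<alpha>) * (CL * (2 * \<rho>) powr (2 - (1 + \<alpha>)))"
          using CL(3)[of "2*\<rho>" x] \<rho> M by (intro mult_left_mono) auto
        also have "\<dots> = CL * 2 powr (1 - \<alpha>) * M * (\<rho> powr \<alpha> * \<rho> powr (1 - \<alpha>))"
          using \<rho> by (simp add: powr_mult)
        also have "\<rho> powr \<alpha> * \<rho> powr (1 - \<alpha>) = \<rho>" using \<rho> by (simp add: powr_add[symmetric])
        finally show ?thesis .
      qed
      have rem_dom: "norm (indicat_real (A R) y * (f y * (k y - K1 y) $ i))
          \<le> (M * CT * (\<rho> / 2)\<^sup>2) * (indicat_real {y. \<rho> < norm y} y * norm y powr (-3))" for y
      proof (cases "y \<in> A R")
        case True
        then have y: "\<rho> < norm y" by (simp add: A_def)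
        have "\<bar>(k y - K1 y) $ i\<bar> \<le> norm (k y - K1 y)" by (rule component_le_norm_cart)
        also have "\<dots> \<le> CT * (norm x)\<^sup>2 * norm y powr (-3-\<alpha>)"
        proof -
          have "y \<noteq> 0" using y \<rho> by auto
          then show ?thesis using CT(2)[of "-y" x] y x by (simp add: k_def K1_def)
        qed
        also have "\<dots> \<le> CT * (\<rho> / 2)\<^sup>2 * norm y powr (-3-\<alpha>)"
          using CT(1) x by (intro mult_right_mono mult_left_mono power_mono) auto
        finally have "\<bar>f y\<bar> * \<bar>(k y - K1 y) $ i\<bar> \<le> (M * norm y powr \<alpha>) * (CT * (\<rho> / 2)\<^sup>2 * norm y powr (-3-\<alpha>))"
          using f\<alpha>[of y] M by (intro mult_mono) auto
        also have "\<dots> = (M * CT * (\<rho> / 2)\<^sup>2) * (norm y powr \<alpha> * norm y powr (-3-\<alpha>))" by simp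
        also have "norm y powr \<alpha> * norm y powr (-3-\<alpha>) = norm y powr (-3)" by (simp add: powr_add[symmetric])
        finally show ?thesis using True y by (simp add: abs_mult)
      qed (use M CT in simp)
      have int_rem: "integrable lborel (\<lambda>y. indicat_real (A R) y * (f y * (k y - K1 y) $ i))"
        by (rule Bochner_Integration.integrable_bound[OF integrable_mult_right[OF C3(2)[OF \<rho>]], of _ "M * CT * (\<rho> / 2)\<^sup>2"])
          (use rem_dom M CT in \<open>auto intro!: AE_I2\<close>)
      have rem: "\<bar>\<integral>y. indicat_real (A R) y * (f y * (k y - K1 y) $ i) \<partial>lborel\<bar> \<le> CT * C3 / 4 * M * \<rho>"
      proof -
        have "\<bar>\<integral>y. indicat_real (A R) y * (f y * (k y - K1 y) $ i) \<partial>lborel\<bar>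
            \<le> (\<integral>y. (M * CT * (\<rho> / 2)\<^sup>2) * (indicat_real {y. \<rho> < norm y} y * norm (y::real^2) powr (-3)) \<partial>lborel)"
          using rem_dom
          by (intro order_trans[OF integral_abs_bound] integral_mono integrable_abs[OF int_rem]
              integrable_mult_right[OF C3(2)[OF \<rho>]]) auto
        also have "\<dots> = (M * CT * (\<rho> / 2)\<^sup>2) * (\<integral>y. indicat_real {y. \<rho> < norm y} y * norm (y::real^2) powr (-3) \<partial>lborel)"
          by simp
        also have "\<dots> \<le> (M * CT * (\<rho> / 2)\<^sup>2) * (C3 * \<rho> powr (2 - 3))"
          using C3(3)[OF \<rho>] M CT by (intro mult_left_mono) auto
        also have "\<dots> = CT * C3 / 4 * M * \<rho>"
          using \<rho> powr_minus_divide[of \<rho> 1] by (simp add: power2_eq_square)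
        finally show ?thesis .
      qed
      \<comment> \<open>the terms of the expansion that are even in one coordinate\<close>
      define h where "h = (\<lambda>y. indicat_real (A R) y * (f y * (K1 y $ i - s * ((2 + \<alpha>) * (y $ 1 * y $ 2) * norm y powr (-4-\<alpha>)))))"
      have int_S: "integrable lborel (\<lambda>y. indicat_real (A R) y * (f y * (y $ 1 * y $ 2) * norm y powr (-4-\<alpha>)))"
      proof (rule Bochner_Integration.integrable_bound[OF intdom], measurable, intro AE_I2)
        fix y :: "real^2"
        have "A R \<subseteq> {y. \<rho> < norm y}" by (auto simp: A_def)
        from dom[OF this, of y]
        show "norm (indicat_real (A R) y * (f y * (y $ 1 * y $ 2) * norm y powr (-4-\<alpha>)))
          \<le> norm (M * (indicat_real {y. \<rho> < norm y} y * norm y powr (-(2+\<alpha>))))"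
          using M by simp
      qed
      have h_eq: "h y = indicat_real (A R) y * (f y * k y $ i) - indicat_real (A R) y * (f y * (k y - K1 y) $ i)
          - (s * (2 + \<alpha>)) * (indicat_real (A R) y * (f y * (y $ 1 * y $ 2) * norm y powr (-4-\<alpha>)))" for y
        by (simp add: h_def algebra_simps)
      have "(\<integral>y. h y \<partial>lborel) = 0"
      proof (cases "i = 1")
        case True
        then have s: "s = x $ 1" using i by auto
        show ?thesis
        proof (rule reflection_integral_zero[where a="-1" and b=1])
          fix y :: "real^2"
          have n: "norm (vector [- y $ 1, y $ 2] :: real^2) = norm y"
          proof -
            have "(norm (vector [- y $ 1, y $ 2] :: real^2))\<^sup>2 = (norm y)\<^sup>2" by (simp add: norm_real2)
            then show ?thesis by simp
          qed
          have "h y = indicat_real (A R) y * (f y * (norm y powr (-2-\<alpha>) * (y $ 2 - x $ 2)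
              + (2 + \<alpha>) * x $ 2 * (y $ 2)\<^sup>2 * norm y powr (-4-\<alpha>)))" for y
            unfolding h_def True s K1_def kernel_order1_def
            by (simp add: inner_real2 power2_eq_square algebra_simps)
          then show "h (vector [- 1 * y $ 1, 1 * y $ 2]) = - h y"
            using odd_oddD(1)[OF odd, of y] n by (simp add: A_def indicator_def)
        qed (auto simp: h_def)
      next
        case False
        then have s: "s = - x $ 2" and i2: "i = 2" using i by auto
        show ?thesis
        proof (rule reflection_integral_zero[where a=1 and b="-1"])
          fix y :: "real^2"
          have n: "norm (vector [y $ 1, - y $ 2] :: real^2) = norm y"
          proof -
            have "(norm (vector [y $ 1, - y $ 2] :: real^2))\<^sup>2 = (norm y)\<^sup>2" by (simp add: norm_real2)
            then show ?thesis by simp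
          qed
          have "h y = indicat_real (A R) y * (f y * (norm y powr (-2-\<alpha>) * (x $ 1 - y $ 1)
              - (2 + \<alpha>) * x $ 1 * (y $ 1)\<^sup>2 * norm y powr (-4-\<alpha>)))" for y
            unfolding h_def i2 s K1_def kernel_order1_def
            by (simp add: inner_real2 power2_eq_square algebra_simps)
          then show "h (vector [1 * y $ 1, - 1 * y $ 2]) = - h y"
            using odd_oddD(2)[OF odd, of y] n by (simp add: A_def indicator_def)
        qed (auto simp: h_def)
      qed
      moreover have "(\<integral>y. h y \<partial>lborel) = (\<integral>y. indicat_real (A R) y * (f y * k y $ i) \<partial>lborel)
          - (\<integral>y. indicat_real (A R) y * (f y * (k y - K1 y) $ i) \<partial>lborel) - s * S R"
        unfolding h_eq S_def using int_A int_rem int_S by simp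
      ultimately have "(\<integral>y. indicat_real (ball 0 R) y * (f y * k y $ i) \<partial>lborel) - S R * s
          = (\<integral>y. indicat_real (cball 0 \<rho>) y * (f y * k y $ i) \<partial>lborel)
            + (\<integral>y. indicat_real (A R) y * (f y * (k y - K1 y) $ i) \<partial>lborel)"
        using split by (simp add: mult.commute)
      then show ?thesis using inner rem by (simp add: C_def algebra_simps)
    qed
    have "((\<lambda>R. LINT y : ball 0 R | lebesgue. (f y / norm (x - y) powr (2 + \<alpha>)) *\<^sub>R perp (x - y)) \<longlongrightarrow> v x) at_top"
      using vel unfolding has_velocity_def by blast
    then have "((\<lambda>R. \<integral>y. indicat_real (ball 0 R) y * (f y * k y $ i) \<partial>lborel) \<longlongrightarrow> v x $ i) at_top"
      unfolding trunc[symmetric] by (rule tendsto_vec_nth)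
    then have "((\<lambda>R. \<bar>(\<integral>y. indicat_real (ball 0 R) y * (f y * k y $ i) \<partial>lborel) - S R * s\<bar>)
        \<longlongrightarrow> \<bar>v x $ i - strain \<alpha> \<rho> f * s\<bar>) at_top"
      by (intro tendsto_intros S_lim)
    then show ?thesis
      by (rule tendsto_upperbound)
        (use eventually_mono[OF eventually_gt_at_top[of \<rho>] est] in auto)
  qed
  show ?thesis
  proof (intro exI[of _ "2 * C"] conjI allI impI)
    fix f M v \<rho> and x :: "real^2"
    assume A: "odd_odd f" "holder_bound \<alpha> M f" "has_velocity \<alpha> f v" "0 < \<rho>" "norm x \<le> \<rho> / 2"
    let ?z = "v x - strain \<alpha> \<rho> f *\<^sub>R vector [x $ 1, - x $ 2]"
    have "norm ?z \<le> \<bar>?z $ 1\<bar> + \<bar>?z $ 2\<bar>"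
      using norm_le_l1_cart[of ?z] by (simp add: sum_2)
    also have "\<dots> \<le> C * M * \<rho> + C * M * \<rho>"
      using main[OF A, of 1 "x $ 1"] main[OF A, of 2 "- x $ 2"] by (intro add_mono) auto
    finally show "norm ?z \<le> 2 * C * M * \<rho>" by simp
  qed (use C in simp)
qed

section \<open>Test functions carried by a hyperbolic flow\<close>

lemma smooth_primitive:
  fixes \<psi> :: "real \<Rightarrow> real"
  assumes \<psi>: "smooth \<psi>" "\<And>t. 0 \<le> \<psi> t" "\<And>t. t \<notin> {a<..<b} \<Longrightarrow> \<psi> t = 0" and ab: "a \<le> b"
  obtains F where "smooth F" "\<And>t. (F has_real_derivative \<psi> t) (at t)" "\<And>t. t \<le> a \<Longrightarrow> F t = 0"
    "\<And>t. b \<le> t \<Longrightarrow> F t = (\<integral>t. \<psi> t \<partial>lborel)" "\<And>t. 0 \<le> F t" "\<And>t. F t \<le> (\<integral>t. \<psi> t \<partial>lborel)"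
proof -
  have cont: "isCont \<psi> t" for t
    using smooth_continuous_on[OF \<psi>(1), of UNIV] continuous_on_eq_continuous_at by blast
  obtain F0 where F0: "\<And>t. (F0 has_real_derivative \<psi> t) (at t)"
    using einterval_antiderivative[of "-\<infinity>" \<infinity> \<psi>] cont
    by (auto simp: has_real_derivative_iff_has_vector_derivative)
  define F where "F = (\<lambda>t. F0 t - F0 a)"
  have F: "(F has_real_derivative \<psi> t) (at t)" for t
    unfolding F_def using F0[of t] by (auto intro!: derivative_eq_intros)
  have mono: "F s \<le> F t" if "s \<le> t" for s t
    by (rule DERIV_nonneg_imp_nondecreasing[OF that]) (use F \<psi>(2) in blast)
  have flat: "F s = F t" if "s \<le> t" "t \<le> a \<or> b \<le> s" for s t
  proof (cases "s = t")
    case False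
    have "continuous_on {s..t} F"
      using F by (intro continuous_at_imp_continuous_on ballI DERIV_isCont) blast
    moreover have "(F has_real_derivative 0) (at y)" if "s < y" "y < t" for y
      using F[of y] \<psi>(3)[of y] that \<open>t \<le> a \<or> b \<le> s\<close> by auto
    ultimately show ?thesis using DERIV_isconst_end[of s t F] False that by auto
  qed simp
  have Fa: "F a = 0" by (simp add: F_def)
  have "(\<integral>t. \<psi> t * indicator {a..b} t \<partial>lborel) = F b - F a"
    by (rule integral_FTC_Icc_real) (use ab F cont in auto)
  also have "(\<integral>t. \<psi> t * indicator {a..b} t \<partial>lborel) = (\<integral>t. \<psi> t \<partial>lborel)"
  proof (rule Bochner_Integration.integral_cong)
    show "\<psi> t * indicator {a..b} t = \<psi> t" for t
      using \<psi>(3)[of t] by (cases "t \<in> {a<..<b}") auto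
  qed simp
  finally have Fb: "F b = (\<integral>t. \<psi> t \<partial>lborel)" using Fa by simp
  show ?thesis
  proof (rule that)
    show "smooth F" by (rule smooth_real_derivative[OF F \<psi>(1)])
    show "F t = 0" if "t \<le> a" for t using flat[OF that] Fa by auto
    then show "0 \<le> F t" for t using mono[of a t] Fa by (cases "t \<le> a") auto
    show "F t = (\<integral>t. \<psi> t \<partial>lborel)" if "b \<le> t" for t using flat[OF that] Fb by auto
    then show "F t \<le> (\<integral>t. \<psi> t \<partial>lborel)" for t using mono[of t b] Fb by (cases "b \<le> t") auto
  qed (rule F)
qed

text \<open>The flow of the strain field \<open>(x\<^sub>1, -x\<^sub>2)\<close> at time \<open>g\<close>.\<close>

definition hyp :: "real \<Rightarrow> real^2 \<Rightarrow> real^2" where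
  "hyp g x = vector [exp g * x $ 1, exp (- g) * x $ 2]"

lemma hyp_nth [simp]: "hyp g x $ 1 = exp g * x $ 1" "hyp g x $ 2 = exp (- g) * x $ 2"
  by (simp_all add: hyp_def)

lemma hyp_0 [simp]: "hyp 0 x = x"
  and hyp_inverse: "hyp g (hyp (- g) x) = x"
  by (simp_all add: real2_eq_iff mult.assoc[symmetric] exp_add[symmetric])

lemma norm_le_abs_sum: "norm (x :: real^2) \<le> \<bar>x $ 1\<bar> + \<bar>x $ 2\<bar>"
  using norm_le_l1_cart[of x] by (simp add: sum_2)

text \<open>A bump of radius \<open>r\<close> around \<open>z\<close>, composed with \<open>hyp (-g)\<close>: it is carried along when \<open>g\<close> evolves.
  The area-preserving map leaves its integral unchanged.\<close>

definition tracer :: "real^2 \<Rightarrow> real \<Rightarrow> real \<Rightarrow> real^2 \<Rightarrow> real" where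
  "tracer z r g x = bump ((exp (- g) * x $ 1 - z $ 1) / r) * bump ((exp g * x $ 2 - z $ 2) / r)"

definition tracer_mass :: real where
  "tracer_mass = (\<integral>y. bump (y $ 1) * bump (y $ 2) \<partial>(lborel :: (real^2) measure))"

lemma bump_borel [measurable]: "bump \<in> borel_measurable borel"
  by (intro borel_measurable_continuous_onI smooth_continuous_on smooth_bump)

lemma integrable_bump2: "integrable lborel (\<lambda>y::real^2. bump (y $ 1) * bump (y $ 2))"
proof (rule Bochner_Integration.integrable_bound[of _ "indicat_real (cball 0 2)"])
  show "integrable lborel (indicat_real (cball 0 2 :: (real^2) set))"
    by (intro integrable_real_indicator) (auto simp: emeasure_cball)
  show "AE y::real^2 in lborel. norm (bump (y $ 1) * bump (y $ 2)) \<le> norm (indicat_real (cball 0 2) y)"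
  proof (intro AE_I2)
    fix y :: "real^2"
    show "norm (bump (y $ 1) * bump (y $ 2)) \<le> norm (indicat_real (cball 0 2) y)"
    proof (cases "\<bar>y $ 1\<bar> \<le> 1 \<and> \<bar>y $ 2\<bar> \<le> 1")
      case True
      then have "norm y \<le> 2" using norm_le_abs_sum[of y] by linarith
      then show ?thesis by (simp add: abs_mult bump_nonneg bump_le_1 mult_le_one)
    next
      case False
      then consider "bump (y $ 1) = 0" | "bump (y $ 2) = 0"
        using bump_zero[of "y $ 1"] bump_zero[of "y $ 2"] by linarith
      then show ?thesis by cases simp_all
    qed
  qed
qed measurable

lemma tracer_mass_pos: "0 < tracer_mass"
proof -
  let ?f = "\<lambda>y::real^2. bump (y $ 1) * bump (y $ 2)"
  have "\<not> (AE y in lborel. ?f y = 0)"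
  proof
    assume "AE y in lborel. ?f y = 0"
    then have "AE y in lborel. y \<notin> ball (0 :: real^2) 1"
    proof eventually_elim
      case (elim y)
      have "?f y > 0" if "norm y < 1"
        using that component_le_norm_cart[of y 1] component_le_norm_cart[of y 2]
        by (intro mult_pos_pos bump_pos) auto
      then show ?case using elim by auto
    qed
    then have "ball (0 :: real^2) 1 \<in> null_sets lborel"
      by (subst (asm) AE_iff_null_sets[symmetric]) auto
    then show False by (auto simp: null_sets_def emeasure_ball unit_ball_vol_2)
  qed
  moreover have "0 \<le> tracer_mass" unfolding tracer_mass_def by (simp add: bump_nonneg)
  ultimately show ?thesis
    using integral_nonneg_eq_0_iff_AE[OF integrable_bump2] bump_nonneg
    unfolding tracer_mass_def by fastforce
qed

lemma tracer_borel [measurable]: "(\<lambda>(g, x). tracer z r g x) \<in> borel_measurable borel"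
proof -
  have "continuous_on UNIV (\<lambda>p. tracer z r (fst p) (snd p))"
    unfolding tracer_def divide_inverse
    by (intro continuous_intros continuous_on_compose2[OF smooth_continuous_on[OF smooth_bump, of UNIV]]) auto
  then show ?thesis by (simp add: borel_measurable_continuous_onI case_prod_beta')
qed

lemma tracer_bounds: "0 \<le> tracer z r g x" "tracer z r g x \<le> 1"
  by (auto simp: tracer_def bump_nonneg bump_le_1 intro!: mult_le_one)

lemma tracer_integral:
  assumes r: "0 < r"
  shows "integrable lborel (tracer z r g)" "(\<integral>x. tracer z r g x \<partial>lborel) = r\<^sup>2 * tracer_mass"
proof -
  let ?f = "\<lambda>y::real^2. bump (y $ 1) * bump (y $ 2)"
  have eq: "tracer z r g = (\<lambda>x. ?f (vector [- z $ 1 / r + (exp (- g) / r) * x $ 1, - z $ 2 / r + (exp g / r) * x $ 2]))"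
    by (simp add: tracer_def fun_eq_iff diff_divide_distrib)
  have nz: "exp (- g) / r \<noteq> 0" "exp g / r \<noteq> 0" using r by auto
  have jac: "\<bar>exp (- g) / r * (exp g / r)\<bar> = 1 / r\<^sup>2"
    using r by (simp add: power2_eq_square exp_minus field_simps)
  have [measurable]: "?f \<in> borel_measurable borel" by measurable
  show "integrable lborel (tracer z r g)"
    unfolding eq by (subst integral_diag(2)) (use nz integrable_bump2 in auto)
  show "(\<integral>x. tracer z r g x \<partial>lborel) = r\<^sup>2 * tracer_mass"
  proof -
    have "(\<integral>x. tracer z r g x \<partial>lborel) = (\<integral>y. ?f y \<partial>lborel) / \<bar>exp (- g) / r * (exp g / r)\<bar>"
      unfolding eq by (rule integral_diag(1)) (use nz in auto)
    then show ?thesis unfolding jac tracer_mass_def by simp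
  qed
qed

lemma tracer_support:
  assumes "tracer z r g x \<noteq> 0" "0 < r" "exp g \<le> E" "exp (- g) \<le> E"
  shows "norm (x - hyp g z) \<le> 2 * E * r"
proof -
  have n: "\<not> 1 \<le> \<bar>(exp (- g) * x $ 1 - z $ 1) / r\<bar>" "\<not> 1 \<le> \<bar>(exp g * x $ 2 - z $ 2) / r\<bar>"
    using assms(1) bump_zero by (auto simp: tracer_def)
  then have "\<bar>exp (- g) * x $ 1 - z $ 1\<bar> \<le> r" "\<bar>exp g * x $ 2 - z $ 2\<bar> \<le> r"
    using assms(2) by (auto simp: abs_divide)
  then have "exp g * \<bar>exp (- g) * x $ 1 - z $ 1\<bar> \<le> E * r" "exp (- g) * \<bar>exp g * x $ 2 - z $ 2\<bar> \<le> E * r"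
    using assms by (auto intro!: mult_mono order_trans[OF exp_ge_zero assms(3)])
  moreover have "exp g * \<bar>exp (- g) * x $ 1 - z $ 1\<bar> = \<bar>(x - hyp g z) $ 1\<bar>"
    by (subst abs_exp_cancel[symmetric], subst abs_mult[symmetric])
      (simp add: right_diff_distrib mult.assoc[symmetric] exp_add[symmetric])
  moreover have "exp (- g) * \<bar>exp g * x $ 2 - z $ 2\<bar> = \<bar>(x - hyp g z) $ 2\<bar>"
    by (subst abs_exp_cancel[symmetric], subst abs_mult[symmetric])
      (simp add: right_diff_distrib mult.assoc[symmetric] exp_add[symmetric])
  ultimately show ?thesis using norm_le_abs_sum[of "x - hyp g z"] by linarith
qed

lemma tracer_test_function:
  assumes \<Gamma>: "smooth \<Gamma>" and \<eta>: "smooth \<eta>" "\<And>t. t \<notin> {a..b} \<Longrightarrow> \<eta> t = 0" and b: "b < \<delta>" and r: "0 < r"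
  shows "(\<lambda>(t, x). \<eta> t * tracer z r (\<Gamma> t) x) \<in> test_functions \<delta>"
proof -
  let ?\<phi> = "\<lambda>(t, x). \<eta> t * tracer z r (\<Gamma> t) x"
  have fst': "smooth (\<lambda>p::real \<times> (real^2). fst p)" by (intro smooth_bounded_linear bounded_linear_fst)
  have snd': "smooth (\<lambda>p::real \<times> (real^2). snd p $ i)" for i
    by (intro smooth_bounded_linear bounded_linear_compose[OF bounded_linear_vec_nth bounded_linear_snd])
  have "smooth (\<lambda>p::real \<times> (real^2). \<eta> (fst p) * (bump ((exp (- \<Gamma> (fst p)) * snd p $ 1 - z $ 1) * (1 / r))
      * bump ((exp (\<Gamma> (fst p)) * snd p $ 2 - z $ 2) * (1 / r))))"
    by (intro smooth_mult smooth_compose[OF smooth_bump] smooth_diff smooth_const snd' smooth_uminus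
        smooth_compose[OF smooth_exp] smooth_compose[OF \<Gamma>] smooth_compose[OF \<eta>(1)] fst')
  then have sm: "smooth ?\<phi>" by (simp add: tracer_def case_prod_beta')
  have "compact (\<Gamma> ` {a..b})"
    by (intro compact_continuous_image smooth_continuous_on \<Gamma> compact_Icc)
  then have "bounded (\<Gamma> ` {a..b})" by (rule compact_imp_bounded)
  then obtain B where B: "\<forall>y\<in>\<Gamma> ` {a..b}. norm y \<le> B" unfolding bounded_iff by blast
  define R where "R = 2 * exp B * r + 2 * exp B * norm z"
  have supp: "{p. ?\<phi> p \<noteq> 0} \<subseteq> {a..b} \<times> cball 0 R"
  proof
    fix p :: "real \<times> (real^2)" assume "p \<in> {p. ?\<phi> p \<noteq> 0}"
    then obtain t x where p: "p = (t, x)" and nz: "\<eta> t \<noteq> 0" "tracer z r (\<Gamma> t) x \<noteq> 0" by (cases p) auto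
    have t: "t \<in> {a..b}" using nz(1) \<eta>(2) by blast
    then have "\<bar>\<Gamma> t\<bar> \<le> B" using B by auto
    then have e: "exp (\<Gamma> t) \<le> exp B" "exp (- \<Gamma> t) \<le> exp B" by auto
    have "\<bar>z $ 1\<bar> \<le> norm z" "\<bar>z $ 2\<bar> \<le> norm z" by (rule component_le_norm_cart)+
    then have "exp (\<Gamma> t) * \<bar>z $ 1\<bar> + exp (- \<Gamma> t) * \<bar>z $ 2\<bar> \<le> exp B * norm z + exp B * norm z"
      using e by (intro add_mono mult_mono) auto
    then have "norm (hyp (\<Gamma> t) z) \<le> 2 * exp B * norm z"
      using norm_le_abs_sum[of "hyp (\<Gamma> t) z"] by (simp add: abs_mult algebra_simps)
    moreover have "norm x \<le> norm (x - hyp (\<Gamma> t) z) + norm (hyp (\<Gamma> t) z)"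
      using norm_triangle_ineq[of "x - hyp (\<Gamma> t) z" "hyp (\<Gamma> t) z"] by simp
    ultimately have "norm x \<le> R"
      using tracer_support[OF nz(2) r e] by (simp add: R_def)
    then show "p \<in> {a..b} \<times> cball 0 R" using p t by simp
  qed
  have comp: "compact ({a..b} \<times> cball (0 :: real^2) R)" by (intro compact_Times compact_Icc compact_cball)
  then have cl: "closure {p. ?\<phi> p \<noteq> 0} \<subseteq> {a..b} \<times> cball 0 R"
    using supp by (intro closure_minimal compact_imp_closed)
  then have "compact (closure {p. ?\<phi> p \<noteq> 0})"
    using comp compact_closure bounded_subset compact_imp_bounded closure_subset by meson
  moreover have "closure {p. ?\<phi> p \<noteq> 0} \<subseteq> {..<\<delta>} \<times> UNIV" using cl b by auto
  ultimately show ?thesis using sm unfolding test_functions_def compactly_supported_def smooth_def by blast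
qed

text \<open>The derivative of the tracer at \<open>x\<close> in direction \<open>v\<close>.\<close>

definition tracer_grad :: "real^2 \<Rightarrow> real \<Rightarrow> real \<Rightarrow> real^2 \<Rightarrow> real^2 \<Rightarrow> real" where
  "tracer_grad z r g x v =
     bump' ((exp (- g) * x $ 1 - z $ 1) / r) * (exp (- g) * v $ 1 / r) * bump ((exp g * x $ 2 - z $ 2) / r)
   + bump ((exp (- g) * x $ 1 - z $ 1) / r) * (bump' ((exp g * x $ 2 - z $ 2) / r) * (exp g * v $ 2 / r))"

lemma tracer_has_derivative:
  assumes r: "0 < r"
  shows "(tracer z r g has_derivative tracer_grad z r g x) (at x)"
proof -
  have comp: "((\<lambda>x. bump ((c * x $ i - z $ i) / r)) has_derivative
      (\<lambda>v. bump' ((c * x $ i - z $ i) / r) * (c * v $ i / r))) (at x)" for c i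
  proof -
    have "((\<lambda>x. (c * x $ i - z $ i) / r) has_derivative (\<lambda>v. c * v $ i / r)) (at x)"
      using r by (auto intro!: derivative_eq_intros bounded_linear_imp_has_derivative bounded_linear_vec_nth)
    from has_derivative_compose[OF this bump_DERIV[unfolded has_field_derivative_def]]
    show ?thesis .
  qed
  have "((\<lambda>x. bump ((exp (- g) * x $ 1 - z $ 1) / r) * bump ((exp g * x $ 2 - z $ 2) / r)) has_derivative
      (\<lambda>v. bump ((exp (- g) * x $ 1 - z $ 1) / r) * (bump' ((exp g * x $ 2 - z $ 2) / r) * (exp g * v $ 2 / r))
       + bump' ((exp (- g) * x $ 1 - z $ 1) / r) * (exp (- g) * v $ 1 / r) * bump ((exp g * x $ 2 - z $ 2) / r))) (at x)"
    by (rule has_derivative_mult[OF comp comp])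
  then show ?thesis unfolding tracer_def[abs_def] tracer_grad_def[abs_def] by (simp add: add.commute)
qed

text \<open>If \<open>g\<close> grows at rate \<open>\<gamma>\<close>, the tracer solves the transport equation for the velocity
  \<open>\<gamma> (x\<^sub>1, -x\<^sub>2)\<close>.\<close>

lemma tracer_time_derivative:
  assumes \<Gamma>: "(\<Gamma> has_real_derivative \<gamma>) (at t)" and r: "0 < r"
  shows "((\<lambda>t. tracer z r (\<Gamma> t) x) has_real_derivative - \<gamma> * tracer_grad z r (\<Gamma> t) x (vector [x $ 1, - x $ 2])) (at t)"
proof -
  have 1: "((\<lambda>t. (exp (- \<Gamma> t) * x $ 1 - z $ 1) / r) has_real_derivative exp (- \<Gamma> t) * - \<gamma> * x $ 1 / r) (at t)"
    using r by (auto intro!: derivative_eq_intros \<Gamma>)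
  have 2: "((\<lambda>t. (exp (\<Gamma> t) * x $ 2 - z $ 2) / r) has_real_derivative exp (\<Gamma> t) * \<gamma> * x $ 2 / r) (at t)"
    using r by (auto intro!: derivative_eq_intros \<Gamma>)
  show ?thesis
    unfolding tracer_def
    by (rule DERIV_cong[OF DERIV_mult[OF DERIV_chain2[OF bump_DERIV 1] DERIV_chain2[OF bump_DERIV 2]]])
      (simp add: tracer_grad_def algebra_simps)
qed

lemma tracer_grad_bound:
  assumes C: "\<And>s. \<bar>bump' s\<bar> \<le> Cb" and r: "0 < r" and E: "exp g \<le> E" "exp (- g) \<le> E"
  shows "\<bar>tracer_grad z r g x v\<bar> \<le> 2 * Cb * E / r * norm v"
proof -
  have Cb: "0 \<le> Cb" using C[of 0] by linarith
  have E0: "0 \<le> E" using E(1) exp_ge_zero order_trans by blast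
  have v: "\<bar>v $ 1\<bar> \<le> norm v" "\<bar>v $ 2\<bar> \<le> norm v" by (rule component_le_norm_cart)+
  have e: "\<bar>exp (- g) * v $ 1 / r\<bar> \<le> E * norm v / r" "\<bar>exp g * v $ 2 / r\<bar> \<le> E * norm v / r"
  proof -
    have "exp (- g) * \<bar>v $ 1\<bar> \<le> E * norm v" "exp g * \<bar>v $ 2\<bar> \<le> E * norm v"
      by (rule mult_mono[OF E(2) v(1) E0 abs_ge_zero], rule mult_mono[OF E(1) v(2) E0 abs_ge_zero])
    then show "\<bar>exp (- g) * v $ 1 / r\<bar> \<le> E * norm v / r" "\<bar>exp g * v $ 2 / r\<bar> \<le> E * norm v / r"
      using r by (simp_all add: abs_mult divide_right_mono)
  qed
  have b: "\<bar>bump s\<bar> \<le> 1" for s using bump_nonneg[of s] bump_le_1[of s] by simp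
  have "\<bar>bump' s1 * (exp (- g) * v $ 1 / r) * bump s2\<bar> \<le> Cb * (E * norm v / r) * 1" for s1 s2
    unfolding abs_mult[of _ "bump s2"] abs_mult[of "bump' s1"] using C[of s1] e(1) r Cb E0 b[of s2]
    by (intro mult_mono mult_nonneg_nonneg) auto
  moreover have "\<bar>bump s1 * (bump' s2 * (exp g * v $ 2 / r))\<bar> \<le> 1 * (Cb * (E * norm v / r))" for s1 s2
    unfolding abs_mult[of "bump s1"] abs_mult[of "bump' s2"] using C[of s2] e(2) r Cb E0 b[of s1]
    by (intro mult_mono mult_nonneg_nonneg) auto
  ultimately have "\<bar>tracer_grad z r g x v\<bar> \<le> Cb * (E * norm v / r) * 1 + 1 * (Cb * (E * norm v / r))"
    unfolding tracer_grad_def by (intro order_trans[OF abs_triangle_ineq] add_mono) 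
  then show ?thesis by (simp add: algebra_simps)
qed

lemma tracer_grad_zero:
  assumes "\<not> (\<bar>exp (- g) * x $ 1 - z $ 1\<bar> \<le> r \<and> \<bar>exp g * x $ 2 - z $ 2\<bar> \<le> r)" and r: "0 < r"
  shows "tracer_grad z r g x v = 0" "tracer z r g x = 0"
proof -
  have "1 < \<bar>(exp (- g) * x $ 1 - z $ 1) / r\<bar> \<or> 1 < \<bar>(exp g * x $ 2 - z $ 2) / r\<bar>"
    using assms by (auto simp: abs_divide)
  then show "tracer_grad z r g x v = 0" "tracer z r g x = 0"
    using bump_zero bump'_zero by (auto simp: tracer_grad_def tracer_def)
qed

section \<open>From the weak formulation to approximate transport\<close>

lemma AE_lborel_fst:
  assumes "AE t in (lborel :: real measure). P t"
  shows "AE p in (lborel :: (real \<times> (real^2)) measure). P (fst p)"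
proof -
  obtain N where N: "{t. \<not> P t} \<subseteq> N" "N \<in> sets lborel" "emeasure lborel N = 0"
    using AE_E[OF assms] by auto
  show ?thesis
  proof (rule AE_I[where N="N \<times> UNIV"])
    show "{p \<in> space lborel. \<not> P (fst p)} \<subseteq> N \<times> UNIV" using N(1) by auto
    have "emeasure (lborel \<Otimes>\<^sub>M lborel :: (real \<times> (real^2)) measure) (N \<times> UNIV) = emeasure lborel N * emeasure lborel (UNIV :: (real^2) set)"
      using N(2) by (intro lborel.emeasure_pair_measure_Times) auto
    then show "emeasure lborel (N \<times> (UNIV :: (real^2) set)) = 0" using N(3) by (simp add: lborel_prod)
    have "N \<times> UNIV \<in> sets (lborel \<Otimes>\<^sub>M lborel :: (real \<times> (real^2)) measure)"
      using N(2) by (intro pair_measureI) auto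
    then show "N \<times> (UNIV :: (real^2) set) \<in> sets lborel" by (simp only: lborel_prod)
  qed
qed

lemma slab_sets: "{0..\<delta>} \<times> (UNIV :: (real^2) set) \<in> sets borel" for \<delta> :: real
  by (intro borel_closed closed_Times) auto

lemma AE_lebesgue_on_iff:
  assumes "S \<in> sets (borel :: 'a::euclidean_space measure)"
  shows "(AE p in lebesgue_on S. P p) \<longleftrightarrow> (AE p in lborel. p \<in> S \<longrightarrow> P p)"
  using assms by (simp add: AE_restrict_space_iff AE_completion_iff)

text \<open>A function that is measurable only with respect to the completed measure on space-time is
  replaced by a Borel one, whose slices and slice integrals are measurable.\<close>

lemma borel_representative:
  fixes \<theta> :: "real \<Rightarrow> real^2 \<Rightarrow> real"
  assumes meas: "(\<lambda>(t, x). \<theta> t x) \<in> borel_measurable (lebesgue_on ({0..\<delta>} \<times> UNIV))"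
    and bd: "AE t in lebesgue_on {0..\<delta>}. \<forall>x. \<bar>\<theta> t x\<bar> \<le> M" and M: "0 \<le> M"
  shows "\<exists>w :: real \<times> (real^2) \<Rightarrow> real. w \<in> borel_measurable borel \<and> (\<forall>p. \<bar>w p\<bar> \<le> M) \<and>
    (AE p in lborel. fst p \<in> {0..\<delta>} \<longrightarrow> \<theta> (fst p) (snd p) = w p) \<and>
    (AE t in lborel. t \<in> {0..\<delta>} \<longrightarrow> (AE x in lborel. \<theta> t x = w (t, x)))"
proof -
  let ?S = "{0..\<delta>} \<times> (UNIV :: (real^2) set)"
  define h where "h = (\<lambda>p. indicat_real ?S p *\<^sub>R \<theta> (fst p) (snd p))"
  have "(\<lambda>p. \<theta> (fst p) (snd p)) \<in> borel_measurable (lebesgue_on ?S)"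
    using meas by (simp add: case_prod_beta')
  then have "h \<in> borel_measurable lebesgue"
    unfolding h_def using slab_sets[of \<delta>] by (subst (asm) borel_measurable_restrict_space_iff) auto
  then obtain g where g[measurable]: "g \<in> borel_measurable lborel" and eq: "AE p in lborel. h p = g p"
    using completion_ex_borel_measurable_real by blast
  define w where "w = (\<lambda>p. max (- M) (min M (g p)))"
  have "g \<in> borel_measurable borel" using g by simp
  then have wm: "w \<in> borel_measurable borel" unfolding w_def by measurable
  have bd': "AE p in (lborel :: (real \<times> (real^2)) measure). fst p \<in> {0..\<delta>} \<longrightarrow> (\<forall>x. \<bar>\<theta> (fst p) x\<bar> \<le> M)"
  proof -
    have "AE t in lborel. t \<in> {0..\<delta>} \<longrightarrow> (\<forall>x. \<bar>\<theta> t x\<bar> \<le> M)"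
      using bd by (subst (asm) AE_lebesgue_on_iff) auto
    from AE_lborel_fst[OF this] show ?thesis .
  qed
  have e: "AE p in lborel. fst p \<in> {0..\<delta>} \<longrightarrow> \<theta> (fst p) (snd p) = w p"
    using eq bd'
  proof eventually_elim
    case (elim p)
    show ?case
    proof
      assume p: "fst p \<in> {0..\<delta>}"
      then have "\<theta> (fst p) (snd p) = g p" using elim(1) by (cases p) (simp add: h_def)
      moreover have "\<bar>\<theta> (fst p) (snd p)\<bar> \<le> M" using elim(2) p by blast
      ultimately show "\<theta> (fst p) (snd p) = w p" by (auto simp: w_def)
    qed
  qed
  then have "AE p in (lborel \<Otimes>\<^sub>M lborel). fst p \<in> {0..\<delta>} \<longrightarrow> \<theta> (fst p) (snd p) = w p"
    unfolding lborel_prod .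
  then have "AE t in lborel. AE x in lborel. t \<in> {0..\<delta>} \<longrightarrow> \<theta> t x = w (t, x)"
    using lborel_pair.AE_pair by fastforce
  then have "AE t in lborel. t \<in> {0..\<delta>} \<longrightarrow> (AE x in lborel. \<theta> t x = w (t, x))"
    by eventually_elim auto
  moreover have "\<forall>p. \<bar>w p\<bar> \<le> M" using M by (auto simp: w_def)
  ultimately show ?thesis using wm e by blast
qed

lemma slab_integral:
  fixes G :: "real \<times> (real^2) \<Rightarrow> real"
  assumes int: "integrable lborel G" and zero: "\<And>p. fst p \<notin> {0..\<delta>} \<Longrightarrow> G p = 0"
  shows "integrable (lebesgue_on ({0..\<delta>} \<times> UNIV)) G"
    and "(\<integral>p. G p \<partial>lebesgue_on ({0..\<delta>} \<times> UNIV)) = (\<integral>t. (\<integral>x. G (t, x) \<partial>lborel) \<partial>lborel)"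
proof -
  let ?S = "{0..\<delta>} \<times> (UNIV :: (real^2) set)"
  have G[measurable]: "G \<in> borel_measurable borel" using int by auto
  have S: "?S \<inter> space lebesgue \<in> sets lebesgue" using slab_sets[of \<delta>] by auto
  have ind: "(\<lambda>p. indicat_real ?S p *\<^sub>R G p) = G"
    using zero by (force simp: indicator_def fun_eq_iff)
  have "integrable lebesgue G" using int by (subst integrable_completion) auto
  then show "integrable (lebesgue_on ?S) G" by (subst integrable_restrict_space[OF S]) (simp only: ind)
  have "(\<integral>p. G p \<partial>lebesgue_on ?S) = (\<integral>p. G p \<partial>lebesgue)"
    by (subst integral_restrict_space[OF S]) (simp only: ind)
  also have "\<dots> = (\<integral>p. G p \<partial>lborel)" by (rule integral_completion) simp
  also have "\<dots> = (\<integral>p. G p \<partial>(lborel \<Otimes>\<^sub>M lborel))" by (simp add: lborel_prod)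
  also have "\<dots> = (\<integral>t. (\<integral>x. G (t, x) \<partial>lborel) \<partial>lborel)"
    by (rule lborel_pair.integral_fst'[symmetric]) (use int in \<open>simp add: lborel_prod\<close>)
  finally show "(\<integral>p. G p \<partial>lebesgue_on ?S) = (\<integral>t. (\<integral>x. G (t, x) \<partial>lborel) \<partial>lborel)" .
qed

lemma strain_bounded:
  assumes \<alpha>: "0 < \<alpha>" and \<rho>: "0 < \<rho>"
  shows "\<exists>B\<ge>0. \<forall>f M. f \<in> borel_measurable borel \<longrightarrow> (\<forall>y. \<bar>f y\<bar> \<le> M) \<longrightarrow> \<bar>strain \<alpha> \<rho> f\<bar> \<le> B * M"
proof -
  let ?g = "\<lambda>y::real^2. indicat_real {y. \<rho> < norm y} y * norm y powr (-(2+\<alpha>))"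
  have int: "integrable lborel ?g" using tail_power_bound[of "2 + \<alpha>"] \<alpha> \<rho> by auto
  define B where "B = (2 + \<alpha>) * (\<integral>y. ?g y \<partial>lborel)"
  have "\<bar>strain \<alpha> \<rho> f\<bar> \<le> B * M" if [measurable]: "f \<in> borel_measurable borel" and f: "\<And>y. \<bar>f y\<bar> \<le> M" for f M
  proof -
    let ?h = "\<lambda>y::real^2. indicat_real {y. \<rho> < norm y} y * (f y * (y $ 1 * y $ 2) * norm y powr (-4-\<alpha>))"
    have le: "\<bar>?h y\<bar> \<le> M * ?g y" for y
      using strain_integrand_bound[of f y M \<alpha>] f[of y] by (auto simp: indicator_def)
    have "integrable lborel ?h"
      by (rule Bochner_Integration.integrable_bound[OF integrable_mult_right[OF int, of M]])
        (use le in \<open>auto intro!: AE_I2 intro: order_trans[OF _ abs_ge_self]\<close>)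
    then have "\<bar>\<integral>y. ?h y \<partial>lborel\<bar> \<le> (\<integral>y. M * ?g y \<partial>lborel)"
      by (intro order_trans[OF integral_abs_bound] integral_mono integrable_abs integrable_mult_right[OF int] le)
    then have "\<bar>\<integral>y. ?h y \<partial>lborel\<bar> \<le> (\<integral>y. ?g y \<partial>lborel) * M" by (simp add: mult.commute)
    then have "(2 + \<alpha>) * \<bar>\<integral>y. ?h y \<partial>lborel\<bar> \<le> (2 + \<alpha>) * ((\<integral>y. ?g y \<partial>lborel) * M)"
      using \<alpha> by (intro mult_left_mono) auto
    then show ?thesis using \<alpha> by (simp add: strain_def B_def abs_mult mult.assoc)
  qed
  moreover have "0 \<le> B" using \<alpha> by (auto simp: B_def intro!: mult_nonneg_nonneg integral_nonneg)
  ultimately show ?thesis by blast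
qed

definition velocity_const :: "real \<Rightarrow> real" where
  "velocity_const \<alpha> = (SOME C. C > 0 \<and> (\<forall>f M v \<rho> x. odd_odd f \<longrightarrow> holder_bound \<alpha> M f \<longrightarrow> has_velocity \<alpha> f v \<longrightarrow>
     0 < \<rho> \<longrightarrow> norm x \<le> \<rho> / 2 \<longrightarrow> norm (v x - strain \<alpha> \<rho> f *\<^sub>R vector [x $ 1, - x $ 2]) \<le> C * M * \<rho>))"

lemma velocity_const:
  assumes "0 < \<alpha>" "\<alpha> < 1"
  shows "0 < velocity_const \<alpha>"
    and "odd_odd f \<Longrightarrow> holder_bound \<alpha> M f \<Longrightarrow> has_velocity \<alpha> f v \<Longrightarrow> 0 < \<rho> \<Longrightarrow> norm x \<le> \<rho> / 2 \<Longrightarrow>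
      norm (v x - strain \<alpha> \<rho> f *\<^sub>R vector [x $ 1, - x $ 2]) \<le> velocity_const \<alpha> * M * \<rho>"
  using someI_ex[OF velocity_estimate[OF assms]] unfolding velocity_const_def[symmetric] by blast+

definition bump_slope :: real where
  "bump_slope = (SOME C. C \<ge> 1 \<and> (\<forall>s. \<bar>bump' s\<bar> \<le> C))"

lemma bump_slope: "1 \<le> bump_slope" "\<bar>bump' s\<bar> \<le> bump_slope"
proof -
  have "\<exists>C\<ge>1. \<forall>s. \<bar>bump' s\<bar> \<le> C" using bump'_bounded by metis
  from someI_ex[OF this] show "1 \<le> bump_slope" "\<bar>bump' s\<bar> \<le> bump_slope"
    unfolding bump_slope_def[symmetric] by blast+
qed

text \<open>A solution with Hoelder norm at most \<open>M\<close>, together with a Borel function \<open>w\<close> on space-time that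
  agrees with it almost everywhere.\<close>

locale holder_solution =
  fixes \<alpha> \<delta> M :: real and \<theta>0 :: "real^2 \<Rightarrow> real" and \<theta> :: "real \<Rightarrow> real^2 \<Rightarrow> real"
    and u :: "real \<Rightarrow> real^2 \<Rightarrow> real^2" and w :: "real \<times> (real^2) \<Rightarrow> real"
  assumes \<alpha>: "0 < \<alpha>" "\<alpha> < 1" and \<delta>: "0 < \<delta>" and M: "0 \<le> M"
    and init: "holder_bound \<alpha> M \<theta>0"
    and w_borel [measurable]: "w \<in> borel_measurable borel" and w_bound: "\<And>p. \<bar>w p\<bar> \<le> M"
    and w_eq: "AE p in lborel. fst p \<in> {0..\<delta>} \<longrightarrow> \<theta> (fst p) (snd p) = w p"
    and slices: "AE t in lborel. t \<in> {0..\<delta>} \<longrightarrow> odd_odd (\<theta> t) \<and> holder_bound \<alpha> M (\<theta> t) \<and>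
      has_velocity \<alpha> (\<theta> t) (u t) \<and> (AE x in lborel. \<theta> t x = w (t, x))"
    and weak: "\<And>\<phi>. \<phi> \<in> test_functions \<delta> \<Longrightarrow>
      has_bochner_integral (lebesgue_on ({0..\<delta>} \<times> UNIV))
        (\<lambda>(t, x). \<theta> t x * (deriv (\<lambda>s. \<phi> (s, x)) t + frechet_derivative (\<lambda>y. \<phi> (t, y)) (at x) (u t x)))
        (- (LINT x | lebesgue. \<theta>0 x * \<phi> (0, x)))"
begin

definition L :: "real \<Rightarrow> real \<Rightarrow> real" where
  "L \<rho> t = strain \<alpha> \<rho> (\<lambda>x. w (t, x))"

lemma w_slice_borel [measurable]: "(\<lambda>x. w (t, x)) \<in> borel_measurable borel"
  by measurable

lemma L_borel [measurable]: "L \<rho> \<in> borel_measurable borel"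
  unfolding L_def strain_def by measurable

lemma L_bounded:
  assumes "0 < \<rho>" shows "\<exists>B\<ge>0. \<forall>t. \<bar>L \<rho> t\<bar> \<le> B"
proof -
  obtain B where B: "0 \<le> B"
    "\<forall>f M. f \<in> borel_measurable borel \<longrightarrow> (\<forall>y. \<bar>f y\<bar> \<le> M) \<longrightarrow> \<bar>strain \<alpha> \<rho> f\<bar> \<le> B * M"
    using strain_bounded[OF \<alpha>(1) assms] by blast
  have "\<bar>L \<rho> t\<bar> \<le> B * M" for t
    unfolding L_def using w_bound B(2)[rule_format, OF w_slice_borel[of t], of M] by blast
  then show ?thesis using B(1) M by (intro exI[of _ "B * M"]) simp
qed

lemma \<theta>_slice_borel: "holder_bound \<alpha> M f \<Longrightarrow> f \<in> borel_measurable borel"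
  by (intro borel_measurable_continuous_onI holder_bound_continuous[OF _ \<alpha>(1)])

lemma slices_L:
  "AE t in lborel. t \<in> {0..\<delta>} \<longrightarrow> (\<forall>\<rho>. strain \<alpha> \<rho> (\<theta> t) = L \<rho> t)"
  using slices
proof eventually_elim
  case (elim t)
  show ?case
  proof (intro impI allI)
    fix \<rho> assume "t \<in> {0..\<delta>}"
    then have h: "holder_bound \<alpha> M (\<theta> t)" and eq: "AE x in lborel. \<theta> t x = w (t, x)" using elim by auto
    note [measurable] = \<theta>_slice_borel[OF h]
    show "strain \<alpha> \<rho> (\<theta> t) = L \<rho> t"
      unfolding strain_def L_def
      by (intro arg_cong2[where f="(*)"] refl integral_cong_AE) (use eq in auto)
  qed
qed

text \<open>The weak formulation tested with \<open>\<eta>(t)\<close> times the moving tracer, where \<open>\<eta>' = - \<psi>\<close>. On the support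
  of the tracer the velocity differs from the field \<open>\<gamma> t (x\<^sub>1, -x\<^sub>2)\<close> that carries it by at most
  \<open>\<bar>L \<rho> t - \<gamma> t\<bar> \<rho>/2 + O(M \<rho>)\<close>; what remains after the cancellation is the average of the
  masses seen by the tracer, weighted by \<open>\<psi>\<close>, compared with the mass seen initially.\<close>

lemma weak_tracer:
  assumes \<rho>: "0 < \<rho>" and T: "0 < T" "T < \<delta>" and r: "0 < r"
    and \<Gamma>: "smooth \<Gamma>" "\<And>t. (\<Gamma> has_real_derivative \<gamma> t) (at t)" "\<Gamma> 0 = 0" and \<gamma>: "continuous_on UNIV \<gamma>"
    and E: "\<And>t. t \<in> {0..T} \<Longrightarrow> exp (\<Gamma> t) \<le> E" "\<And>t. t \<in> {0..T} \<Longrightarrow> exp (- \<Gamma> t) \<le> E"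
    and supp: "\<And>t (x :: real^2). t \<in> {0..T} \<Longrightarrow> \<bar>exp (- \<Gamma> t) * x $ 1 - z $ 1\<bar> \<le> r \<Longrightarrow> \<bar>exp (\<Gamma> t) * x $ 2 - z $ 2\<bar> \<le> r
      \<Longrightarrow> norm x \<le> \<rho> / 2"
    and \<psi>: "smooth \<psi>" "\<And>t. 0 \<le> \<psi> t" "\<And>t. \<psi> t \<le> 1" "\<And>t. t \<notin> {0<..<T} \<Longrightarrow> \<psi> t = 0"
  shows "\<bar>(\<integral>t. \<psi> t * (\<integral>x. w (t, x) * tracer z r (\<Gamma> t) x \<partial>lborel) \<partial>lborel)
      - (\<integral>t. \<psi> t \<partial>lborel) * (\<integral>x. \<theta>0 x * tracer z r 0 x \<partial>lborel)\<bar>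
    \<le> (\<integral>t. \<psi> t \<partial>lborel) * (M * \<rho> powr \<alpha> * \<rho>\<^sup>2 * (2 * bump_slope * E / r)
        * (\<rho> / 2 * (LINT t : {0..T} | lborel. \<bar>L \<rho> t - \<gamma> t\<bar>) + velocity_const \<alpha> * M * \<rho> * T))"
proof -
  define A where "A = (\<integral>t. \<psi> t \<partial>lborel)"
  obtain F where F: "smooth F" "\<And>t. (F has_real_derivative \<psi> t) (at t)" "\<And>t. t \<le> 0 \<Longrightarrow> F t = 0"
    "\<And>t. T \<le> t \<Longrightarrow> F t = A" "\<And>t. 0 \<le> F t" "\<And>t. F t \<le> A"
    using smooth_primitive[of \<psi> 0 T] \<psi> T unfolding A_def by (metis less_imp_le)
  have A0: "0 \<le> A" using F(5,6)[of 0] by linarith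
  \<comment> \<open>The time factor \<open>\<eta>\<close> has derivative \<open>- \<psi>\<close> on \<open>t \<ge> 0\<close>; the bump \<open>\<beta>\<close> on negative times brings it back to zero, so that it has compact support.\<close>
  define \<beta> where "\<beta> = (\<lambda>t::real. bump (2 * t + 3))"
  have \<beta>: "smooth \<beta>" "\<And>t. 0 \<le> \<beta> t" "\<And>t. t \<notin> {-2<..<-1} \<Longrightarrow> \<beta> t = 0"
    unfolding \<beta>_def
    by (intro smooth_compose[OF smooth_bump] smooth_add smooth_mult smooth_const smooth_ident)
      (auto simp: bump_nonneg intro!: bump_zero)
  define c where "c = (\<integral>t. \<beta> t \<partial>lborel)"
  obtain F\<beta> where F\<beta>: "smooth F\<beta>" "\<And>t. (F\<beta> has_real_derivative \<beta> t) (at t)" "\<And>t. t \<le> -2 \<Longrightarrow> F\<beta> t = 0"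
    "\<And>t. -1 \<le> t \<Longrightarrow> F\<beta> t = c" "\<And>t. 0 \<le> F\<beta> t" "\<And>t. F\<beta> t \<le> c"
    using smooth_primitive[of \<beta> "-2" "-1"] \<beta> unfolding c_def by (metis neg_le_iff_le one_le_numeral)
  have "c \<noteq> 0"
  proof
    assume "c = 0"
    then have "F\<beta> = (\<lambda>_. 0)" using F\<beta>(5,6) by (auto intro!: ext order_antisym)
    then have "\<beta> (-3/2) = 0" using F\<beta>(2)[of "-3/2"] DERIV_unique DERIV_const by metis
    then show False using bump_pos[of 0] by (simp add: \<beta>_def)
  qed
  define \<eta> where "\<eta> = (\<lambda>t. A / c * F\<beta> t - F t)"
  have \<eta>_smooth: "smooth \<eta>" unfolding \<eta>_def by (intro smooth_diff smooth_mult smooth_const F\<beta> F)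
  have \<eta>_zero: "\<eta> t = 0" if "t \<notin> {-2..T}" for t
    using that F(3,4)[of t] F\<beta>(3,4)[of t] T \<open>c \<noteq> 0\<close> by (auto simp: \<eta>_def)
  have \<eta>_pos: "\<eta> t = A - F t" if "0 \<le> t" for t
    using that F\<beta>(4)[of t] \<open>c \<noteq> 0\<close> by (simp add: \<eta>_def)
  have \<eta>_bound: "\<bar>\<eta> t\<bar> \<le> A" if "0 \<le> t" for t
    using \<eta>_pos[OF that] F(5,6)[of t] by auto
  have \<eta>_deriv: "(\<eta> has_real_derivative - \<psi> t) (at t)" if "0 \<le> t" for t
  proof -
    have "(\<eta> has_real_derivative A / c * \<beta> t - \<psi> t) (at t)"
      unfolding \<eta>_def by (intro DERIV_diff DERIV_cmult F\<beta> F)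
    then show ?thesis using \<beta>(3)[of t] that by simp
  qed
  define \<phi> where "\<phi> = (\<lambda>(t, x). \<eta> t * tracer z r (\<Gamma> t) x)"
  have test: "\<phi> \<in> test_functions \<delta>"
    unfolding \<phi>_def by (rule tracer_test_function[OF \<Gamma>(1) \<eta>_smooth \<eta>_zero T(2) r])
  define s where "s = (\<lambda>x::real^2. vector [x $ 1, - x $ 2] :: real^2)"
  have norm_s: "norm (s x) = norm x" for x
  proof -
    have "(norm (s x))\<^sup>2 = (norm x)\<^sup>2" by (simp add: s_def norm_real2)
    then show ?thesis by simp
  qed
  let ?S = "{0..\<delta>} \<times> (UNIV :: (real^2) set)"
  define f1 where "f1 = (\<lambda>p. \<theta> (fst p) (snd p) * (deriv (\<lambda>s. \<phi> (s, snd p)) (fst p)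
      + frechet_derivative (\<lambda>y. \<phi> (fst p, y)) (at (snd p)) (u (fst p) (snd p))))"
  define f2 where "f2 = (\<lambda>p. - (\<psi> (fst p) * (w p * tracer z r (\<Gamma> (fst p)) (snd p))))"
  define K where "K = A * (M * \<rho> powr \<alpha>) * (2 * bump_slope * E / r)"
  have E0: "0 \<le> E" using E(1)[of 0] T exp_ge_zero order_trans by (metis atLeastAtMost_iff less_imp_le order_refl)
  have K0: "0 \<le> K" unfolding K_def using A0 M E0 r bump_slope(1) by simp
  define f3 where "f3 = (\<lambda>p. indicat_real {0..T} (fst p) * (\<bar>L \<rho> (fst p) - \<gamma> (fst p)\<bar> * (\<rho> / 2) + velocity_const \<alpha> * M * \<rho>)
      * (K * indicat_real (cball (0 :: real^2) (\<rho> / 2)) (snd p)))"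
  have vc: "0 < velocity_const \<alpha>" by (rule velocity_const(1)[OF \<alpha>])
  have f3_nonneg: "0 \<le> f3 p" for p unfolding f3_def using vc K0 M \<rho> by simp
  have [measurable]: "\<gamma> \<in> borel_measurable borel" "\<psi> \<in> borel_measurable borel" "\<Gamma> \<in> borel_measurable borel"
    by (intro borel_measurable_continuous_onI \<gamma> smooth_continuous_on \<psi> \<Gamma>)+
  have [measurable]: "(\<lambda>p. tracer z r (\<Gamma> (fst p)) (snd p)) \<in> borel_measurable (borel :: (real \<times> (real^2)) measure)"
  proof -
    have "continuous_on UNIV (\<lambda>p::real \<times> (real^2). (\<Gamma> (fst p), snd p))"
      by (intro continuous_intros continuous_on_compose2[OF smooth_continuous_on[OF \<Gamma>(1), of UNIV]]) auto
    then have "(\<lambda>p::real \<times> (real^2). (\<Gamma> (fst p), snd p)) \<in> borel \<rightarrow>\<^sub>M borel"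
      by (rule borel_measurable_continuous_onI)
    from measurable_compose[OF this tracer_borel] show ?thesis by simp
  qed
  have [measurable]: "fst \<in> borel_measurable (borel :: (real \<times> (real^2)) measure)"
    "snd \<in> borel_measurable (borel :: (real \<times> (real^2)) measure)"
    by (intro borel_measurable_continuous_onI continuous_intros)+
  have f2_borel: "f2 \<in> borel_measurable borel" unfolding f2_def by measurable
  have f3_borel: "f3 \<in> borel_measurable borel" unfolding f3_def by measurable
  have linear_grad: "linear (tracer_grad z r g x)" for g x
    using tracer_has_derivative[OF r] has_derivative_linear by blast

  \<comment> \<open>\<open>f1\<close> is the integrand of the weak formulation, \<open>f2\<close> what is left of it for exact transport, \<open>f3\<close> the error bound\<close>
  have key: "AE p in lebesgue_on ?S. \<bar>f1 p - f2 p\<bar> \<le> f3 p"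
    unfolding AE_lebesgue_on_iff[OF slab_sets]
    using w_eq AE_lborel_fst[OF slices] AE_lborel_fst[OF slices_L]
  proof eventually_elim
    case (elim p)
    obtain t x where p: "p = (t, x)" by (cases p)
    show ?case
    proof
      assume "p \<in> ?S"
      then have t: "t \<in> {0..\<delta>}" using p by simp
      then have t0: "0 \<le> t" by simp
      have \<theta>w: "\<theta> t x = w (t, x)" and odd: "odd_odd (\<theta> t)" and hold: "holder_bound \<alpha> M (\<theta> t)"
        and vel: "has_velocity \<alpha> (\<theta> t) (u t)" and L: "strain \<alpha> \<rho> (\<theta> t) = L \<rho> t"
        using elim t p by auto
      have "((\<lambda>s. \<eta> s * tracer z r (\<Gamma> s) x) has_real_derivative
          \<eta> t * (- \<gamma> t * tracer_grad z r (\<Gamma> t) x (s x)) + - \<psi> t * tracer z r (\<Gamma> t) x) (at t)"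
        unfolding s_def by (rule DERIV_mult'[OF \<eta>_deriv[OF t0] tracer_time_derivative[OF \<Gamma>(2) r]])
      then have d1: "deriv (\<lambda>s. \<phi> (s, x)) t = \<eta> t * (- \<gamma> t * tracer_grad z r (\<Gamma> t) x (s x)) - \<psi> t * tracer z r (\<Gamma> t) x"
        by (simp add: \<phi>_def DERIV_imp_deriv)
      have "((\<lambda>y. \<eta> t * tracer z r (\<Gamma> t) y) has_derivative (\<lambda>v. \<eta> t * tracer_grad z r (\<Gamma> t) x v)) (at x)"
        by (intro has_derivative_mult_right tracer_has_derivative[OF r])
      note fd = frechet_derivative_at[OF this, symmetric]
      have d2: "frechet_derivative (\<lambda>y. \<phi> (t, y)) (at x) v = \<eta> t * tracer_grad z r (\<Gamma> t) x v" for v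
        using fun_cong[OF fd, of v] by (simp add: \<phi>_def)
      have lin: "tracer_grad z r (\<Gamma> t) x (u t x - \<gamma> t *\<^sub>R s x)
          = tracer_grad z r (\<Gamma> t) x (u t x) - \<gamma> t * tracer_grad z r (\<Gamma> t) x (s x)"
        using linear_grad[of "\<Gamma> t" x] by (simp add: linear_diff linear_cmul)
      have diff: "f1 p - f2 p = \<theta> t x * \<eta> t * tracer_grad z r (\<Gamma> t) x (u t x - \<gamma> t *\<^sub>R s x)"
        unfolding f1_def f2_def p lin by (simp add: d1 d2 \<theta>w algebra_simps)
      show "\<bar>f1 p - f2 p\<bar> \<le> f3 p"
      proof (cases "t \<in> {0..T} \<and> \<bar>exp (- \<Gamma> t) * x $ 1 - z $ 1\<bar> \<le> r \<and> \<bar>exp (\<Gamma> t) * x $ 2 - z $ 2\<bar> \<le> r")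
        case False
        then have "\<eta> t = 0 \<or> tracer_grad z r (\<Gamma> t) x (u t x - \<gamma> t *\<^sub>R s x) = 0"
          using \<eta>_zero[of t] t0 tracer_grad_zero(1)[OF _ r] by auto
        then show ?thesis using diff f3_nonneg[of p] by auto
      next
        case True
        then have tT: "t \<in> {0..T}" and x: "norm x \<le> \<rho> / 2" using supp[of t x] by auto
        have "\<bar>\<theta> t x\<bar> \<le> M * norm x powr \<alpha>"
          using holder_boundD(2)[OF hold, of x 0] odd_oddD(3)[OF odd] by simp
        also have "\<dots> \<le> M * \<rho> powr \<alpha>"
          using x \<rho> M \<alpha> by (intro mult_left_mono powr_mono2) auto
        finally have b1: "\<bar>\<theta> t x\<bar> \<le> M * \<rho> powr \<alpha>" .
        have "u t x - \<gamma> t *\<^sub>R s x = (u t x - strain \<alpha> \<rho> (\<theta> t) *\<^sub>R s x) + (L \<rho> t - \<gamma> t) *\<^sub>R s x"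
          by (simp add: L algebra_simps)
        also have "norm \<dots> \<le> velocity_const \<alpha> * M * \<rho> + \<bar>L \<rho> t - \<gamma> t\<bar> * norm x"
        proof -
          have "norm (u t x - strain \<alpha> \<rho> (\<theta> t) *\<^sub>R s x) \<le> velocity_const \<alpha> * M * \<rho>"
            unfolding s_def by (rule velocity_const(2)[OF \<alpha> odd hold vel \<rho> x])
          then show ?thesis by (intro order_trans[OF norm_triangle_ineq] add_mono) (simp_all add: norm_s)
        qed
        also have "\<dots> \<le> \<bar>L \<rho> t - \<gamma> t\<bar> * (\<rho> / 2) + velocity_const \<alpha> * M * \<rho>"
          using mult_left_mono[OF x abs_ge_zero[of "L \<rho> t - \<gamma> t"]] by linarith
        finally have b2: "norm (u t x - \<gamma> t *\<^sub>R s x) \<le> \<bar>L \<rho> t - \<gamma> t\<bar> * (\<rho> / 2) + velocity_const \<alpha> * M * \<rho>" .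
        have "\<bar>tracer_grad z r (\<Gamma> t) x (u t x - \<gamma> t *\<^sub>R s x)\<bar>
            \<le> 2 * bump_slope * E / r * norm (u t x - \<gamma> t *\<^sub>R s x)"
          by (rule tracer_grad_bound[OF bump_slope(2) r E[OF tT]])
        also have "\<dots> \<le> 2 * bump_slope * E / r * (\<bar>L \<rho> t - \<gamma> t\<bar> * (\<rho> / 2) + velocity_const \<alpha> * M * \<rho>)"
          using bump_slope(1) E0 r by (intro mult_left_mono b2) auto
        finally have b3: "\<bar>tracer_grad z r (\<Gamma> t) x (u t x - \<gamma> t *\<^sub>R s x)\<bar>
            \<le> 2 * bump_slope * E / r * (\<bar>L \<rho> t - \<gamma> t\<bar> * (\<rho> / 2) + velocity_const \<alpha> * M * \<rho>)" .
        have "\<bar>f1 p - f2 p\<bar> = \<bar>\<theta> t x\<bar> * \<bar>\<eta> t\<bar> * \<bar>tracer_grad z r (\<Gamma> t) x (u t x - \<gamma> t *\<^sub>R s x)\<bar>"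
          unfolding diff by (simp add: abs_mult)
        also have "\<dots> \<le> (M * \<rho> powr \<alpha>) * A * (2 * bump_slope * E / r * (\<bar>L \<rho> t - \<gamma> t\<bar> * (\<rho> / 2) + velocity_const \<alpha> * M * \<rho>))"
          using b1 b3 \<eta>_bound[OF t0] M A0 by (intro mult_mono mult_nonneg_nonneg) auto
        also have "\<dots> = f3 p"
          using tT x by (simp add: f3_def p K_def mult_ac)
        finally show ?thesis .
      qed
    qed
  qed

  define Q where "Q = {0..T} \<times> cball (0 :: real^2) (\<rho> / 2)"
  have [measurable]: "Q \<in> sets borel" unfolding Q_def by (intro borel_closed closed_Times) auto
  have intQ: "integrable lborel (indicat_real Q)"
    unfolding Q_def by (intro integrable_real_indicator emeasure_bounded_finite bounded_Times) (auto intro!: borel_closed closed_Times)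
  have f2_int: "integrable lborel f2"
  proof (rule Bochner_Integration.integrable_bound[OF integrable_mult_right[OF intQ, of M]])
    show "f2 \<in> borel_measurable lborel" using f2_borel by simp
    show "AE p in lborel. norm (f2 p) \<le> norm (M * indicat_real Q p)"
    proof (intro AE_I2)
      fix p :: "real \<times> (real^2)"
      obtain t x where p: "p = (t, x)" by (cases p)
      show "norm (f2 p) \<le> norm (M * indicat_real Q p)"
      proof (cases "p \<in> Q")
        case True
        have "\<psi> t * (\<bar>w p\<bar> * tracer z r (\<Gamma> t) x) \<le> 1 * (M * 1)"
          using \<psi> w_bound[of p] tracer_bounds[of z r "\<Gamma> t" x] M by (intro mult_mono mult_nonneg_nonneg) auto
        then show ?thesis using True \<psi>(2)[of t] tracer_bounds(1)[of z r "\<Gamma> t" x] M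
          by (simp add: f2_def p abs_mult)
      next
        case False
        have "\<psi> t = 0 \<or> tracer z r (\<Gamma> t) x = 0"
        proof (cases "t \<in> {0..T}")
          case True
          then have "\<not> norm x \<le> \<rho> / 2" using False p by (auto simp: Q_def)
          then show ?thesis using supp[OF True, of x] tracer_grad_zero(2)[OF _ r] by blast
        qed (use \<psi>(4)[of t] in auto)
        then show ?thesis by (auto simp: f2_def p)
      qed
    qed
  qed
  have f2_zero: "f2 p = 0" if "fst p \<notin> {0..\<delta>}" for p
    using \<psi>(4)[of "fst p"] that T by (auto simp: f2_def)
  obtain B where B: "0 \<le> B" "\<And>t. \<bar>L \<rho> t\<bar> \<le> B" using L_bounded[OF \<rho>] by blast
  have "compact (\<gamma> ` {0..T})" by (intro compact_continuous_image continuous_on_subset[OF \<gamma>]) auto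
  then have "bounded (\<gamma> ` {0..T})" by (rule compact_imp_bounded)
  then obtain B' where B': "\<forall>y\<in>\<gamma> ` {0..T}. norm y \<le> B'" unfolding bounded_iff by blast
  define B2 where "B2 = ((B + B') * (\<rho> / 2) + velocity_const \<alpha> * M * \<rho>) * K"
  have f3_int: "integrable lborel f3"
  proof (rule Bochner_Integration.integrable_bound[OF integrable_mult_right[OF intQ, of B2]])
    show "f3 \<in> borel_measurable lborel" using f3_borel by simp
    show "AE p in lborel. norm (f3 p) \<le> norm (B2 * indicat_real Q p)"
    proof (intro AE_I2)
      fix p :: "real \<times> (real^2)"
      obtain t x where p: "p = (t, x)" by (cases p)
      show "norm (f3 p) \<le> norm (B2 * indicat_real Q p)"
      proof (cases "p \<in> Q")
        case True
        then have tx: "t \<in> {0..T}" "x \<in> cball 0 (\<rho> / 2)" using p by (auto simp: Q_def)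
        have "\<bar>\<gamma> t\<bar> \<le> B'" using B' tx by auto
        then have "\<bar>L \<rho> t - \<gamma> t\<bar> \<le> B + B'" using B(2)[of t] by linarith
        then have "(\<bar>L \<rho> t - \<gamma> t\<bar> * (\<rho> / 2) + velocity_const \<alpha> * M * \<rho>) * K \<le> B2"
          unfolding B2_def using \<rho> K0 by (intro mult_right_mono add_right_mono) auto
        then have "f3 p \<le> B2" using tx by (simp add: f3_def p)
        then show ?thesis using True f3_nonneg[of p] by simp
      next
        case False
        then have "f3 p = 0" using p by (auto simp: f3_def Q_def)
        then show ?thesis by simp
      qed
    qed
  qed
  have f3_zero: "f3 p = 0" if "fst p \<notin> {0..\<delta>}" for p
    using that T by (auto simp: f3_def)

  have weak1: "has_bochner_integral (lebesgue_on ?S) f1 (- (LINT x | lebesgue. \<theta>0 x * \<phi> (0, x)))"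
    using weak[OF test] by (simp add: f1_def case_prod_beta')
  have f1_int: "integrable (lebesgue_on ?S) f1"
    and f1_val: "(\<integral>p. f1 p \<partial>lebesgue_on ?S) = - (LINT x | lebesgue. \<theta>0 x * \<phi> (0, x))"
    using weak1 by (auto simp: has_bochner_integral_iff)
  note f2_slab = slab_integral[OF f2_int f2_zero]
  note f3_slab = slab_integral[OF f3_int f3_zero]
  have "\<bar>(\<integral>p. f1 p \<partial>lebesgue_on ?S) - (\<integral>p. f2 p \<partial>lebesgue_on ?S)\<bar> = \<bar>\<integral>p. f1 p - f2 p \<partial>lebesgue_on ?S\<bar>"
    using f1_int f2_slab(1) by simp
  also have "\<dots> \<le> (\<integral>p. \<bar>f1 p - f2 p\<bar> \<partial>lebesgue_on ?S)" by (rule integral_abs_bound)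
  also have "\<dots> \<le> (\<integral>p. f3 p \<partial>lebesgue_on ?S)"
    using f1_int f2_slab(1) f3_slab(1) key by (intro integral_mono_AE) auto
  finally have main: "\<bar>(\<integral>p. f1 p \<partial>lebesgue_on ?S) - (\<integral>p. f2 p \<partial>lebesgue_on ?S)\<bar> \<le> (\<integral>p. f3 p \<partial>lebesgue_on ?S)" .

  have v1: "(LINT x | lebesgue. \<theta>0 x * \<phi> (0, x)) = A * (\<integral>x. \<theta>0 x * tracer z r 0 x \<partial>lborel)"
  proof -
    note [measurable] = \<theta>_slice_borel[OF init]
    have [measurable]: "tracer z r 0 \<in> borel_measurable borel" using tracer_integral(1)[OF r] by auto
    have "\<eta> 0 = A" using \<eta>_pos[of 0] F(3)[of 0] by simp
    then have "(LINT x | lebesgue. \<theta>0 x * \<phi> (0, x)) = (LINT x | lebesgue. A * (\<theta>0 x * tracer z r 0 x))"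
      by (simp add: \<phi>_def \<Gamma>(3) mult_ac)
    also have "\<dots> = (\<integral>x. A * (\<theta>0 x * tracer z r 0 x) \<partial>lborel)" by (rule integral_completion) measurable
    finally show ?thesis by simp
  qed
  have v2: "(\<integral>p. f2 p \<partial>lebesgue_on ?S) = - (\<integral>t. \<psi> t * (\<integral>x. w (t, x) * tracer z r (\<Gamma> t) x \<partial>lborel) \<partial>lborel)"
  proof -
    have "(\<integral>p. f2 p \<partial>lebesgue_on ?S) = (\<integral>t. (\<integral>x. f2 (t, x) \<partial>lborel) \<partial>lborel)" by (rule f2_slab(2))
    also have "\<dots> = - (\<integral>t. \<psi> t * (\<integral>x. w (t, x) * tracer z r (\<Gamma> t) x \<partial>lborel) \<partial>lborel)"
      by (simp add: f2_def)
    finally show ?thesis .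
  qed
  have v3: "(\<integral>p. f3 p \<partial>lebesgue_on ?S) \<le> A * (M * \<rho> powr \<alpha> * \<rho>\<^sup>2 * (2 * bump_slope * E / r)
        * (\<rho> / 2 * (LINT t : {0..T} | lborel. \<bar>L \<rho> t - \<gamma> t\<bar>) + velocity_const \<alpha> * M * \<rho> * T))"
  proof -
    let ?I = "LINT t : {0..T} | lborel. \<bar>L \<rho> t - \<gamma> t\<bar>"
    have area: "(\<integral>x. K * indicat_real (cball (0 :: real^2) (\<rho> / 2)) x \<partial>lborel) = K * (pi * (\<rho> / 2)\<^sup>2)"
      using \<rho> by (simp add: content_cball unit_ball_vol_2)
    have intI: "integrable lborel (\<lambda>t. indicat_real {0..T} t * \<bar>L \<rho> t - \<gamma> t\<bar>)"
    proof (rule Bochner_Integration.integrable_bound[of _ "\<lambda>t. (B + B') * indicat_real {0..T} t"])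
      show "AE t in lborel. norm (indicat_real {0..T} t * \<bar>L \<rho> t - \<gamma> t\<bar>) \<le> norm ((B + B') * indicat_real {0..T} t)"
      proof (intro AE_I2)
        fix t
        show "norm (indicat_real {0..T} t * \<bar>L \<rho> t - \<gamma> t\<bar>) \<le> norm ((B + B') * indicat_real {0..T} t)"
        proof (cases "t \<in> {0..T}")
          case True
          then have "\<bar>\<gamma> t\<bar> \<le> B'" using B' by auto
          then show ?thesis using True B(2)[of t] by simp
        qed simp
      qed
    qed (simp, measurable)
    have "(\<integral>p. f3 p \<partial>lebesgue_on ?S) = (\<integral>t. (\<integral>x. f3 (t, x) \<partial>lborel) \<partial>lborel)" by (rule f3_slab(2))
    also have "\<dots> = (\<integral>t. indicat_real {0..T} t * (\<bar>L \<rho> t - \<gamma> t\<bar> * (\<rho> / 2) + velocity_const \<alpha> * M * \<rho>)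
        * (K * (pi * (\<rho> / 2)\<^sup>2)) \<partial>lborel)"
      unfolding f3_def fst_conv snd_conv using area by simp
    also have "\<dots> = (\<integral>t. (\<rho> / 2) * (indicat_real {0..T} t * \<bar>L \<rho> t - \<gamma> t\<bar>)
        + (velocity_const \<alpha> * M * \<rho>) * indicat_real {0..T} t \<partial>lborel) * (K * (pi * (\<rho> / 2)\<^sup>2))"
      by (subst integral_mult_left_zero[symmetric]) (simp add: algebra_simps)
    also have "(\<integral>t. (\<rho> / 2) * (indicat_real {0..T} t * \<bar>L \<rho> t - \<gamma> t\<bar>)
        + (velocity_const \<alpha> * M * \<rho>) * indicat_real {0..T} t \<partial>lborel)
        = \<rho> / 2 * ?I + velocity_const \<alpha> * M * \<rho> * T"
      using intI T by (simp add: set_lebesgue_integral_def)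
    also have "(\<rho> / 2 * ?I + velocity_const \<alpha> * M * \<rho> * T) * (K * (pi * (\<rho> / 2)\<^sup>2))
        \<le> (\<rho> / 2 * ?I + velocity_const \<alpha> * M * \<rho> * T) * (K * \<rho>\<^sup>2)"
    proof (intro mult_left_mono)
      have "pi * \<rho>\<^sup>2 \<le> 4 * \<rho>\<^sup>2" using pi_less_4 by (intro mult_right_mono) auto
      then show "pi * (\<rho> / 2)\<^sup>2 \<le> \<rho>\<^sup>2" by (simp add: power_divide)
      have "0 \<le> ?I" unfolding set_lebesgue_integral_def by (intro Bochner_Integration.integral_nonneg) auto
      then show "0 \<le> \<rho> / 2 * ?I + velocity_const \<alpha> * M * \<rho> * T" using \<rho> vc M T by simp
    qed (rule K0)
    finally show ?thesis by (simp add: K_def mult_ac)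
  qed
  show ?thesis
    using main v3 unfolding f1_val v1 v2 A_def[symmetric] by (simp add: abs_minus_commute)
qed

end

section \<open>Pointwise tracking along hyperbolic maps\<close>

lemma set_integral_interval_diff_le:
  fixes f h :: "real \<Rightarrow> real"
  assumes f: "set_integrable lborel {0..T} f" and h: "set_integrable lborel {0..T} h" and t: "0 \<le> t" "t \<le> T"
  shows "\<bar>(LINT s : {0..t} | lborel. f s) - (LINT s : {0..t} | lborel. h s)\<bar> \<le> (LINT s : {0..T} | lborel. \<bar>f s - h s\<bar>)"
proof -
  have sub: "{0..t} \<subseteq> {0..T}" using t by auto
  have ft: "set_integrable lborel {0..t} f" "set_integrable lborel {0..t} h"
    by (rule set_integrable_subset[OF f _ sub], simp, rule set_integrable_subset[OF h _ sub], simp)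
  have d: "set_integrable lborel {0..T} (\<lambda>s. \<bar>f s - h s\<bar>)"
    by (intro set_integrable_abs set_integral_diff f h)
  have "\<bar>(LINT s : {0..t} | lborel. f s) - (LINT s : {0..t} | lborel. h s)\<bar> = \<bar>LINT s : {0..t} | lborel. f s - h s\<bar>"
    using ft by (simp add: set_integral_diff)
  also have "\<dots> \<le> (LINT s : {0..t} | lborel. \<bar>f s - h s\<bar>)"
    using set_integral_norm_bound[OF set_integral_diff(1)[OF ft]] by simp
  also have "\<dots> \<le> (LINT s : {0..T} | lborel. \<bar>f s - h s\<bar>)"
    unfolding set_lebesgue_integral_def
    by (rule integral_mono) (use d set_integrable_subset[OF d _ sub] sub in \<open>auto simp: set_integrable_def indicator_def\<close>)
  finally show ?thesis .
qed

lemma powr_small: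
  assumes "0 < \<alpha>" "0 < (\<epsilon>::real)" "0 \<le> A"
  obtains \<kappa> where "0 < \<kappa>" "\<kappa> \<le> 1" "A * \<kappa> powr \<alpha> \<le> \<epsilon>"
proof -
  define \<kappa> where "\<kappa> = min 1 ((\<epsilon> / (A + 1)) powr (1 / \<alpha>))"
  have \<kappa>: "0 < \<kappa>" "\<kappa> \<le> 1" using assms by (auto simp: \<kappa>_def)
  have "\<kappa> powr \<alpha> \<le> ((\<epsilon> / (A + 1)) powr (1 / \<alpha>)) powr \<alpha>"
    using \<kappa> assms by (intro powr_mono2) (auto simp: \<kappa>_def)
  also have "\<dots> = \<epsilon> / (A + 1)" using assms by (simp add: powr_powr)
  finally have "A * \<kappa> powr \<alpha> \<le> A * (\<epsilon> / (A + 1))" using assms by (intro mult_left_mono) auto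
  also have "\<dots> \<le> \<epsilon>" using assms by (simp add: field_simps)
  finally show ?thesis using that \<kappa> by blast
qed

lemma norm_hyp_le: "norm (hyp g x) \<le> exp \<bar>g\<bar> * norm x"
proof -
  have e: "exp (g + g) \<le> exp (\<bar>g\<bar> + \<bar>g\<bar>)" "exp (- g + - g) \<le> exp (\<bar>g\<bar> + \<bar>g\<bar>)" by (auto simp: abs_if)
  have "(norm (hyp g x))\<^sup>2 = exp (g + g) * (x $ 1)\<^sup>2 + exp (- g + - g) * (x $ 2)\<^sup>2"
    by (simp only: norm_real2 hyp_nth power_mult_distrib exp_add power2_eq_square[of "exp _"])
  also have "\<dots> \<le> exp (\<bar>g\<bar> + \<bar>g\<bar>) * (x $ 1)\<^sup>2 + exp (\<bar>g\<bar> + \<bar>g\<bar>) * (x $ 2)\<^sup>2"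
    using e by (intro add_mono mult_right_mono) auto
  also have "\<dots> = (exp \<bar>g\<bar> * norm x)\<^sup>2"
    by (simp only: norm_real2 power_mult_distrib exp_add power2_eq_square[of "exp _"] distrib_left)
  finally show ?thesis by (rule power2_le_imp_le) simp
qed

lemma continuous_on_hyp: "continuous_on S (\<lambda>g. hyp g x)" "continuous_on S' (hyp g)"
proof -
  have h: "hyp g x = (\<chi> i. if i = 1 then exp g * x $ 1 else exp (- g) * x $ 2)" for g x
    by (simp add: vec_eq_iff forall_2)
  show "continuous_on S (\<lambda>g. hyp g x)" unfolding h
  proof (rule continuous_on_vec_lambda)
    show "continuous_on S (\<lambda>g. if i = 1 then exp g * x $ 1 else exp (- g) * x $ 2)" for i :: 2
      by (cases "i = 1") (auto intro!: continuous_intros)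
  qed
  show "continuous_on S' (hyp g)" unfolding h[abs_def]
  proof (rule continuous_on_vec_lambda)
    show "continuous_on S' (\<lambda>x::real^2. if i = 1 then exp g * x $ 1 else exp (- g) * x $ 2)" for i :: 2
      by (cases "i = 1") (auto intro!: continuous_intros)
  qed
qed

context holder_solution
begin

text \<open>The tracer is concentrated within \<open>2 E r\<close> of \<open>hyp g z\<close>, so averaging against it evaluates a Hoelder
  function there up to the modulus of continuity.\<close>

lemma tracer_average:
  assumes f: "holder_bound \<alpha> M f" and r: "0 < r" and E: "exp g \<le> E" "exp (- g) \<le> E"
  shows "\<bar>(\<integral>x. f x * tracer z r g x \<partial>lborel) / (r\<^sup>2 * tracer_mass) - f (hyp g z)\<bar> \<le> M * (2 * E * r) powr \<alpha>"
proof -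
  note [measurable] = \<theta>_slice_borel[OF f]
  have m: "0 < r\<^sup>2 * tracer_mass" using r tracer_mass_pos by simp
  note ti = tracer_integral[OF r, of z g]
  have i1: "integrable lborel (\<lambda>x. f x * tracer z r g x)"
  proof (rule Bochner_Integration.integrable_bound[OF integrable_mult_right[OF ti(1), of M]])
    show "(\<lambda>x. f x * tracer z r g x) \<in> borel_measurable lborel"
      using ti(1) by measurable
    show "AE x in lborel. norm (f x * tracer z r g x) \<le> norm (M * tracer z r g x)"
      using holder_boundD(1)[OF f] M tracer_bounds(1)[of z r g]
      by (intro AE_I2) (auto simp: abs_mult intro!: mult_right_mono)
  qed
  have "\<bar>(\<integral>x. f x * tracer z r g x \<partial>lborel) - f (hyp g z) * (r\<^sup>2 * tracer_mass)\<bar>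
      = \<bar>\<integral>x. f x * tracer z r g x - f (hyp g z) * tracer z r g x \<partial>lborel\<bar>"
    using i1 ti by simp
  also have "\<dots> \<le> (\<integral>x. (M * (2 * E * r) powr \<alpha>) * tracer z r g x \<partial>lborel)"
  proof (intro order_trans[OF integral_abs_bound] integral_mono)
    show "integrable lborel (\<lambda>x. \<bar>f x * tracer z r g x - f (hyp g z) * tracer z r g x\<bar>)"
      using i1 ti(1) by simp
    show "integrable lborel (\<lambda>x. (M * (2 * E * r) powr \<alpha>) * tracer z r g x)"
      using ti(1) by simp
    fix x
    show "\<bar>f x * tracer z r g x - f (hyp g z) * tracer z r g x\<bar> \<le> (M * (2 * E * r) powr \<alpha>) * tracer z r g x"
    proof (cases "tracer z r g x = 0")
      case False
      have "\<bar>f x - f (hyp g z)\<bar> \<le> M * norm (x - hyp g z) powr \<alpha>" by (rule holder_boundD(2)[OF f])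
      also have "\<dots> \<le> M * (2 * E * r) powr \<alpha>"
        using tracer_support[OF False r E] M \<alpha> by (intro mult_left_mono powr_mono2) auto
      finally have "\<bar>f x - f (hyp g z)\<bar> * tracer z r g x \<le> M * (2 * E * r) powr \<alpha> * tracer z r g x"
        using tracer_bounds(1) by (intro mult_right_mono)
      moreover have "f x * tracer z r g x - f (hyp g z) * tracer z r g x = (f x - f (hyp g z)) * tracer z r g x"
        by (simp add: algebra_simps)
      ultimately show ?thesis using tracer_bounds(1)[of z r g x] by (simp add: abs_mult)
    qed simp
  qed
  also have "\<dots> = M * (2 * E * r) powr \<alpha> * (r\<^sup>2 * tracer_mass)" using ti by simp
  finally have "\<bar>(\<integral>x. f x * tracer z r g x \<partial>lborel) - f (hyp g z) * (r\<^sup>2 * tracer_mass)\<bar> / (r\<^sup>2 * tracer_mass)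
      \<le> M * (2 * E * r) powr \<alpha>"
    using m by (simp add: pos_divide_le_eq)
  moreover have "\<bar>(\<integral>x. f x * tracer z r g x \<partial>lborel) - f (hyp g z) * (r\<^sup>2 * tracer_mass)\<bar> / (r\<^sup>2 * tracer_mass)
      = \<bar>((\<integral>x. f x * tracer z r g x \<partial>lborel) - f (hyp g z) * (r\<^sup>2 * tracer_mass)) / (r\<^sup>2 * tracer_mass)\<bar>"
    using m by (simp only: abs_divide abs_of_pos)
  moreover have "((\<integral>x. f x * tracer z r g x \<partial>lborel) - f (hyp g z) * (r\<^sup>2 * tracer_mass)) / (r\<^sup>2 * tracer_mass)
      = (\<integral>x. f x * tracer z r g x \<partial>lborel) / (r\<^sup>2 * tracer_mass) - f (hyp g z)"
    by (simp only: diff_divide_distrib nonzero_mult_div_cancel_right[OF less_imp_neq[OF m, symmetric]])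
  ultimately show ?thesis by simp
qed

text \<open>The averages over \<open>\<psi>\<close> in \<open>weak_tracer\<close> are localised in time: as \<open>\<psi>\<close> is arbitrary, the mass
  seen by the tracer is close to the initial one at almost every time.\<close>

lemma tracer_AE:
  assumes \<rho>: "0 < \<rho>" and T: "0 < T" "T < \<delta>" and r: "0 < r"
    and \<Gamma>: "smooth \<Gamma>" "\<And>t. (\<Gamma> has_real_derivative \<gamma> t) (at t)" "\<Gamma> 0 = 0" and \<gamma>: "continuous_on UNIV \<gamma>"
    and E: "\<And>t. t \<in> {0..T} \<Longrightarrow> exp (\<Gamma> t) \<le> E" "\<And>t. t \<in> {0..T} \<Longrightarrow> exp (- \<Gamma> t) \<le> E"
    and supp: "\<And>t (x :: real^2). t \<in> {0..T} \<Longrightarrow> \<bar>exp (- \<Gamma> t) * x $ 1 - z $ 1\<bar> \<le> r \<Longrightarrow> \<bar>exp (\<Gamma> t) * x $ 2 - z $ 2\<bar> \<le> r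
      \<Longrightarrow> norm x \<le> \<rho> / 2"
  defines "Err \<equiv> M * \<rho> powr \<alpha> * \<rho>\<^sup>2 * (2 * bump_slope * E / r)
        * (\<rho> / 2 * (LINT t : {0..T} | lborel. \<bar>L \<rho> t - \<gamma> t\<bar>) + velocity_const \<alpha> * M * \<rho> * T)"
  shows "AE t in lborel. 0 < t \<longrightarrow> t < T \<longrightarrow>
    \<bar>\<theta> t (hyp (\<Gamma> t) z) - \<theta>0 z\<bar> \<le> 2 * (M * (2 * E * r) powr \<alpha>) + Err / (r\<^sup>2 * tracer_mass)"
proof -
  define m where "m = (\<lambda>t. \<integral>x. w (t, x) * tracer z r (\<Gamma> t) x \<partial>lborel)"
  define m0 where "m0 = (\<integral>x. \<theta>0 x * tracer z r 0 x \<partial>lborel)"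
  have mass: "0 < r\<^sup>2 * tracer_mass" using r tracer_mass_pos by simp
  have [measurable]: "\<Gamma> \<in> borel_measurable borel"
    by (intro borel_measurable_continuous_onI smooth_continuous_on \<Gamma>)
  have cont: "continuous_on UNIV (\<lambda>p::real \<times> (real^2). (\<Gamma> (fst p), snd p))"
    by (intro continuous_intros continuous_on_compose2[OF smooth_continuous_on[OF \<Gamma>(1), of UNIV]]) auto
  have "(\<lambda>p::real \<times> (real^2). (\<Gamma> (fst p), snd p)) \<in> borel \<rightarrow>\<^sub>M borel"
    by (rule borel_measurable_continuous_onI[OF cont])
  from measurable_compose[OF this tracer_borel]
  have "(\<lambda>p. w p * tracer z r (\<Gamma> (fst p)) (snd p)) \<in> borel_measurable borel" by simp
  then have "(\<lambda>(t, x). w (t, x) * tracer z r (\<Gamma> t) x) \<in> borel_measurable (lborel \<Otimes>\<^sub>M lborel)"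
    unfolding lborel_prod by (simp add: case_prod_beta')
  from lborel.borel_measurable_lebesgue_integral[OF this]
  have m_borel[measurable]: "m \<in> borel_measurable borel" by (simp add: m_def)
  have m_bound: "\<bar>m t\<bar> \<le> M * (r\<^sup>2 * tracer_mass)" for t
  proof -
    note ti = tracer_integral[OF r, of z "\<Gamma> t"]
    have le: "norm (w (t, x) * tracer z r (\<Gamma> t) x) \<le> M * tracer z r (\<Gamma> t) x" for x
      using w_bound[of "(t, x)"] tracer_bounds(1)[of z r "\<Gamma> t" x] by (simp add: abs_mult mult_right_mono)
    have int: "integrable lborel (\<lambda>x. w (t, x) * tracer z r (\<Gamma> t) x)"
      by (rule Bochner_Integration.integrable_bound[OF integrable_mult_right[OF ti(1), of M]])
        (use le ti(1) M tracer_bounds(1) in \<open>auto intro!: AE_I2 simp: abs_mult\<close>)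
    have "\<bar>m t\<bar> \<le> (\<integral>x. M * tracer z r (\<Gamma> t) x \<partial>lborel)"
      unfolding m_def using int ti(1) le by (intro order_trans[OF integral_abs_bound] integral_mono) auto
    then show ?thesis using ti(2) by simp
  qed
  define C where "C = M * (r\<^sup>2 * tracer_mass) + \<bar>m0\<bar> + \<bar>Err\<bar>"
  have test: "(\<integral>t. (\<sigma> * (m t - m0) - Err) * \<psi> t \<partial>lborel) \<le> 0"
    if \<sigma>: "\<sigma> \<in> {-1, 1}" and \<psi>: "smooth \<psi>" "\<And>t. 0 \<le> \<psi> t" "\<And>t. \<psi> t \<le> 1" "\<And>t. t \<notin> {0<..<T} \<Longrightarrow> \<psi> t = 0" for \<sigma> \<psi>
  proof -
    have [measurable]: "\<psi> \<in> borel_measurable borel"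
      by (intro borel_measurable_continuous_onI smooth_continuous_on \<psi>)
    have \<psi>_int: "integrable lborel \<psi>"
      by (rule Bochner_Integration.integrable_bound[of _ "indicat_real {0..T}"])
        (use \<psi> in \<open>auto intro!: AE_I2 simp: indicator_def abs_le_iff\<close>)
    have \<psi>m_int: "integrable lborel (\<lambda>t. \<psi> t * m t)"
    proof (rule Bochner_Integration.integrable_bound[OF integrable_mult_right[OF \<psi>_int, of "M * (r\<^sup>2 * tracer_mass)"]])
      show "AE t in lborel. norm (\<psi> t * m t) \<le> norm (M * (r\<^sup>2 * tracer_mass) * \<psi> t)"
      proof (intro AE_I2)
        fix t
        have "\<psi> t * \<bar>m t\<bar> \<le> \<psi> t * (M * (r\<^sup>2 * tracer_mass))" by (intro mult_left_mono m_bound \<psi>)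
        also have "\<dots> \<le> \<bar>M * (r\<^sup>2 * tracer_mass) * \<psi> t\<bar>" by (simp add: mult.commute)
        finally show "norm (\<psi> t * m t) \<le> norm (M * (r\<^sup>2 * tracer_mass) * \<psi> t)"
          using \<psi>(2)[of t] by (simp add: abs_mult)
      qed
    qed measurable
    have "(\<integral>t. (\<sigma> * (m t - m0) - Err) * \<psi> t \<partial>lborel) = (\<integral>t. \<sigma> * (\<psi> t * m t) - (\<sigma> * m0 + Err) * \<psi> t \<partial>lborel)"
      by (simp add: algebra_simps)
    also have "\<dots> = \<sigma> * (\<integral>t. \<psi> t * m t \<partial>lborel) - (\<sigma> * m0 + Err) * (\<integral>t. \<psi> t \<partial>lborel)"
      using \<psi>_int \<psi>m_int by simp
    also have "\<dots> = \<sigma> * ((\<integral>t. \<psi> t * m t \<partial>lborel) - (\<integral>t. \<psi> t \<partial>lborel) * m0) - (\<integral>t. \<psi> t \<partial>lborel) * Err"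
      by (simp add: algebra_simps)
    also have "\<dots> \<le> 0"
    proof -
      have "\<bar>(\<integral>t. \<psi> t * m t \<partial>lborel) - (\<integral>t. \<psi> t \<partial>lborel) * m0\<bar> \<le> (\<integral>t. \<psi> t \<partial>lborel) * Err"
        unfolding m_def m0_def Err_def by (rule weak_tracer[OF \<rho> T r \<Gamma> \<gamma> E supp \<psi>])
      then show ?thesis using \<sigma> by auto
    qed
    finally show ?thesis .
  qed
  have bd: "\<bar>\<sigma> * (m t - m0) - Err\<bar> \<le> C" if "\<sigma> \<in> {-1, 1}" for \<sigma> t
    using that m_bound[of t] unfolding C_def by (auto simp: abs_le_iff)
  have half: "AE t in lborel. 0 < t \<longrightarrow> t < T \<longrightarrow> \<sigma> * (m t - m0) - Err \<le> 0" if "\<sigma> \<in> {-1, 1}" for \<sigma>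
    by (rule smooth_integral_tests_imp_AE_nonpos[OF _ bd[OF that] test[OF that]]) measurable
  have "AE t in lborel. 0 < t \<longrightarrow> t < T \<longrightarrow> 1 * (m t - m0) - Err \<le> 0"
    "AE t in lborel. 0 < t \<longrightarrow> t < T \<longrightarrow> - 1 * (m t - m0) - Err \<le> 0"
    by (rule half, simp)+
  then show ?thesis using slices
  proof eventually_elim
    case (elim t)
    show ?case
    proof (intro impI)
      assume t: "0 < t" "t < T"
      then have hold: "holder_bound \<alpha> M (\<theta> t)" and eq: "AE x in lborel. \<theta> t x = w (t, x)"
        using elim(3) T by auto
      have tT: "t \<in> {0..T}" using t by simp
      note [measurable] = \<theta>_slice_borel[OF hold]
      have [measurable]: "tracer z r (\<Gamma> t) \<in> borel_measurable borel" using tracer_integral(1)[OF r] by auto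
      have m_eq: "m t = (\<integral>x. \<theta> t x * tracer z r (\<Gamma> t) x \<partial>lborel)"
        unfolding m_def by (rule integral_cong_AE) (use eq in auto)
      have a1: "\<bar>m t / (r\<^sup>2 * tracer_mass) - \<theta> t (hyp (\<Gamma> t) z)\<bar> \<le> M * (2 * E * r) powr \<alpha>"
        unfolding m_eq by (rule tracer_average[OF hold r E[OF tT]])
      have "exp (0::real) \<le> E" "exp (- 0 :: real) \<le> E" using E[of 0] \<Gamma>(3) T by auto
      then have a2: "\<bar>m0 / (r\<^sup>2 * tracer_mass) - \<theta>0 z\<bar> \<le> M * (2 * E * r) powr \<alpha>"
        unfolding m0_def using tracer_average[OF init r, of 0 E z] by simp
      have "\<bar>m t - m0\<bar> \<le> Err" using elim(1,2) t by (auto simp: abs_le_iff)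
      then have "\<bar>m t - m0\<bar> / (r\<^sup>2 * tracer_mass) \<le> Err / (r\<^sup>2 * tracer_mass)"
        using mass by (intro divide_right_mono) auto
      moreover have "\<bar>m t - m0\<bar> / (r\<^sup>2 * tracer_mass) = \<bar>m t / (r\<^sup>2 * tracer_mass) - m0 / (r\<^sup>2 * tracer_mass)\<bar>"
        using mass by (simp only: diff_divide_distrib[symmetric] abs_divide abs_of_pos)
      ultimately have a3: "\<bar>m t / (r\<^sup>2 * tracer_mass) - m0 / (r\<^sup>2 * tracer_mass)\<bar> \<le> Err / (r\<^sup>2 * tracer_mass)" by simp
      have "\<bar>b - c\<bar> \<le> 2 * q + d" if "\<bar>a - b\<bar> \<le> q" "\<bar>a' - c\<bar> \<le> q" "\<bar>a - a'\<bar> \<le> d" for a a' b c d q :: real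
        using that by linarith
      from this[OF a1 a2 a3]
      show "\<bar>\<theta> t (hyp (\<Gamma> t) z) - \<theta>0 z\<bar> \<le> 2 * (M * (2 * E * r) powr \<alpha>) + Err / (r\<^sup>2 * tracer_mass)" .
    qed
  qed
qed

definition G :: "real \<Rightarrow> real \<Rightarrow> real" where
  "G \<rho> t = (LINT s : {0..t} | lborel. L \<rho> s)"

lemma L_set_integrable: "0 < \<rho> \<Longrightarrow> set_integrable lborel {a..b} (L \<rho>)"
  using L_bounded integrable_bounded_on_interval[OF L_borel] by blast

lemma G_Lipschitz:
  assumes "0 < \<rho>" shows "\<exists>B\<ge>0. \<forall>s t. 0 \<le> s \<longrightarrow> s \<le> t \<longrightarrow> \<bar>G \<rho> t - G \<rho> s\<bar> \<le> B * (t - s)"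
proof -
  obtain B where B: "0 \<le> B" "\<And>t. \<bar>L \<rho> t\<bar> \<le> B" using L_bounded[OF assms] by blast
  have "\<bar>G \<rho> t - G \<rho> s\<bar> \<le> B * (t - s)" if st: "0 \<le> s" "s \<le> t" for s t
  proof -
    have i: "set_integrable lborel {a..b} (L \<rho>)" for a b by (rule L_set_integrable[OF assms])
    have "G \<rho> t = (LINT y : {0..s} \<union> {s<..t} | lborel. L \<rho> y)"
      unfolding G_def using st by (simp add: ivl_disj_un)
    also have "\<dots> = G \<rho> s + (LINT y : {s<..t} | lborel. L \<rho> y)"
      unfolding G_def by (rule set_integral_Un) (auto intro: i set_integrable_subset[OF i[of s t]])
    finally have "\<bar>G \<rho> t - G \<rho> s\<bar> = \<bar>LINT y : {s<..t} | lborel. L \<rho> y\<bar>" by simp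
    also have "\<dots> \<le> (\<integral>y. B * indicat_real {s..t} y \<partial>lborel)"
      unfolding set_lebesgue_integral_def
    proof (intro order_trans[OF integral_abs_bound] integral_mono)
      show "integrable lborel (\<lambda>y. \<bar>indicat_real {s<..t} y *\<^sub>R L \<rho> y\<bar>)"
      proof -
        have "set_integrable lborel {s<..t} (L \<rho>)" by (rule set_integrable_subset[OF i[of s t]]) auto
        then show ?thesis unfolding set_integrable_def by (rule integrable_abs)
      qed
      show "\<bar>indicat_real {s<..t} y *\<^sub>R L \<rho> y\<bar> \<le> B * indicat_real {s..t} y" for y
        using B(2)[of y] B(1) by (auto simp: indicator_def)
    qed simp
    also have "\<dots> = B * (t - s)" using st by simp
    finally show ?thesis .
  qed
  then show ?thesis using B(1) by blast
qed

lemma G_0 [simp]: "G \<rho> 0 = 0"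
proof -
  have "G \<rho> 0 = (\<integral>s. 0 \<partial>(lborel :: real measure))"
    unfolding G_def set_lebesgue_integral_def
  proof (rule integral_cong_AE)
    show "AE s in lborel. indicat_real {0..0} s *\<^sub>R L \<rho> s = 0"
      using AE_lborel_singleton[of "0::real"] by eventually_elim (auto simp: indicator_def)
  qed auto
  then show ?thesis by simp
qed

text \<open>The polynomial exponents \<open>\<Gamma> n\<close> converge to \<open>G \<rho>\<close>, and the exceptional null sets of times for
  different \<open>n\<close> are combined before the limit is taken. The choice \<open>E = exp (g + 1)\<close> leaves room for
  \<open>\<bar>\<Gamma> n\<bar> \<le> g + 1\<close>; the restrictions on \<open>r\<close> and \<open>z\<close> keep the tracer inside the ball of radius \<open>\<rho>/2\<close>.\<close>

lemma tracking_point: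
  assumes \<rho>: "0 < \<rho>" and T: "0 < T" "T < \<delta>" and G: "\<And>t. t \<in> {0..T} \<Longrightarrow> \<bar>G \<rho> t\<bar> \<le> g"
    and E: "E = exp (g + 1)" and r: "0 < r" "r \<le> \<rho> / (8 * E)" and z: "norm z \<le> \<rho> / (8 * E)"
  shows "AE t in lborel. 0 < t \<longrightarrow> t < T \<longrightarrow> \<bar>\<theta> t (hyp (G \<rho> t) z) - \<theta>0 z\<bar>
    \<le> 2 * (M * (2 * E * r) powr \<alpha>)
      + M * \<rho> powr \<alpha> * \<rho>\<^sup>2 * (2 * bump_slope * E / r) * (velocity_const \<alpha> * M * \<rho> * T) / (r\<^sup>2 * tracer_mass)"
proof -
  obtain B where B: "0 \<le> B" "\<And>t. \<bar>L \<rho> t\<bar> \<le> B" using L_bounded[OF \<rho>] by blast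
  have "\<forall>n. \<exists>p. real_polynomial_function p \<and> (LINT t : {0..T} | lborel. \<bar>L \<rho> t - p t\<bar>) < inverse (real (Suc n))"
  proof
    fix n
    have "0 < inverse (real (Suc n))" by simp
    from polynomial_approx_L1[OF L_borel B(2) this less_imp_le[OF T(1)]]
    show "\<exists>p. real_polynomial_function p \<and> (LINT t : {0..T} | lborel. \<bar>L \<rho> t - p t\<bar>) < inverse (real (Suc n))"
      by metis
  qed
  then obtain p where p: "\<And>n. real_polynomial_function (p n)"
    "\<And>n. (LINT t : {0..T} | lborel. \<bar>L \<rho> t - p n t\<bar>) < inverse (real (Suc n))"
    by metis
  have "\<exists>\<Gamma>. smooth \<Gamma> \<and> (\<forall>t. (\<Gamma> has_real_derivative p n t) (at t)) \<and> \<Gamma> 0 = 0" for n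
  proof -
    obtain a N where a: "p n = (\<lambda>x. \<Sum>i\<le>N. a i * x ^ i)"
      using p(1)[of n] unfolding real_polynomial_function_iff_sum by blast
    define \<Gamma> where "\<Gamma> = (\<lambda>x::real. \<Sum>i\<le>N. a i / real (Suc i) * x ^ Suc i)"
    have "((\<lambda>x::real. a i / real (Suc i) * x ^ Suc i) has_real_derivative a i * t ^ i) (at t)" for i t
      by (rule DERIV_cong[OF DERIV_cmult[OF DERIV_pow]]) (simp del: of_nat_Suc)
    then have "(\<Gamma> has_real_derivative p n t) (at t)" for t
      unfolding a \<Gamma>_def by (intro DERIV_sum)
    moreover have "smooth \<Gamma>" unfolding \<Gamma>_def
      by (intro smooth_sum smooth_mult smooth_const smooth_power smooth_ident)
    ultimately show ?thesis by (intro exI[of _ \<Gamma>]) (simp add: \<Gamma>_def)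
  qed
  then obtain \<Gamma> where \<Gamma>: "\<And>n. smooth (\<Gamma> n)" "\<And>n t. (\<Gamma> n has_real_derivative p n t) (at t)" "\<And>n. \<Gamma> n 0 = 0"
    by metis
  have p_cont: "continuous_on S (p n)" for n S
    using p(1) continuous_on_polymonial_function real_polynomial_function_eq by blast
  have close: "\<bar>\<Gamma> n t - G \<rho> t\<bar> \<le> inverse (real (Suc n))" if t: "t \<in> {0..T}" for n t
  proof -
    have "(\<integral>s. p n s * indicator {0..t} s \<partial>lborel) = \<Gamma> n t - \<Gamma> n 0"
      by (rule integral_FTC_Icc_real) (use t \<Gamma> p_cont[of UNIV n] in \<open>auto simp: continuous_on_eq_continuous_at\<close>)
    then have "\<Gamma> n t = (LINT s : {0..t} | lborel. p n s)"
      using \<Gamma>(3) by (simp add: set_lebesgue_integral_def mult.commute)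
    moreover have "set_integrable lborel {0..T} (p n)"
      by (rule borel_integrable_atLeastAtMost') (rule p_cont)
    ultimately have "\<bar>G \<rho> t - \<Gamma> n t\<bar> \<le> (LINT t : {0..T} | lborel. \<bar>L \<rho> t - p n t\<bar>)"
      unfolding G_def using set_integral_interval_diff_le[OF L_set_integrable[OF \<rho>], of T "p n" t] t by auto
    then show ?thesis using p(2)[of n] by linarith
  qed
  have \<Gamma>_bound: "\<bar>\<Gamma> n t\<bar> \<le> g + 1" if "t \<in> {0..T}" for n t
  proof -
    have "inverse (real (Suc n)) \<le> 1" by (simp add: field_simps)
    then show ?thesis using close[OF that, of n] G[OF that] by linarith
  qed
  have E_bounds: "exp (\<Gamma> n t) \<le> E" "exp (- \<Gamma> n t) \<le> E" if "t \<in> {0..T}" for n t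
    using \<Gamma>_bound[OF that, of n] unfolding E by auto
  have E0: "0 < E" by (simp add: E)
  have supp: "norm x \<le> \<rho> / 2" if t: "t \<in> {0..T}" and x: "\<bar>exp (- \<Gamma> n t) * x $ 1 - z $ 1\<bar> \<le> r"
    "\<bar>exp (\<Gamma> n t) * x $ 2 - z $ 2\<bar> \<le> r" for n t and x :: "real^2"
  proof -
    have zr: "\<bar>z $ i\<bar> + r \<le> \<rho> / (4 * E)" for i
    proof -
      have "\<bar>z $ i\<bar> + r \<le> \<rho> / (8 * E) + \<rho> / (8 * E)"
        using component_le_norm_cart[of z i] z r by linarith
      then show ?thesis by (simp add: field_simps)
    qed
    have "\<bar>x $ 1\<bar> = exp (\<Gamma> n t) * \<bar>exp (- \<Gamma> n t) * x $ 1\<bar>"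
      by (simp add: abs_mult exp_minus)
    also have "\<dots> \<le> E * (\<rho> / (4 * E))"
      using E_bounds[OF t] x zr[of 1] E0 by (intro mult_mono) auto
    finally have 1: "\<bar>x $ 1\<bar> \<le> \<rho> / 4" using E0 by simp
    have "\<bar>x $ 2\<bar> = exp (- \<Gamma> n t) * \<bar>exp (\<Gamma> n t) * x $ 2\<bar>"
      by (simp add: abs_mult exp_minus)
    also have "\<dots> \<le> E * (\<rho> / (4 * E))"
      using E_bounds[OF t] x zr[of 2] E0 by (intro mult_mono) auto
    finally have 2: "\<bar>x $ 2\<bar> \<le> \<rho> / 4" using E0 by simp
    show ?thesis using 1 2 norm_le_abs_sum[of x] by linarith
  qed
  define K where "K = M * \<rho> powr \<alpha> * \<rho>\<^sup>2 * (2 * bump_slope * E / r)"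
  have K: "0 \<le> K" unfolding K_def using M E0 r bump_slope(1) by simp
  have mass: "0 < r\<^sup>2 * tracer_mass" using r tracer_mass_pos by simp
  define bound where "bound = (\<lambda>n. 2 * (M * (2 * E * r) powr \<alpha>)
      + K * (\<rho> / 2 * inverse (real (Suc n)) + velocity_const \<alpha> * M * \<rho> * T) / (r\<^sup>2 * tracer_mass))"
  have "AE t in lborel. 0 < t \<longrightarrow> t < T \<longrightarrow> \<bar>\<theta> t (hyp (\<Gamma> n t) z) - \<theta>0 z\<bar> \<le> bound n" for n
  proof -
    have "AE t in lborel. 0 < t \<longrightarrow> t < T \<longrightarrow> \<bar>\<theta> t (hyp (\<Gamma> n t) z) - \<theta>0 z\<bar>
      \<le> 2 * (M * (2 * E * r) powr \<alpha>) + K * (\<rho> / 2 * (LINT t : {0..T} | lborel. \<bar>L \<rho> t - p n t\<bar>)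
          + velocity_const \<alpha> * M * \<rho> * T) / (r\<^sup>2 * tracer_mass)"
      unfolding K_def
    proof (rule tracer_AE[OF \<rho> T r(1) \<Gamma>(1) \<Gamma>(2) \<Gamma>(3) p_cont])
      show "exp (\<Gamma> n t) \<le> E" "exp (- \<Gamma> n t) \<le> E" if "t \<in> {0..T}" for t by (rule E_bounds[OF that])+
      show "norm x \<le> \<rho> / 2" if "t \<in> {0..T}" "\<bar>exp (- \<Gamma> n t) * x $ 1 - z $ 1\<bar> \<le> r"
        "\<bar>exp (\<Gamma> n t) * x $ 2 - z $ 2\<bar> \<le> r" for t and x :: "real^2"
        by (rule supp[OF that])
    qed
    then show ?thesis
    proof eventually_elim
      case (elim t)
    have "K * (\<rho> / 2 * (LINT t : {0..T} | lborel. \<bar>L \<rho> t - p n t\<bar>) + velocity_const \<alpha> * M * \<rho> * T) / (r\<^sup>2 * tracer_mass)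
        \<le> K * (\<rho> / 2 * inverse (real (Suc n)) + velocity_const \<alpha> * M * \<rho> * T) / (r\<^sup>2 * tracer_mass)"
      using K mass \<rho> p(2)[of n] by (intro divide_right_mono mult_left_mono add_right_mono) auto
    then show ?case using elim unfolding bound_def by linarith
    qed
  qed
  then have "AE t in lborel. \<forall>n. 0 < t \<longrightarrow> t < T \<longrightarrow> \<bar>\<theta> t (hyp (\<Gamma> n t) z) - \<theta>0 z\<bar> \<le> bound n"
    unfolding AE_all_countable by blast
  then show ?thesis using slices
  proof eventually_elim
    case (elim t)
    show ?case
    proof (intro impI)
      assume t: "0 < t" "t < T"
      then have hold: "holder_bound \<alpha> M (\<theta> t)" using elim(2) T by auto
      have inv: "(\<lambda>n. inverse (real (Suc n))) \<longlonglongrightarrow> 0" by (rule LIMSEQ_inverse_real_of_nat)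
      have "(\<lambda>n. \<Gamma> n t - G \<rho> t) \<longlonglongrightarrow> 0"
        by (rule Lim_null_comparison[OF _ inv]) (use close[of t] t in \<open>auto intro!: always_eventually\<close>)
      then have "(\<lambda>n. \<Gamma> n t) \<longlonglongrightarrow> G \<rho> t" by (rule LIM_zero_cancel)
      moreover have "continuous_on UNIV (\<lambda>s. \<theta> t (hyp s z))"
        by (rule continuous_on_compose2[OF holder_bound_continuous[OF hold \<alpha>(1), of UNIV] continuous_on_hyp(1)]) auto
      then have "isCont (\<lambda>s. \<theta> t (hyp s z)) (G \<rho> t)" by (simp add: continuous_on_eq_continuous_at)
      ultimately have "(\<lambda>n. \<theta> t (hyp (\<Gamma> n t) z)) \<longlonglongrightarrow> \<theta> t (hyp (G \<rho> t) z)"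
        by (rule isCont_tendsto_compose[rotated])
      then have l1: "(\<lambda>n. \<bar>\<theta> t (hyp (\<Gamma> n t) z) - \<theta>0 z\<bar>) \<longlonglongrightarrow> \<bar>\<theta> t (hyp (G \<rho> t) z) - \<theta>0 z\<bar>"
        by (intro tendsto_intros)
      have l2: "bound \<longlonglongrightarrow> 2 * (M * (2 * E * r) powr \<alpha>)
          + K * (\<rho> / 2 * 0 + velocity_const \<alpha> * M * \<rho> * T) / (r\<^sup>2 * tracer_mass)"
        unfolding bound_def using mass by (intro tendsto_intros inv) auto
      have "\<bar>\<theta> t (hyp (G \<rho> t) z) - \<theta>0 z\<bar> \<le> 2 * (M * (2 * E * r) powr \<alpha>)
          + K * (\<rho> / 2 * 0 + velocity_const \<alpha> * M * \<rho> * T) / (r\<^sup>2 * tracer_mass)"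
        by (rule LIMSEQ_le[OF l1 l2]) (use elim(1) t in auto)
      then show "\<bar>\<theta> t (hyp (G \<rho> t) z) - \<theta>0 z\<bar> \<le> 2 * (M * (2 * E * r) powr \<alpha>)
          + M * \<rho> powr \<alpha> * \<rho>\<^sup>2 * (2 * bump_slope * E / r) * (velocity_const \<alpha> * M * \<rho> * T) / (r\<^sup>2 * tracer_mass)"
        by (simp add: K_def)
    qed
  qed
qed

text \<open>Both error terms of \<open>tracking_point\<close> are multiples of \<open>\<rho> powr \<alpha>\<close> when the tracer has radius \<open>\<kappa> \<rho>\<close>: the
  first is made small by \<open>\<kappa>\<close>, the second afterwards by the length of the time interval, which
  therefore does not depend on \<open>\<rho>\<close>. A countable dense set of points makes the null set of times
  independent of \<open>z\<close>.\<close>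

lemma tracking:
  assumes e: "0 < e" and E: "E = exp (g + 1)"
  shows "\<exists>T0>0. \<forall>\<rho> T. 0 < \<rho> \<longrightarrow> 0 < T \<longrightarrow> T \<le> T0 \<longrightarrow> T < \<delta> \<longrightarrow> (\<forall>t\<in>{0..T}. \<bar>G \<rho> t\<bar> \<le> g) \<longrightarrow>
    (AE t in lborel. 0 < t \<longrightarrow> t < T \<longrightarrow> (\<forall>z. norm z < \<rho> / (8 * E) \<longrightarrow> \<bar>\<theta> t (hyp (G \<rho> t) z) - \<theta>0 z\<bar> \<le> e * \<rho> powr \<alpha>))"
proof -
  have E0: "0 < E" by (simp add: E)
  have mass: "0 < tracer_mass" by (rule tracer_mass_pos)
  have vc: "0 < velocity_const \<alpha>" by (rule velocity_const(1)[OF \<alpha>])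
  obtain k where k: "0 < k" "k \<le> 1" "(2 * M * 1) * k powr \<alpha> \<le> e / 2"
    using powr_small[of \<alpha> "e / 2" "2 * M * 1"] \<alpha> e M by auto
  \<comment> \<open>the radius \<open>\<kappa> \<rho>\<close> of the tracer\<close>
  define \<kappa> where "\<kappa> = k / (8 * E)"
  have \<kappa>: "0 < \<kappa>" "\<kappa> \<le> 1 / (8 * E)" using k E0 by (auto simp: \<kappa>_def divide_right_mono)
  define Q where "Q = M * (2 * bump_slope * E) * velocity_const \<alpha> * M / (\<kappa> ^ 3 * tracer_mass)"
  have Q: "0 \<le> Q" unfolding Q_def using M E0 vc \<kappa> mass bump_slope(1) by simp
  define T0 where "T0 = e / (2 * (Q + 1))"
  have T0: "0 < T0" using e Q by (simp add: T0_def)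
  have QT0: "Q * T0 \<le> e / 2" using e Q by (simp add: T0_def field_simps)
  have "AE t in lborel. 0 < t \<longrightarrow> t < T \<longrightarrow> (\<forall>z. norm z < \<rho> / (8 * E) \<longrightarrow> \<bar>\<theta> t (hyp (G \<rho> t) z) - \<theta>0 z\<bar> \<le> e * \<rho> powr \<alpha>)"
    if \<rho>: "0 < \<rho>" and T: "0 < T" "T \<le> T0" "T < \<delta>" and G: "\<forall>t\<in>{0..T}. \<bar>G \<rho> t\<bar> \<le> g" for \<rho> T
  proof -
    define r where "r = \<kappa> * \<rho>"
    have r: "0 < r" "r \<le> \<rho> / (8 * E)"
      using \<kappa> \<rho> mult_right_mono[OF \<kappa>(2), of \<rho>] by (auto simp: r_def)
    have err: "2 * (M * (2 * E * r) powr \<alpha>)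
      + M * \<rho> powr \<alpha> * \<rho>\<^sup>2 * (2 * bump_slope * E / r) * (velocity_const \<alpha> * M * \<rho> * T) / (r\<^sup>2 * tracer_mass) \<le> e * \<rho> powr \<alpha>"
    proof -
      have "2 * E * r \<le> k * \<rho>" using E0 k \<rho> by (simp add: r_def \<kappa>_def)
      then have "(2 * E * r) powr \<alpha> \<le> (k * \<rho>) powr \<alpha>" using E0 r \<alpha> by (intro powr_mono2) auto
      also have "\<dots> = k powr \<alpha> * \<rho> powr \<alpha>" using k \<rho> by (simp add: powr_mult)
      finally have "2 * (M * (2 * E * r) powr \<alpha>) \<le> 2 * (M * (k powr \<alpha> * \<rho> powr \<alpha>))"
        using M by (intro mult_left_mono) auto
      also have "\<dots> = (2 * M * 1) * k powr \<alpha> * \<rho> powr \<alpha>" by simp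
      also have "\<dots> \<le> e / 2 * \<rho> powr \<alpha>" using k(3) by (intro mult_right_mono) auto
      finally have 1: "2 * (M * (2 * E * r) powr \<alpha>) \<le> e / 2 * \<rho> powr \<alpha>" .
      have "M * \<rho> powr \<alpha> * \<rho>\<^sup>2 * (2 * bump_slope * E / r) * (velocity_const \<alpha> * M * \<rho> * T) / (r\<^sup>2 * tracer_mass)
          = \<rho> powr \<alpha> * (Q * T)"
        using \<rho> \<kappa> mass by (simp add: Q_def r_def power2_eq_square power3_eq_cube field_simps)
      also have "\<dots> \<le> \<rho> powr \<alpha> * (e / 2)"
        using QT0 mult_left_mono[OF T(2) Q] by (intro mult_left_mono) auto
      finally show ?thesis by (rule order_trans[OF add_mono[OF 1]]) simp
    qed
    obtain D :: "(real^2) set" where D: "countable D" "\<And>X. open X \<Longrightarrow> X \<noteq> {} \<Longrightarrow> \<exists>d\<in>D. d \<in> X"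
      using countable_dense_setE by metis
    have "AE t in lborel. \<forall>z\<in>D \<inter> ball 0 (\<rho> / (8 * E)). 0 < t \<longrightarrow> t < T \<longrightarrow> \<bar>\<theta> t (hyp (G \<rho> t) z) - \<theta>0 z\<bar> \<le> e * \<rho> powr \<alpha>"
    proof (subst AE_ball_countable)
      show "countable (D \<inter> ball 0 (\<rho> / (8 * E)))" using D(1) by auto
      show "\<forall>z\<in>D \<inter> ball 0 (\<rho> / (8 * E)). AE t in lborel. 0 < t \<longrightarrow> t < T \<longrightarrow> \<bar>\<theta> t (hyp (G \<rho> t) z) - \<theta>0 z\<bar> \<le> e * \<rho> powr \<alpha>"
      proof
        fix z assume "z \<in> D \<inter> ball 0 (\<rho> / (8 * E))"
        then have z: "norm z \<le> \<rho> / (8 * E)" by simp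
        from tracking_point[OF \<rho> T(1,3) _ E r z] G
        have "AE t in lborel. 0 < t \<longrightarrow> t < T \<longrightarrow> \<bar>\<theta> t (hyp (G \<rho> t) z) - \<theta>0 z\<bar>
          \<le> 2 * (M * (2 * E * r) powr \<alpha>)
          + M * \<rho> powr \<alpha> * \<rho>\<^sup>2 * (2 * bump_slope * E / r) * (velocity_const \<alpha> * M * \<rho> * T) / (r\<^sup>2 * tracer_mass)"
          by blast
        then show "AE t in lborel. 0 < t \<longrightarrow> t < T \<longrightarrow> \<bar>\<theta> t (hyp (G \<rho> t) z) - \<theta>0 z\<bar> \<le> e * \<rho> powr \<alpha>"
          by eventually_elim (use err in linarith)
      qed
    qed
    then show ?thesis using slices
    proof eventually_elim
      case (elim t)
      show ?case
      proof (intro impI allI leI notI)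
        fix z assume t: "0 < t" "t < T" and z: "norm z < \<rho> / (8 * E)"
          and gt: "e * \<rho> powr \<alpha> < \<bar>\<theta> t (hyp (G \<rho> t) z) - \<theta>0 z\<bar>"
        have hold: "holder_bound \<alpha> M (\<theta> t)" using elim(2) t T by auto
        let ?f = "\<lambda>z. \<bar>\<theta> t (hyp (G \<rho> t) z) - \<theta>0 z\<bar>"
        have "continuous_on UNIV ?f"
          by (intro continuous_intros holder_bound_continuous[OF init \<alpha>(1)]
              continuous_on_compose2[OF holder_bound_continuous[OF hold \<alpha>(1), of UNIV] continuous_on_hyp(2)]) auto
        then have "open {z. e * \<rho> powr \<alpha> < ?f z}" by (intro open_Collect_less continuous_on_const)
        then have "open ({z. e * \<rho> powr \<alpha> < ?f z} \<inter> ball 0 (\<rho> / (8 * E)))" by auto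
        moreover have "z \<in> {z. e * \<rho> powr \<alpha> < ?f z} \<inter> ball 0 (\<rho> / (8 * E))" using z gt by simp
        ultimately obtain d where "d \<in> D" "d \<in> {z. e * \<rho> powr \<alpha> < ?f z} \<inter> ball 0 (\<rho> / (8 * E))"
          using D(2) by blast
        then have "d \<in> D \<inter> ball 0 (\<rho> / (8 * E))" "e * \<rho> powr \<alpha> < ?f d" by auto
        then show False using bspec[OF elim(1), of d] t by linarith
      qed
    qed
  qed
  then show ?thesis using T0 by blast
qed

end

section \<open>Growth of the strain\<close>

lemma holder_odd_bound:
  assumes f: "odd_odd f" "holder_bound \<alpha> M f"
  shows "\<bar>f y\<bar> \<le> M * \<bar>y $ 1\<bar> powr \<alpha>" "\<bar>f y\<bar> \<le> M * \<bar>y $ 2\<bar> powr \<alpha>"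
proof -
  have n: "norm (y - vector [0, y $ 2]) = \<bar>y $ 1\<bar>" "norm (y - vector [y $ 1, 0]) = \<bar>y $ 2\<bar>"
    by (simp_all add: norm_vec_def L2_set_def sum_2)
  have "f (vector [0, y $ 2]) = 0" "f (vector [y $ 1, 0]) = 0"
    by (rule odd_oddD(4)[OF f(1)], simp, rule odd_oddD(5)[OF f(1)], simp)
  then show "\<bar>f y\<bar> \<le> M * \<bar>y $ 1\<bar> powr \<alpha>" "\<bar>f y\<bar> \<le> M * \<bar>y $ 2\<bar> powr \<alpha>"
    using holder_boundD(2)[OF f(2), of y "vector [0, y $ 2]"] holder_boundD(2)[OF f(2), of y "vector [y $ 1, 0]"] n
    by auto
qed

lemma AE_interval_witness:
  assumes "AE t in (lborel :: real measure). P t" and "a < b"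
  shows "\<exists>t. a < t \<and> t < b \<and> P t"
proof (rule ccontr)
  assume "\<not> ?thesis"
  then have "AE t in lborel. t \<notin> {a<..<b}" using assms(1) by (auto elim!: eventually_mono)
  then have "{a<..<b} \<in> null_sets lborel" by (subst AE_iff_null_sets) auto
  then show False using assms(2) by (simp add: null_sets_def)
qed

text \<open>The difference of two strains is the contribution of the annulus \<open>\<rho> < \<bar>y\<bar> \<le> 2 \<rho>\<close>. If \<open>f\<close> is within \<open>e\<close>
  of a function \<open>h\<close> with the sign of \<open>y\<^sub>1 y\<^sub>2\<close>, this contribution is bounded below by that of a square on
  which \<open>h \<ge> a\<close>, minus the integral of the error.\<close>

lemma strain_annulus_lower:
  assumes \<alpha>: "0 < \<alpha>" and \<rho>: "0 < \<rho>" and f: "holder_bound \<alpha> M f" and e: "0 \<le> e" and a: "0 \<le> a"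
    and close: "\<And>y. norm y \<le> 2 * \<rho> \<Longrightarrow> \<bar>f y - h y\<bar> \<le> e"
    and sgn: "\<And>y. norm y \<le> 2 * \<rho> \<Longrightarrow> 0 \<le> h y * (y $ 1 * y $ 2)"
    and low: "\<And>y. y \<in> cbox (vector [\<rho>, \<rho>]) (vector [6/5 * \<rho>, 6/5 * \<rho>]) \<Longrightarrow> a \<le> h y"
  shows "(2 + \<alpha>) * (a * \<rho>\<^sup>2 * (2 * \<rho>) powr (-4-\<alpha>) * (\<rho> / 5)\<^sup>2 - e * \<rho> powr (-2-\<alpha>) * (16 * \<rho>\<^sup>2))
    \<le> strain \<alpha> \<rho> f - strain \<alpha> (2 * \<rho>) f"
proof -
  define S where "S = cbox (vector [\<rho>, \<rho>]) (vector [6/5 * \<rho>, 6/5 * \<rho>] :: real^2)"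
  have [measurable]: "f \<in> borel_measurable borel"
    by (intro borel_measurable_continuous_onI holder_bound_continuous[OF f \<alpha>])
  have [measurable]: "S \<in> sets borel" unfolding S_def by (intro borel_closed closed_cbox)
  define F where "F = (\<lambda>y. f y * (y $ 1 * y $ 2) * norm y powr (-4-\<alpha>))"
  have int: "integrable lborel (\<lambda>y. indicat_real {y. s < norm y} y * F y)" if s: "0 < s" for s
  proof -
    have "integrable lborel (\<lambda>y::real^2. M * (indicat_real {y. s < norm y} y * norm y powr (-(2+\<alpha>))))"
      using tail_power_bound[of "2 + \<alpha>"] \<alpha> s by (intro integrable_mult_right) auto
    then show ?thesis
    proof (rule Bochner_Integration.integrable_bound)
      show "(\<lambda>y. indicat_real {y. s < norm y} y * F y) \<in> borel_measurable lborel" unfolding F_def by measurable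
      show "AE y in lborel. norm (indicat_real {y. s < norm y} y * F y)
          \<le> norm (M * (indicat_real {y. s < norm y} y * norm y powr (-(2+\<alpha>))))"
      proof (intro AE_I2)
        fix y
        show "norm (indicat_real {y. s < norm y} y * F y) \<le> norm (M * (indicat_real {y. s < norm y} y * norm y powr (-(2+\<alpha>))))"
          using strain_integrand_bound[of f y M \<alpha>] holder_boundD(1)[OF f, of y] holder_boundD(3)[OF f]
          by (auto simp: indicator_def F_def intro: order_trans[OF _ abs_ge_self])
      qed
    qed
  qed
  define A where "A = {y::real^2. \<rho> < norm y \<and> norm y \<le> 2 * \<rho>}"
  have split: "indicat_real A y * F y = indicat_real {y. \<rho> < norm y} y * F y - indicat_real {y. 2 * \<rho> < norm y} y * F y" for y
    using \<rho> by (auto simp: A_def indicator_def)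
  have intA: "integrable lborel (\<lambda>y. indicat_real A y * F y)"
    unfolding split using int[of \<rho>] int[of "2 * \<rho>"] \<rho> by auto
  have eq: "strain \<alpha> \<rho> f - strain \<alpha> (2 * \<rho>) f = (2 + \<alpha>) * (\<integral>y. indicat_real A y * F y \<partial>lborel)"
  proof -
    have "strain \<alpha> s f = (2 + \<alpha>) * (\<integral>y. indicat_real {y. s < norm y} y * F y \<partial>lborel)" for s
      by (simp add: strain_def F_def)
    then show ?thesis
      unfolding split using int[of \<rho>] int[of "2 * \<rho>"] \<rho> by (simp add: right_diff_distrib)
  qed
  have fin: "emeasure lborel S < \<infinity>" "emeasure lborel (cball (0::real^2) (2 * \<rho>)) < \<infinity>"
    unfolding S_def by (intro emeasure_bounded_finite bounded_cbox bounded_cball)+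
  then have iS: "integrable lborel (indicat_real S)" and iB: "integrable lborel (indicat_real (cball (0::real^2) (2 * \<rho>)))"
    by (intro integrable_real_indicator; simp)+
  have "vector [\<rho>, \<rho>] \<in> S" unfolding S_def using \<rho> by (auto simp: mem_box_cart forall_2)
  then have mS: "measure lborel S = (\<rho> / 5)\<^sup>2"
    unfolding S_def by (subst content_cbox_cart) (auto simp: UNIV_2 power2_eq_square field_simps)
  have mB: "measure lborel (cball (0::real^2) (2 * \<rho>)) \<le> 16 * \<rho>\<^sup>2"
  proof -
    have "measure lborel (cball (0::real^2) (2 * \<rho>)) = pi * (2 * \<rho>)\<^sup>2"
      using \<rho> content_cball[of "2 * \<rho>" "0::real^2"] by (simp add: unit_ball_vol_2)
    also have "\<dots> \<le> 4 * (2 * \<rho>)\<^sup>2" using pi_less_4 by (intro mult_right_mono) auto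
    finally show ?thesis by (simp add: power_mult_distrib)
  qed
  let ?a = "a * \<rho>\<^sup>2 * (2 * \<rho>) powr (-4-\<alpha>)" and ?e = "e * \<rho> powr (-2-\<alpha>)"
  have a0: "0 \<le> ?a" and e0: "0 \<le> ?e" using a e by auto
  have S_sub: "\<rho> < norm y \<and> norm y \<le> 2 * \<rho> \<and> \<rho>\<^sup>2 \<le> y $ 1 * y $ 2" if "y \<in> S" for y
  proof -
    have y: "\<rho> \<le> y $ 1" "y $ 1 \<le> 6/5 * \<rho>" "\<rho> \<le> y $ 2" "y $ 2 \<le> 6/5 * \<rho>"
      using that by (auto simp: S_def mem_box_cart forall_2)
    have l: "\<rho>\<^sup>2 \<le> (y $ 1)\<^sup>2" "\<rho>\<^sup>2 \<le> (y $ 2)\<^sup>2" "(y $ 1)\<^sup>2 \<le> (6/5 * \<rho>)\<^sup>2" "(y $ 2)\<^sup>2 \<le> (6/5 * \<rho>)\<^sup>2"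
      using y \<rho> by (auto intro!: power_mono)
    have p: "0 < \<rho>\<^sup>2" using \<rho> by simp
    have sq: "(6/5 * \<rho>)\<^sup>2 = 36/25 * \<rho>\<^sup>2" "(2 * \<rho>)\<^sup>2 = 4 * \<rho>\<^sup>2"
      by (simp_all add: power_mult_distrib power_divide)
    have "\<rho>\<^sup>2 < (norm y)\<^sup>2" "(norm y)\<^sup>2 \<le> (2 * \<rho>)\<^sup>2"
      using l p unfolding norm_real2 sq by linarith+
    then have "\<rho> < norm y" "norm y \<le> 2 * \<rho>"
      using \<rho> by (auto intro: power2_less_imp_less power2_le_imp_le)
    moreover have "\<rho>\<^sup>2 \<le> y $ 1 * y $ 2" unfolding power2_eq_square using y \<rho> by (intro mult_mono) auto
    ultimately show ?thesis by blast
  qed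
  have pointwise: "?a * indicat_real S y - ?e * indicat_real (cball 0 (2 * \<rho>)) y \<le> indicat_real A y * F y" for y
  proof (cases "y \<in> A")
    case True
    then have y: "\<rho> < norm y" "norm y \<le> 2 * \<rho>" by (auto simp: A_def)
    let ?n = "norm y powr (-4-\<alpha>)"
    have "\<bar>(f y - h y) * (y $ 1 * y $ 2) * ?n\<bar> \<le> e * norm y powr (-(2+\<alpha>))"
      by (rule strain_integrand_bound[where f="\<lambda>y. f y - h y"]) (rule close[OF y(2)])
    also have "\<dots> \<le> ?e" using e y \<rho> \<alpha> by (auto intro!: mult_left_mono powr_mono2')
    finally have 1: "- ?e \<le> (f y - h y) * (y $ 1 * y $ 2) * ?n" by linarith
    have 2: "?a * indicat_real S y \<le> h y * (y $ 1 * y $ 2) * ?n"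
    proof (cases "y \<in> S")
      case True
      have h: "a \<le> h y" and q: "\<rho>\<^sup>2 \<le> y $ 1 * y $ 2"
        using S_sub[OF True] low True by (auto simp: S_def)
      have "a * \<rho>\<^sup>2 \<le> h y * (y $ 1 * y $ 2)"
        using h q a by (intro mult_mono) auto
      moreover have "(2 * \<rho>) powr (-4-\<alpha>) \<le> ?n"
        using y \<rho> \<alpha> by (intro powr_mono2') auto
      ultimately have "a * \<rho>\<^sup>2 * (2 * \<rho>) powr (-4-\<alpha>) \<le> h y * (y $ 1 * y $ 2) * ?n"
        using sgn[OF y(2)] by (rule mult_mono) auto
      then show ?thesis using True by simp
    qed (use sgn[OF y(2)] in simp)
    have "F y = (f y - h y) * (y $ 1 * y $ 2) * ?n + h y * (y $ 1 * y $ 2) * ?n"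
      by (simp add: F_def algebra_simps)
    then show ?thesis using 1 2 True y by simp
  next
    case False
    then have "y \<notin> S" using S_sub[of y] by (auto simp: A_def)
    then show ?thesis using False e0 by simp
  qed
  have "?a * (\<rho> / 5)\<^sup>2 - ?e * (16 * \<rho>\<^sup>2) \<le> ?a * measure lborel S - ?e * measure lborel (cball (0::real^2) (2 * \<rho>))"
    unfolding mS by (rule diff_left_mono[OF mult_left_mono[OF mB e0]])
  also have "\<dots> = (\<integral>y. ?a * indicat_real S y - ?e * indicat_real (cball 0 (2 * \<rho>)) y \<partial>lborel)"
    using iS iB by simp
  also have "\<dots> \<le> (\<integral>y. indicat_real A y * F y \<partial>lborel)"
    by (rule integral_mono[OF _ intA pointwise]) (use iS iB in auto)
  finally have "?a * (\<rho> / 5)\<^sup>2 - ?e * (16 * \<rho>\<^sup>2) \<le> (\<integral>y. indicat_real A y * F y \<partial>lborel)" .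
  then show ?thesis unfolding eq using \<alpha> by (intro mult_left_mono) auto
qed

context holder_solution
begin

lemma G_continuous: "0 < \<rho> \<Longrightarrow> continuous_on {0..} (G \<rho>)"
proof -
  assume "0 < \<rho>"
  then obtain B where B: "0 \<le> B" "\<And>s t. 0 \<le> s \<Longrightarrow> s \<le> t \<Longrightarrow> \<bar>G \<rho> t - G \<rho> s\<bar> \<le> B * (t - s)"
    using G_Lipschitz by blast
  have "B-lipschitz_on {0..} (G \<rho>)"
  proof (rule lipschitz_onI)
    fix x y :: real assume "x \<in> {0..}" "y \<in> {0..}"
    then show "dist (G \<rho> x) (G \<rho> y) \<le> B * dist x y"
      using B(2)[of x y] B(2)[of y x] by (cases "x \<le> y") (auto simp: dist_real_def)
  qed (rule B(1))
  then show ?thesis by (rule lipschitz_on_continuous_on)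
qed

text \<open>At the first time when \<open>\<bar>G \<rho>\<bar>\<close> reaches \<open>g\<close>, tracking is still available. Shortly before, the value
  \<open>c (b \<rho>) powr \<alpha>\<close> of the datum at \<open>z = (b \<rho>, b \<rho>)\<close> has been carried to a point at distance at most
  \<open>k b \<rho>\<close> from one of the axes, where \<open>k = exp (1 - g)\<close>. The solution is at most a quarter of this value
  there, and the tracking error another quarter.\<close>

lemma deformation_bounded:
  assumes c: "0 < c" and profile: "\<And>x. norm x \<le> 1 \<Longrightarrow> \<theta>0 x = c * (sgn (x $ 1 * x $ 2) * (min \<bar>x $ 1\<bar> \<bar>x $ 2\<bar>) powr \<alpha>)"
  shows "\<exists>g>0. \<exists>T0>0. T0 < \<delta> \<and> (\<forall>\<rho>. 0 < \<rho> \<longrightarrow> \<rho> \<le> 1 \<longrightarrow> (\<forall>t\<in>{0..T0}. \<bar>G \<rho> t\<bar> \<le> g))"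
proof -
  obtain k where k: "0 < k" "k \<le> 1" "M * k powr \<alpha> \<le> c / 4"
    using powr_small[of \<alpha> "c / 4" M] \<alpha> c M by auto
  define g where "g = 1 + ln (1 / k)"
  have g: "1 \<le> g" using k by (simp add: g_def)
  have kg: "exp (- (g - 1)) = k" using k by (simp add: g_def exp_minus)
  define E where "E = exp (g + 1)"
  have E: "1 \<le> E" using g by (simp add: E_def)
  define b where "b = 1 / (32 * E)"
  have b: "0 < b" "b \<le> 1 / 32" using E by (auto simp: b_def field_simps)
  define e where "e = c / 4 * b powr \<alpha>"
  have e: "0 < e" using c b by (simp add: e_def)
  obtain T1 where T1: "0 < T1" and track: "\<And>\<rho> T. 0 < \<rho> \<Longrightarrow> 0 < T \<Longrightarrow> T \<le> T1 \<Longrightarrow> T < \<delta> \<Longrightarrow> \<forall>t\<in>{0..T}. \<bar>G \<rho> t\<bar> \<le> g \<Longrightarrow>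
    AE t in lborel. 0 < t \<longrightarrow> t < T \<longrightarrow> (\<forall>z. norm z < \<rho> / (8 * E) \<longrightarrow> \<bar>\<theta> t (hyp (G \<rho> t) z) - \<theta>0 z\<bar> \<le> e * \<rho> powr \<alpha>)"
    using tracking[OF e E_def] by blast
  define T0 where "T0 = min T1 (\<delta> / 2)"
  have T0: "0 < T0" "T0 \<le> T1" "T0 < \<delta>" using T1 \<delta> by (auto simp: T0_def)
  have "\<bar>G \<rho> t1\<bar> \<le> g" if \<rho>: "0 < \<rho>" "\<rho> \<le> 1" and t1: "t1 \<in> {0..T0}" for \<rho> t1
  proof (rule ccontr)
    assume "\<not> \<bar>G \<rho> t1\<bar> \<le> g"
    then have big: "g < \<bar>G \<rho> t1\<bar>" by simp
    have cont: "continuous_on {0..t} (\<lambda>s. \<bar>G \<rho> s\<bar>)" for t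
      by (intro continuous_intros continuous_on_subset[OF G_continuous[OF \<rho>(1)]]) auto
    define S where "S = {0..t1} \<inter> (\<lambda>s. \<bar>G \<rho> s\<bar>) -` {g..}"
    have "closed S" unfolding S_def
      by (rule continuous_closed_preimage[OF cont]) auto
    then have "compact ({0..t1} \<inter> S)" by (intro compact_Int_closed compact_Icc)
    moreover have "{0..t1} \<inter> S = S" by (auto simp: S_def)
    ultimately have "compact S" by simp
    moreover have "t1 \<in> S" using big t1 by (auto simp: S_def)
    ultimately obtain T where T: "T \<in> S" "\<And>s. s \<in> S \<Longrightarrow> T \<le> s"
      using compact_attains_inf[of S] by blast
    have Tr: "0 \<le> T" "T \<le> t1" "g \<le> \<bar>G \<rho> T\<bar>" using T(1) by (auto simp: S_def)
    then have Tpos: "0 < T" using g by (cases "T = 0") auto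
    have before: "\<bar>G \<rho> s\<bar> < g" if "0 \<le> s" "s < T" for s
      using T(2)[of s] that Tr by (force simp: S_def)
    have "\<bar>G \<rho> T\<bar> \<le> g"
    proof (rule ccontr)
      assume n: "\<not> \<bar>G \<rho> T\<bar> \<le> g"
      obtain s where s: "0 \<le> s" "s \<le> T" "\<bar>G \<rho> s\<bar> = g"
        using IVT'[of "\<lambda>s. \<bar>G \<rho> s\<bar>" 0 g T] g Tr cont by auto
      then show False using before[of s] n by (cases "s = T") auto
    qed
    then have bd: "\<forall>t\<in>{0..T}. \<bar>G \<rho> t\<bar> \<le> g" using before by (force simp: le_less)
    obtain B where B: "0 \<le> B" "\<And>s t. 0 \<le> s \<Longrightarrow> s \<le> t \<Longrightarrow> \<bar>G \<rho> t - G \<rho> s\<bar> \<le> B * (t - s)"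
      using G_Lipschitz[OF \<rho>(1)] by blast
    define s0 where "s0 = max 0 (T - 1 / (B + 1))"
    have s0: "0 \<le> s0" "s0 < T" using Tpos B(1) by (auto simp: s0_def)
    have TT: "T \<le> T1" "T < \<delta>" using Tr t1 T0 by auto
    have "AE t in lborel. (0 < t \<longrightarrow> t < T \<longrightarrow> (\<forall>z. norm z < \<rho> / (8 * E) \<longrightarrow> \<bar>\<theta> t (hyp (G \<rho> t) z) - \<theta>0 z\<bar> \<le> e * \<rho> powr \<alpha>))
        \<and> (t \<in> {0..\<delta>} \<longrightarrow> odd_odd (\<theta> t) \<and> holder_bound \<alpha> M (\<theta> t))"
      using track[OF \<rho>(1) Tpos TT bd] slices by eventually_elim auto
    from AE_interval_witness[OF this s0(2)] obtain t where t: "s0 < t" "t < T"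
      and tr: "0 < t \<longrightarrow> t < T \<longrightarrow> (\<forall>z. norm z < \<rho> / (8 * E) \<longrightarrow> \<bar>\<theta> t (hyp (G \<rho> t) z) - \<theta>0 z\<bar> \<le> e * \<rho> powr \<alpha>)"
      and oh: "t \<in> {0..\<delta>} \<longrightarrow> odd_odd (\<theta> t) \<and> holder_bound \<alpha> M (\<theta> t)"
      by blast
    have hold: "odd_odd (\<theta> t)" "holder_bound \<alpha> M (\<theta> t)" using oh t s0 TT by auto
    have "\<bar>G \<rho> T - G \<rho> t\<bar> \<le> B * (T - t)" using B(2)[of t T] t s0 by auto
    also have "\<dots> \<le> B * (1 / (B + 1))"
    proof (rule mult_left_mono[OF _ B(1)])
      have "T - 1 / (B + 1) \<le> s0" by (simp add: s0_def)
      then show "T - t \<le> 1 / (B + 1)" using t by linarith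
    qed
    also have "\<dots> \<le> 1" using B(1) by (simp add: field_simps)
    finally have large: "g - 1 \<le> \<bar>G \<rho> t\<bar>" using Tr(3) by linarith
    define z where "z = (vector [b * \<rho>, b * \<rho>] :: real^2)"
    have b\<rho>: "0 < b * \<rho>" using b \<rho> by simp
    have nz: "norm z \<le> 2 * (b * \<rho>)" using norm_le_abs_sum[of z] b\<rho> unfolding z_def vector_2 by linarith
    also have "\<dots> < \<rho> / (8 * E)" using \<rho> E by (simp add: b_def field_simps)
    finally have z1: "norm z < \<rho> / (8 * E)" .
    have "b * \<rho> \<le> (1/32) * 1" using b \<rho> by (intro mult_mono) auto
    then have "norm z \<le> 1" using nz by linarith
    then have z2: "\<theta>0 z = c * (b * \<rho>) powr \<alpha>" using b\<rho> profile[of z] by (simp add: z_def)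
    have "\<bar>\<theta> t (hyp (G \<rho> t) z)\<bar> \<le> M * (k * (b * \<rho>)) powr \<alpha>"
    proof (cases "0 \<le> G \<rho> t")
      case True
      then have "exp (- G \<rho> t) \<le> exp (- (g - 1))" using large by simp
      then have "exp (- G \<rho> t) \<le> k" unfolding kg .
      then have "\<bar>hyp (G \<rho> t) z $ 2\<bar> \<le> k * (b * \<rho>)" using b \<rho> by (simp add: z_def abs_mult mult_right_mono)
      then show ?thesis
        using M \<alpha> by (intro order_trans[OF holder_odd_bound(2)[OF hold]] mult_left_mono powr_mono2) auto
    next
      case False
      then have "exp (G \<rho> t) \<le> exp (- (g - 1))" using large by simp
      then have "exp (G \<rho> t) \<le> k" unfolding kg .
      then have "\<bar>hyp (G \<rho> t) z $ 1\<bar> \<le> k * (b * \<rho>)" using b \<rho> by (simp add: z_def abs_mult mult_right_mono)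
      then show ?thesis
        using M \<alpha> by (intro order_trans[OF holder_odd_bound(1)[OF hold]] mult_left_mono powr_mono2) auto
    qed
    also have "\<dots> = (M * k powr \<alpha>) * (b * \<rho>) powr \<alpha>" using k b\<rho> by (simp add: powr_mult)
    also have "\<dots> \<le> c / 4 * (b * \<rho>) powr \<alpha>" using k(3) by (intro mult_right_mono) auto
    finally have 1: "\<bar>\<theta> t (hyp (G \<rho> t) z)\<bar> \<le> c / 4 * (b * \<rho>) powr \<alpha>" .
    have 2: "\<bar>\<theta> t (hyp (G \<rho> t) z) - \<theta>0 z\<bar> \<le> e * \<rho> powr \<alpha>" using tr t s0 z1 by auto
    have 3: "e * \<rho> powr \<alpha> = c / 4 * (b * \<rho>) powr \<alpha>" using b \<rho> by (simp add: e_def powr_mult)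
    have "0 < c * (b * \<rho>) powr \<alpha>" using c b \<rho> by (intro mult_pos_pos) auto
    then show False using 1 2 3 z2 by linarith
  qed
  then show ?thesis using g T0 by (intro exI[of _ g] conjI exI[of _ T0]) auto
qed

text \<open>Tracking at the larger scale \<open>K \<rho>\<close> covers the annulus around \<open>\<rho>\<close>, since \<open>K = 32 E\<^sup>2\<close> absorbs the
  deformation by factors up to \<open>E\<close>. There the solution is close to the datum composed with a
  hyperbolic map, which keeps the sign of \<open>y\<^sub>1 y\<^sub>2\<close> and on the square
  \<open>[\<rho>, 6\<rho>/5]\<^sup>2\<close> is at least \<open>c (\<rho>/E) powr \<alpha>\<close>. By homogeneity the resulting gain does not depend on \<open>\<rho>\<close>;
  the tracking accuracy \<open>e\<close> is chosen to lose at most half of it.\<close>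

lemma strain_increment:
  assumes c: "0 < c" and profile: "\<And>x. norm x \<le> 1 \<Longrightarrow> \<theta>0 x = c * (sgn (x $ 1 * x $ 2) * (min \<bar>x $ 1\<bar> \<bar>x $ 2\<bar>) powr \<alpha>)"
    and T0: "0 < T0" "T0 < \<delta>" and G: "\<And>\<rho> t. 0 < \<rho> \<Longrightarrow> \<rho> \<le> 1 \<Longrightarrow> t \<in> {0..T0} \<Longrightarrow> \<bar>G \<rho> t\<bar> \<le> g" and g: "0 < g"
  shows "\<exists>c1>0. \<exists>T>0. \<exists>\<rho>0>0. T \<le> T0 \<and> \<rho>0 \<le> 1 \<and> (\<forall>\<rho>. 0 < \<rho> \<longrightarrow> \<rho> \<le> \<rho>0 \<longrightarrow>
     (AE t in lborel. 0 < t \<longrightarrow> t < T \<longrightarrow> L (2 * \<rho>) t + c1 \<le> L \<rho> t))"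
proof -
  define E where "E = exp (g + 1)"
  have E: "1 \<le> E" using g by (simp add: E_def)
  define K where "K = 32 * E\<^sup>2"
  have E2: "E \<le> E\<^sup>2" "1 \<le> E\<^sup>2" 
    using E mult_mono[of 1 E 1 E] mult_left_mono[of 1 E E] by (auto simp: power2_eq_square)
  have K: "1 \<le> K" "2 * E \<le> K" using E2 by (auto simp: K_def)
  define a where "a = c * (1 / E) powr \<alpha> * 2 powr (-4-\<alpha>) / 25"
  have a: "0 < a" using c E by (simp add: a_def)
  define e where "e = a / (32 * K powr \<alpha>)"
  have e: "0 < e" using a K by (simp add: e_def)
  obtain T1 where T1: "0 < T1" and track: "\<And>\<rho> T. 0 < \<rho> \<Longrightarrow> 0 < T \<Longrightarrow> T \<le> T1 \<Longrightarrow> T < \<delta> \<Longrightarrow> \<forall>t\<in>{0..T}. \<bar>G \<rho> t\<bar> \<le> g \<Longrightarrow>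
    AE t in lborel. 0 < t \<longrightarrow> t < T \<longrightarrow> (\<forall>z. norm z < \<rho> / (8 * E) \<longrightarrow> \<bar>\<theta> t (hyp (G \<rho> t) z) - \<theta>0 z\<bar> \<le> e * \<rho> powr \<alpha>)"
    using tracking[OF e E_def] by blast
  define T where "T = min T0 T1"
  have T: "0 < T" "T \<le> T0" "T \<le> T1" "T < \<delta>" using T0 T1 by (auto simp: T_def)
  define c1 where "c1 = (2 + \<alpha>) * (a / 2)"
  have c1: "0 < c1" using a \<alpha> by (simp add: c1_def)
  have "AE t in lborel. 0 < t \<longrightarrow> t < T \<longrightarrow> L (2 * \<rho>) t + c1 \<le> L \<rho> t" if \<rho>: "0 < \<rho>" "\<rho> \<le> 1 / K" for \<rho>
  proof -
    have K\<rho>: "0 < K * \<rho>" "K * \<rho> \<le> 1" using \<rho> K by (auto simp: field_simps)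
    have bd: "\<forall>t\<in>{0..T}. \<bar>G (K * \<rho>) t\<bar> \<le> g" using G[OF K\<rho>] T by auto
    show ?thesis
      using track[OF K\<rho>(1) T(1,3,4) bd] slices slices_L
    proof eventually_elim
      case (elim t)
      show ?case
      proof (intro impI)
        assume t: "0 < t" "t < T"
        then have t\<delta>: "t \<in> {0..\<delta>}" and tT: "t \<in> {0..T}" using T by auto
        have hold: "holder_bound \<alpha> M (\<theta> t)" and Leq: "\<And>\<rho>. strain \<alpha> \<rho> (\<theta> t) = L \<rho> t"
          using elim(2,3) t\<delta> by auto
        define \<gamma> where "\<gamma> = G (K * \<rho>) t"
        have \<gamma>: "\<bar>\<gamma>\<bar> \<le> g" using bd tT by (simp add: \<gamma>_def)
        have ex: "exp \<bar>- \<gamma>\<bar> \<le> E" "1 / E \<le> exp \<gamma>" "1 / E \<le> exp (- \<gamma>)"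
          using \<gamma> by (auto simp: E_def exp_minus[symmetric] inverse_eq_divide[symmetric])
        define h where "h = (\<lambda>y. \<theta>0 (hyp (- \<gamma>) y))"
        have small: "norm (hyp (- \<gamma>) y) \<le> 2 * E * \<rho>" if "norm y \<le> 2 * \<rho>" for y
        proof -
          have "exp \<bar>- \<gamma>\<bar> * norm y \<le> E * (2 * \<rho>)" using ex that E by (intro mult_mono) auto
          then show ?thesis using norm_hyp_le[of "- \<gamma>" y] by linarith
        qed
        have h_eq: "h y = c * (sgn (y $ 1 * y $ 2) * (min (exp (- \<gamma>) * \<bar>y $ 1\<bar>) (exp \<gamma> * \<bar>y $ 2\<bar>)) powr \<alpha>)"
          if "norm y \<le> 2 * \<rho>" for y
        proof -
          have "2 * E * \<rho> \<le> K * \<rho>" using K \<rho> by (intro mult_right_mono) auto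
          then have "norm (hyp (- \<gamma>) y) \<le> 1" using small[OF that] K\<rho> by linarith
          then show ?thesis unfolding h_def by (subst profile) (simp_all add: sgn_mult abs_mult)
        qed
        have lower: "(2 + \<alpha>) * ((c * (\<rho> / E) powr \<alpha>) * \<rho>\<^sup>2 * (2 * \<rho>) powr (-4-\<alpha>) * (\<rho> / 5)\<^sup>2
            - (e * (K * \<rho>) powr \<alpha>) * \<rho> powr (-2-\<alpha>) * (16 * \<rho>\<^sup>2)) \<le> strain \<alpha> \<rho> (\<theta> t) - strain \<alpha> (2 * \<rho>) (\<theta> t)"
        proof (rule strain_annulus_lower[OF \<alpha>(1) \<rho>(1) hold, where h=h])
          show "0 \<le> e * (K * \<rho>) powr \<alpha>" "0 \<le> c * (\<rho> / E) powr \<alpha>" using e c by auto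
          fix y :: "real^2"
          show "\<bar>\<theta> t y - h y\<bar> \<le> e * (K * \<rho>) powr \<alpha>" if y: "norm y \<le> 2 * \<rho>"
          proof -
            have "2 * E * \<rho> < K * \<rho> / (8 * E)"
              using E \<rho> by (simp add: K_def power2_eq_square field_simps)
            then have "norm (hyp (- \<gamma>) y) < K * \<rho> / (8 * E)" using small[OF y] by linarith
            then have "\<bar>\<theta> t (hyp \<gamma> (hyp (- \<gamma>) y)) - \<theta>0 (hyp (- \<gamma>) y)\<bar> \<le> e * (K * \<rho>) powr \<alpha>"
              using elim(1) t unfolding \<gamma>_def by blast
            then show ?thesis by (simp add: hyp_inverse h_def)
          qed
          show "0 \<le> h y * (y $ 1 * y $ 2)" if y: "norm y \<le> 2 * \<rho>"
          proof -
            have "h y * (y $ 1 * y $ 2) = c * (sgn (y $ 1 * y $ 2) * (y $ 1 * y $ 2)) * (min (exp (- \<gamma>) * \<bar>y $ 1\<bar>) (exp \<gamma> * \<bar>y $ 2\<bar>)) powr \<alpha>"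
              unfolding h_eq[OF y] by simp
            also have "sgn (y $ 1 * y $ 2) * (y $ 1 * y $ 2) = \<bar>y $ 1 * y $ 2\<bar>" by (simp add: sgn_mult_self_eq abs_sgn mult.commute)
            finally show ?thesis using c by simp
          qed
          show "c * (\<rho> / E) powr \<alpha> \<le> h y" if "y \<in> cbox (vector [\<rho>, \<rho>]) (vector [6/5 * \<rho>, 6/5 * \<rho>])"
          proof -
            have y: "\<rho> \<le> y $ 1" "y $ 1 \<le> 6/5 * \<rho>" "\<rho> \<le> y $ 2" "y $ 2 \<le> 6/5 * \<rho>"
              using that by (auto simp: mem_box_cart forall_2)
            have "(norm y)\<^sup>2 \<le> (6/5 * \<rho>)\<^sup>2 + (6/5 * \<rho>)\<^sup>2"
              unfolding norm_real2 using y \<rho> by (intro add_mono power_mono) auto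
            also have "\<dots> \<le> (2 * \<rho>)\<^sup>2" by (simp add: power2_eq_square)
            finally have ny: "norm y \<le> 2 * \<rho>" using \<rho> by (auto intro: power2_le_imp_le)
            have "1 / E * \<rho> \<le> exp (- \<gamma>) * \<bar>y $ 1\<bar>" "1 / E * \<rho> \<le> exp \<gamma> * \<bar>y $ 2\<bar>"
              using y \<rho> E by (intro mult_mono ex; simp)+
            then have "(\<rho> / E) powr \<alpha> \<le> (min (exp (- \<gamma>) * \<bar>y $ 1\<bar>) (exp \<gamma> * \<bar>y $ 2\<bar>)) powr \<alpha>"
              using \<rho> E \<alpha> by (intro powr_mono2) auto
            moreover have "sgn (y $ 1 * y $ 2) = 1" using y \<rho> by (auto simp: sgn_mult)
            ultimately show ?thesis unfolding h_eq[OF ny] using c by simp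
          qed
        qed
        have e1: "(c * (\<rho> / E) powr \<alpha>) * \<rho>\<^sup>2 * (2 * \<rho>) powr (-4-\<alpha>) * (\<rho> / 5)\<^sup>2 = a"
        proof -
          have "(\<rho> / E) powr \<alpha> = (1 / E) powr \<alpha> * \<rho> powr \<alpha>"
            using powr_mult[of "1 / E" \<rho> \<alpha>] \<rho> E by simp
          then have i1: "(c * (\<rho> / E) powr \<alpha>) = c * ((1 / E) powr \<alpha> * \<rho> powr \<alpha>)" by simp
          have i2: "(2 * \<rho>) powr (-4-\<alpha>) = 2 powr (-4-\<alpha>) * \<rho> powr (-4-\<alpha>)" using \<rho> by (simp add: powr_mult)
          have i3: "\<rho> powr \<alpha> * \<rho> powr (-4-\<alpha>) * (\<rho>\<^sup>2 * \<rho>\<^sup>2) = 1"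
          proof -
            have "\<rho>\<^sup>2 * \<rho>\<^sup>2 = \<rho> powr 4" using \<rho> by (simp add: powr_numeral power_add[symmetric])
            moreover have "\<rho> powr \<alpha> * \<rho> powr (-4-\<alpha>) * \<rho> powr 4 = \<rho> powr (\<alpha> + (-4-\<alpha>) + 4)"
              by (simp only: powr_add)
            ultimately show ?thesis using \<rho> by simp
          qed
          have i4: "(c * (x * r1)) * \<rho>\<^sup>2 * (y * r2) * (\<rho> / 5)\<^sup>2 = c * x * y / 25 * (r1 * r2 * (\<rho>\<^sup>2 * \<rho>\<^sup>2))" for x y r1 r2
            by (simp add: power2_eq_square)
          show ?thesis unfolding i1 i2 i4 i3 a_def by simp
        qed
        have e2: "(e * (K * \<rho>) powr \<alpha>) * \<rho> powr (-2-\<alpha>) * (16 * \<rho>\<^sup>2) = a / 2"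
        proof -
          have "(K * \<rho>) powr \<alpha> = K powr \<alpha> * \<rho> powr \<alpha>" using \<rho> K by (simp add: powr_mult)
          moreover have "\<rho> powr \<alpha> * \<rho> powr (-2-\<alpha>) * \<rho>\<^sup>2 = 1"
          proof -
            have "\<rho>\<^sup>2 = \<rho> powr 2" using \<rho> by (simp add: powr_numeral)
            moreover have "\<rho> powr \<alpha> * \<rho> powr (-2-\<alpha>) * \<rho> powr 2 = \<rho> powr (\<alpha> + (-2-\<alpha>) + 2)"
              by (simp only: powr_add)
            ultimately show ?thesis using \<rho> by simp
          qed
          moreover have "(e * (k * r1)) * r2 * (16 * \<rho>\<^sup>2) = e * k * 16 * (r1 * r2 * \<rho>\<^sup>2)" for k r1 r2
            by simp
          ultimately have "(e * (K * \<rho>) powr \<alpha>) * \<rho> powr (-2-\<alpha>) * (16 * \<rho>\<^sup>2) = e * K powr \<alpha> * 16" by simp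
          also have "\<dots> = a / 2" using K by (simp add: e_def)
          finally show ?thesis .
        qed
        show "L (2 * \<rho>) t + c1 \<le> L \<rho> t"
          using lower unfolding e1 e2 Leq by (simp add: c1_def)
      qed
    qed
  qed
  moreover have "0 < 1 / K" "1 / K \<le> 1" using K by auto
  ultimately show ?thesis using c1 T by blast
qed

text \<open>The rate of strain grows at least linearly in the number of dyadic scales, which contradicts the uniform
  bound on its time integral.\<close>

lemma no_holder_solution:
  assumes c: "0 < c" and profile: "\<And>x. norm x \<le> 1 \<Longrightarrow> \<theta>0 x = c * (sgn (x $ 1 * x $ 2) * (min \<bar>x $ 1\<bar> \<bar>x $ 2\<bar>) powr \<alpha>)"
  shows False
proof -
  obtain g T0 where g: "0 < g" and T0: "0 < T0" "T0 < \<delta>"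
    and G: "\<And>\<rho> t. 0 < \<rho> \<Longrightarrow> \<rho> \<le> 1 \<Longrightarrow> t \<in> {0..T0} \<Longrightarrow> \<bar>G \<rho> t\<bar> \<le> g"
    using deformation_bounded[OF c profile] by blast
  obtain c1 T \<rho>0 where c1: "0 < c1" and T: "0 < T" "T \<le> T0" and \<rho>0: "0 < \<rho>0" "\<rho>0 \<le> 1"
    and inc: "\<And>\<rho>. 0 < \<rho> \<Longrightarrow> \<rho> \<le> \<rho>0 \<Longrightarrow> AE t in lborel. 0 < t \<longrightarrow> t < T \<longrightarrow> L (2 * \<rho>) t + c1 \<le> L \<rho> t"
    using strain_increment[OF c profile T0 G g] by blast
  obtain B where B: "0 \<le> B" "\<And>t. \<bar>L \<rho>0 t\<bar> \<le> B" using L_bounded[OF \<rho>0(1)] by blast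
  have iter: "AE t in lborel. 0 < t \<longrightarrow> t < T \<longrightarrow> real n * c1 - B \<le> L (\<rho>0 / 2 ^ n) t" for n
  proof (induction n)
    case 0
    have "- B \<le> L \<rho>0 t" for t using B(2)[of t] by (simp add: abs_le_iff)
    then show ?case by simp
  next
    case (Suc n)
    have "(1::real) \<le> 2 ^ Suc n" by (rule one_le_power) simp
    then have "0 < \<rho>0 / 2 ^ Suc n" "\<rho>0 / 2 ^ Suc n \<le> \<rho>0"
      using \<rho>0 divide_left_mono[of 1 "2 ^ Suc n" \<rho>0] by auto
    from inc[OF this] Suc show ?case
    proof eventually_elim
      case (elim t)
      then show ?case by (auto simp: algebra_simps)
    qed
  qed
  obtain n :: nat where n: "(g + 1) / T + B < real n * c1"
    using reals_Archimedean3[OF c1] by blast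
  define \<rho> where "\<rho> = \<rho>0 / 2 ^ n"
  have "(1::real) \<le> 2 ^ n" by (rule one_le_power) simp
  then have \<rho>: "0 < \<rho>" "\<rho> \<le> 1"
    using \<rho>0 divide_left_mono[of 1 "2 ^ n" \<rho>0] unfolding \<rho>_def by (auto simp del: divide_le_eq_1_pos)
  have "(\<integral>t. (real n * c1 - B) * indicat_real {0..T} t \<partial>lborel) \<le> G \<rho> T"
    unfolding G_def set_lebesgue_integral_def
  proof (rule integral_mono_AE)
    show "integrable lborel (\<lambda>t. indicat_real {0..T} t *\<^sub>R L \<rho> t)"
      using L_set_integrable[OF \<rho>(1)] by (simp add: set_integrable_def)
    show "AE t in lborel. (real n * c1 - B) * indicat_real {0..T} t \<le> indicat_real {0..T} t *\<^sub>R L \<rho> t"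
      using iter[of n] AE_lborel_singleton[of 0] AE_lborel_singleton[of T]
      by eventually_elim (auto simp: indicator_def \<rho>_def)
  qed simp
  then have "(real n * c1 - B) * T \<le> G \<rho> T" using T by simp
  moreover have "\<bar>G \<rho> T\<bar> \<le> g" by (rule G[OF \<rho>]) (use T in auto)
  moreover have "g + 1 < (real n * c1 - B) * T"
    using n T by (simp add: field_simps)
  ultimately show False by linarith
qed

end

section \<open>The initial datum\<close>

lemma powr_subadditive:
  assumes "0 \<le> (a::real)" "0 \<le> b" "0 < \<alpha>" "\<alpha> \<le> 1"
  shows "(a + b) powr \<alpha> \<le> a powr \<alpha> + b powr \<alpha>"
proof (cases "a + b = 0")
  case False
  define s where "s = a + b"
  have s: "0 < s" using False assms by (simp add: s_def)
  have "x / s \<le> (x / s) powr \<alpha>" if "0 \<le> x" "x \<le> s" for x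
  proof (cases "x = 0")
    case False
    then have "(x / s) powr 1 \<le> (x / s) powr \<alpha>" using that s assms by (intro powr_mono') auto
    then show ?thesis using that s by simp
  qed simp
  from this[of a] this[of b] have "a / s + b / s \<le> (a / s) powr \<alpha> + (b / s) powr \<alpha>"
    using assms by (simp add: s_def)
  moreover have "a / s + b / s = 1" using s by (simp add: s_def add_divide_distrib[symmetric])
  ultimately have "1 \<le> (a powr \<alpha> + b powr \<alpha>) / s powr \<alpha>"
    using assms s by (simp add: powr_divide add_divide_distrib)
  then show ?thesis using s by (simp add: s_def[symmetric] le_divide_eq)
qed simp

lemma powr_diff_le:
  assumes "0 \<le> (a::real)" "0 \<le> b" "0 < \<alpha>" "\<alpha> \<le> 1"
  shows "\<bar>a powr \<alpha> - b powr \<alpha>\<bar> \<le> \<bar>a - b\<bar> powr \<alpha>"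
proof (cases "a \<le> b")
  case True
  then show ?thesis
    using powr_subadditive[of a "b - a" \<alpha>] assms powr_mono2[of \<alpha> a b] by auto
next
  case False
  then show ?thesis
    using powr_subadditive[of b "a - b" \<alpha>] assms powr_mono2[of \<alpha> b a] by auto
qed

text \<open>The factor \<open>max 0 (2 - \<bar>x\<bar>)\<close> cuts off at radius \<open>2\<close> and is inactive in the unit ball. As a minimum of
  1-Lipschitz functions the height is 1-Lipschitz, so its power \<open>\<alpha>\<close> is Hoelder continuous.\<close>

definition tent :: "real^2 \<Rightarrow> real" where
  "tent x = min (min \<bar>x $ 1\<bar> \<bar>x $ 2\<bar>) (max 0 (2 - norm x))"

definition datum :: "real \<Rightarrow> real \<Rightarrow> real^2 \<Rightarrow> real" where
  "datum \<alpha> c x = c * (sgn (x $ 1 * x $ 2) * tent x powr \<alpha>)"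

lemma tent_bounds: "0 \<le> tent x" "tent x \<le> 2" "tent x \<le> \<bar>x $ 1\<bar>" "tent x \<le> \<bar>x $ 2\<bar>"
  by (auto simp: tent_def min_le_iff_disj)

lemma tent_Lipschitz: "\<bar>tent x - tent y\<bar> \<le> norm (x - y)"
proof -
  have c: "\<bar>\<bar>x $ i\<bar> - \<bar>y $ i\<bar>\<bar> \<le> norm (x - y)" for i
    using component_le_norm_cart[of "x - y" i] abs_triangle_ineq3[of "x $ i" "y $ i"] by simp
  have m: "\<bar>min a b - min a' b'\<bar> \<le> e" if "\<bar>a - a'\<bar> \<le> e" "\<bar>b - b'\<bar> \<le> e" for a a' b b' e :: real
    using that by linarith
  have "\<bar>norm x - norm y\<bar> \<le> norm (x - y)" by (rule norm_triangle_ineq3)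
  then have "\<bar>max 0 (2 - norm x) - max 0 (2 - norm y)\<bar> \<le> norm (x - y)" by linarith
  then show ?thesis unfolding tent_def by (intro m c)
qed

lemma datum_odd: "odd_odd (datum \<alpha> c)"
proof -
  have n: "norm (vector [a, - b] :: real^2) = norm (vector [a, b] :: real^2)"
    "norm (vector [- a, b] :: real^2) = norm (vector [a, b] :: real^2)" for a b
    by (simp_all add: norm_vec_def L2_set_def sum_2)
  then show ?thesis by (simp add: odd_odd_def datum_def tent_def sgn_mult)
qed

text \<open>If the signs at \<open>x\<close> and \<open>y\<close> are opposite, one of the axes separates the two points, so both heights are
  at most \<open>\<bar>x - y\<bar>\<close>; otherwise the difference of the
  powers of the heights is bounded by the power of their difference.\<close>

lemma datum_holder:
  assumes \<alpha>: "0 < \<alpha>" "\<alpha> < 1" and c: "0 < c"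
  shows "holder_bound \<alpha> (2 * c) (datum \<alpha> c)"
  unfolding holder_bound_def
proof (intro conjI allI)
  have s1: "\<bar>sgn t\<bar> \<le> 1" for t :: real by (simp add: sgn_if)
  fix x y :: "real^2"
  have "tent x powr \<alpha> \<le> 2 powr \<alpha>" using tent_bounds \<alpha> by (intro powr_mono2) auto
  also have "\<dots> \<le> 2 powr 1" using \<alpha> by (intro powr_mono) auto
  finally have "\<bar>sgn (x $ 1 * x $ 2)\<bar> * tent x powr \<alpha> \<le> 1 * 2" by (intro mult_mono s1) auto
  then show "\<bar>datum \<alpha> c x\<bar> \<le> 2 * c" using c by (simp add: datum_def abs_mult)
  let ?s = "sgn (x $ 1 * x $ 2)" and ?t = "sgn (y $ 1 * y $ 2)"
  have "\<bar>?s * tent x powr \<alpha> - ?t * tent y powr \<alpha>\<bar> \<le> 2 * norm (x - y) powr \<alpha>"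
  proof (cases "?s * ?t = -1")
    case True
    then have "(x $ 1 * x $ 2) * (y $ 1 * y $ 2) < 0"
      by (simp only: sgn_mult[symmetric] sgn_1_neg)
    then have "(x $ 1 * y $ 1) * (x $ 2 * y $ 2) < 0" by (simp add: mult_ac)
    then consider "x $ 1 * y $ 1 < 0" | "x $ 2 * y $ 2 < 0" by (auto simp: mult_less_0_iff)
    then have sum: "tent x \<le> norm (x - y) \<and> tent y \<le> norm (x - y)"
    proof cases
      case 1
      then have "\<bar>x $ 1\<bar> \<le> \<bar>(x - y) $ 1\<bar>" "\<bar>y $ 1\<bar> \<le> \<bar>(x - y) $ 1\<bar>" by (auto simp: mult_less_0_iff)
      then show ?thesis using tent_bounds(3)[of x] tent_bounds(3)[of y] component_le_norm_cart[of "x - y" 1] by linarith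
    next
      case 2
      then have "\<bar>x $ 2\<bar> \<le> \<bar>(x - y) $ 2\<bar>" "\<bar>y $ 2\<bar> \<le> \<bar>(x - y) $ 2\<bar>" by (auto simp: mult_less_0_iff)
      then show ?thesis using tent_bounds(4)[of x] tent_bounds(4)[of y] component_le_norm_cart[of "x - y" 2] by linarith
    qed
    have "\<bar>?s * tent x powr \<alpha> - ?t * tent y powr \<alpha>\<bar> \<le> \<bar>?s\<bar> * tent x powr \<alpha> + \<bar>?t\<bar> * tent y powr \<alpha>"
      by (rule order_trans[OF abs_triangle_ineq4]) (simp add: abs_mult)
    also have "\<dots> \<le> 1 * norm (x - y) powr \<alpha> + 1 * norm (x - y) powr \<alpha>"
      using sum tent_bounds \<alpha> by (intro add_mono mult_mono s1 powr_mono2) auto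
    finally show ?thesis by simp
  next
    case False
    have z: "tent v = 0" if "sgn (v $ 1 * v $ 2) = 0" for v
      using that tent_bounds[of v] by (auto simp: sgn_zero_iff)
    have "\<bar>?s * tent x powr \<alpha> - ?t * tent y powr \<alpha>\<bar> \<le> \<bar>tent x powr \<alpha> - tent y powr \<alpha>\<bar>"
      using False z[of x] z[of y] by (auto simp: sgn_if split: if_splits)
    also have "\<dots> \<le> \<bar>tent x - tent y\<bar> powr \<alpha>" using tent_bounds \<alpha> by (intro powr_diff_le) auto
    also have "\<dots> \<le> norm (x - y) powr \<alpha>" using tent_Lipschitz \<alpha> by (intro powr_mono2) auto
    finally show ?thesis by (rule order_trans) simp
  qed
  then have "c * \<bar>?s * tent x powr \<alpha> - ?t * tent y powr \<alpha>\<bar> \<le> c * (2 * norm (x - y) powr \<alpha>)"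
    using c by (intro mult_left_mono) auto
  then show "\<bar>datum \<alpha> c x - datum \<alpha> c y\<bar> \<le> 2 * c * norm (x - y) powr \<alpha>"
    using c by (simp add: datum_def right_diff_distrib[symmetric] abs_mult mult_ac)
qed

lemma datum_compact_support: "compactly_supported (datum \<alpha> c)"
proof -
  have "{x. datum \<alpha> c x \<noteq> 0} \<subseteq> cball 0 2"
    by (auto simp: datum_def tent_def)
  then have "bounded {x. datum \<alpha> c x \<noteq> 0}" using bounded_cball bounded_subset by blast
  then show ?thesis by (simp add: compactly_supported_def compact_closure)
qed

lemma datum_profile:
  assumes "norm x \<le> 1"
  shows "datum \<alpha> c x = c * (sgn (x $ 1 * x $ 2) * (min \<bar>x $ 1\<bar> \<bar>x $ 2\<bar>) powr \<alpha>)"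
proof -
  have "tent x = min \<bar>x $ 1\<bar> \<bar>x $ 2\<bar>"
    using component_le_norm_cart[of x 1] assms by (auto simp: tent_def)
  then show ?thesis by (simp add: datum_def)
qed

lemma holder_norm_le:
  assumes "holder_bound \<alpha> M f"
  shows "holder_norm \<alpha> f \<le> ennreal M + ennreal M"
  unfolding holder_norm_def
proof (intro add_mono SUP_least)
  show "ennreal \<bar>f x\<bar> \<le> ennreal M" for x using holder_boundD(1)[OF assms] by (rule ennreal_leI)
  fix p :: "(real^2) \<times> (real^2)" assume "p \<in> {(x, y). x \<noteq> y}"
  then obtain x y where p: "p = (x, y)" "x \<noteq> y" by auto
  then have "\<bar>f x - f y\<bar> / norm (x - y) powr \<alpha> \<le> M"
    using holder_boundD(2)[OF assms, of x y] by (simp add: pos_divide_le_eq)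
  then show "(case p of (x, y) \<Rightarrow> ennreal (\<bar>f x - f y\<bar> / norm (x - y) powr \<alpha>)) \<le> ennreal M"
    using p by (auto intro: ennreal_leI)
qed

lemma holder_bound_of_norm:
  assumes le: "holder_norm \<alpha> f \<le> ennreal M" and M: "0 \<le> M"
  shows "holder_bound \<alpha> M f"
  unfolding holder_bound_def
proof (intro conjI allI)
  let ?a = "SUP x. ennreal \<bar>f x\<bar>"
  let ?b = "SUP (x, y) \<in> {(x, y). x \<noteq> y}. ennreal (\<bar>f x - f y\<bar> / norm (x - y) powr \<alpha>)"
  have "?a \<le> ?a + ?b" "?b \<le> ?a + ?b" by auto
  then have ab: "?a \<le> ennreal M" "?b \<le> ennreal M" using le unfolding holder_norm_def by (meson order_trans)+
  fix x y :: "real^2"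
  have "ennreal \<bar>f x\<bar> \<le> ?a" by (rule SUP_upper) simp
  then show "\<bar>f x\<bar> \<le> M" using ab(1) M order_trans ennreal_le_iff by metis
  show "\<bar>f x - f y\<bar> \<le> M * norm (x - y) powr \<alpha>"
  proof (cases "x = y")
    case False
    have "(case (x, y) of (x, y) \<Rightarrow> ennreal (\<bar>f x - f y\<bar> / norm (x - y) powr \<alpha>)) \<le> ?b"
      by (rule SUP_upper) (use False in simp)
    then have "ennreal (\<bar>f x - f y\<bar> / norm (x - y) powr \<alpha>) \<le> ennreal M" using ab(2) by simp
    then have "\<bar>f x - f y\<bar> / norm (x - y) powr \<alpha> \<le> M" using M by (simp add: ennreal_le_iff)
    then show ?thesis using False by (simp add: pos_divide_le_eq)
  qed simp
qed

lemma holder_bound_mono: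
  assumes "holder_bound \<alpha> M f" "M \<le> M'" shows "holder_bound \<alpha> M' f"
  unfolding holder_bound_def
proof (intro conjI allI)
  fix x y
  show "\<bar>f x\<bar> \<le> M'" using holder_boundD(1)[OF assms(1), of x] assms(2) by linarith
  have "M * norm (x - y) powr \<alpha> \<le> M' * norm (x - y) powr \<alpha>" using assms(2) by (intro mult_right_mono) auto
  then show "\<bar>f x - f y\<bar> \<le> M' * norm (x - y) powr \<alpha>"
    using holder_boundD(2)[OF assms(1), of x y] by linarith
qed

theorem corollary1p1:
  fixes \<alpha> \<epsilon> :: real
  assumes "0 < \<alpha>" and "\<alpha> < 1" and "0 < \<epsilon>"
  shows "\<exists>\<theta>0 :: real^2 \<Rightarrow> real.
    \<theta>0 \<in> holder_space \<alpha> \<and> compactly_supported \<theta>0 \<and> odd_odd \<theta>0 \<and>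
    holder_norm \<alpha> \<theta>0 < ennreal \<epsilon> \<and>
    (\<forall>\<delta>>0. \<not> (\<exists>\<theta> :: real \<Rightarrow> real^2 \<Rightarrow> real.
        gsqg_solution \<alpha> \<delta> \<theta>0 \<theta> \<and>
        (\<forall>t\<in>{0..\<delta>}. odd_odd (\<theta> t)) \<and>
        \<theta> \<in> Linfty_holder \<alpha> \<delta>))"
proof -
  \<comment> \<open>The Hoelder norm of the datum is at most \<open>4 c\<close>.\<close>
  define c where "c = \<epsilon> / 8"
  have c: "0 < c" using assms by (simp add: c_def)
  note hold0 = datum_holder[OF assms(1,2) c]
  have "holder_norm \<alpha> (datum \<alpha> c) \<le> ennreal (2 * c) + ennreal (2 * c)" by (rule holder_norm_le[OF hold0])
  also have "\<dots> = ennreal (\<epsilon> / 2)" using c by (simp add: ennreal_plus[symmetric] c_def del: ennreal_plus)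
  also have "\<dots> < ennreal \<epsilon>" using assms by (intro ennreal_lessI) auto
  finally have small: "holder_norm \<alpha> (datum \<alpha> c) < ennreal \<epsilon>" .
  then have "datum \<alpha> c \<in> holder_space \<alpha>"
    unfolding holder_space_def by (auto intro: less_trans)
  moreover have False
    if \<delta>: "0 < \<delta>" and sol: "gsqg_solution \<alpha> \<delta> (datum \<alpha> c) \<theta>" and odd: "\<forall>t\<in>{0..\<delta>}. odd_odd (\<theta> t)"
      and lin: "\<theta> \<in> Linfty_holder \<alpha> \<delta>" for \<delta> and \<theta> :: "real \<Rightarrow> real^2 \<Rightarrow> real"
  proof -
    have meas: "(\<lambda>(t, x). \<theta> t x) \<in> borel_measurable (lebesgue_on ({0..\<delta>} \<times> UNIV))"
      using lin by (simp add: Linfty_holder_def)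
    obtain M0 where M0: "AE t in lebesgue_on {0..\<delta>}. \<theta> t \<in> holder_space \<alpha> \<and> holder_norm \<alpha> (\<theta> t) \<le> ennreal M0"
      using lin by (auto simp: Linfty_holder_def)
    define M where "M = max M0 (2 * c)"
    have M: "0 \<le> M" "2 * c \<le> M" using c by (auto simp: M_def)
    have hold: "AE t in lebesgue_on {0..\<delta>}. holder_bound \<alpha> M (\<theta> t)"
      using M0
    proof eventually_elim
      case (elim t)
      have "ennreal M0 \<le> ennreal M" by (rule ennreal_leI) (simp add: M_def)
      with elim have "holder_norm \<alpha> (\<theta> t) \<le> ennreal M" by (blast intro: order_trans)
      then show ?case by (rule holder_bound_of_norm[OF _ M(1)])
    qed
    obtain u where vel: "AE t in lebesgue_on {0..\<delta>}. has_velocity \<alpha> (\<theta> t) (u t)"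
      and weak: "\<forall>\<phi>\<in>test_functions \<delta>. has_bochner_integral (lebesgue_on ({0..\<delta>} \<times> UNIV))
          (\<lambda>(t, x). \<theta> t x * (deriv (\<lambda>s. \<phi> (s, x)) t + frechet_derivative (\<lambda>y. \<phi> (t, y)) (at x) (u t x)))
          (- (LINT x | lebesgue. datum \<alpha> c x * \<phi> (0, x)))"
      using sol unfolding gsqg_solution_def by blast
    have "AE t in lebesgue_on {0..\<delta>}. \<forall>x. \<bar>\<theta> t x\<bar> \<le> M"
      using hold by eventually_elim (auto dest: holder_boundD(1))
    then obtain w where w: "w \<in> borel_measurable borel" "\<And>p. \<bar>w p\<bar> \<le> M"
      "AE p in lborel. fst p \<in> {0..\<delta>} \<longrightarrow> \<theta> (fst p) (snd p) = w p"
      "AE t in lborel. t \<in> {0..\<delta>} \<longrightarrow> (AE x in lborel. \<theta> t x = w (t, x))"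
      using borel_representative[OF meas _ M(1)] by blast
    have I: "{0..\<delta>} \<in> sets borel" by simp
    have "holder_solution \<alpha> \<delta> M (datum \<alpha> c) \<theta> u w"
    proof
      show "holder_bound \<alpha> M (datum \<alpha> c)" by (rule holder_bound_mono[OF hold0 M(2)])
      show "AE t in lborel. t \<in> {0..\<delta>} \<longrightarrow> odd_odd (\<theta> t) \<and> holder_bound \<alpha> M (\<theta> t) \<and>
          has_velocity \<alpha> (\<theta> t) (u t) \<and> (AE x in lborel. \<theta> t x = w (t, x))"
        using hold[unfolded AE_lebesgue_on_iff[OF I]] vel[unfolded AE_lebesgue_on_iff[OF I]] w(4)
        by eventually_elim (use odd in blast)
    qed (use assms \<delta> M w weak in blast)+
    then show False
      by (rule holder_solution.no_holder_solution[OF _ c datum_profile])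
  qed
  ultimately show ?thesis
    using datum_compact_support datum_odd small by blast
qed

end
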